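(* Let $H,G^1,\dots,G^d:\mathbb{R}^d\to\mathbb{R}^d$ be bounded, locally Lipschitz and of sub-linear growth ($|H(\xi)|\le C_H(1+|\xi|)$, $|G^\ell(\xi)|\le C_G^\ell(1+|\xi|)$), and let $\mathcal{L}:\mathbb{R}^{dm}\times\mathcal{P}_1(\mathbb{R}^d)\to[0,\infty)$ be a continuous function such that whenever $(\mu_j)_{j\in\mathbb{N}}$ converges narrowly to $\mu$, then $\mathcal{L}(Y,\mu_j)\to\mathcal{L}(Y,\mu)$ uniformly. Let $\mathcal{U}\subset\mathbb{R}^{md}$ be nonempty and compact. Let an initial datum $(Y^0,\mu^0)\in\chi$ and an approximating sequence $\mu_N^0=\frac1N\sum_{i=1}^N\delta_{X^0_{i,N}}$ with $\mathcal{W}_1(\mu_N^0,\mu^0)\to0$ be given, with $\mu^0$ and $\mu_N^0$ equi-compactly supported for all $N\in\mathbb{N}$. For $\mathbf{u}\in L^\infty([0,T],\mathcal{U})$ set $$J_N(\mathbf{u})=\int_0^T\Big(\mathcal{L}(Y_N(t),\mu_N(t))+\sum_{k=1}^m|\mathbf{u}_k(t)|^2\Big)dt,\qquad J(\mathbf{u})=\int_0^T\Big(\mathcal{L}(Y(t),\mu(t))+\sum_{k=1}^m|\mathbf{u}_k(t)|^2\Big)dt,$$ where $(Y_N,\mu_N)$, with $\mu_N(t)=\frac1N\sum_{i=1}^N\delta_{X_i(t)}$, is given by the solution with control $\mathbf{u}$ and initial datum $(Y^0,X_N^0)$ of $$\begin{cases}\dot Y_k=\mathbf{u}_k,& k=1,\dots,m,\\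 \dot X_i=(H*\mu_N)(X_i)+\sum_{\ell=1}^d(G^\ell*\mu_{m\,\ell})(X_i),& i=1,\dots,N,\end{cases}$$ and $(Y,\mu)$ is the solution with control $\mathbf{u}$ and initial datum $(Y^0,\mu^0)$ of $$\begin{cases}\dot Y_k=\mathbf{u}_k,& k=1,\dots,m,\\ \partial_t\mu+\nabla\cdot\Big[\big(H*\mu+\sum_{\ell=1}^dG^\ell*\mu_{m\,\ell}\big)\mu\Big]=0.\end{cases}$$ Then the sequence $(J_N)$ $\Gamma$-converges to $J$ on $L^\infty([0,T],\mathcal{U})$ (with respect to $L^\infty$ convergence of controls).
   Context: $\mathcal{P}_1(\mathbb{R}^d)$: Borel probability measures with finite first moment; $\mathcal{W}_1$: 1-Wasserstein distance; $\chi:=\mathbb{R}^{dm}\times\mathcal{P}_1(\mathbb{R}^d)$ with the metric $\|(Y,\mu)-(Y',\mu')\|_\chi:=\frac1m\sum_{k=1}^m|Y_k-Y_k'|+\mathcal{W}_1(\mu,\mu')$. Write $\mathbf{u}_k=(u_{k\,1},\dots,u_{k\,d})\in\mathbb{R}^d$, $\mu_{m\,\ell}(t)=\frac1m\sum_{k=1}^m u_{k\,\ell}(t)\,\delta_{Y_k(t)}$, $X_N^0=(X^0_{1,N},\dots,X^0_{N,N})$, and $(F*\nu)(x)=\int F(x-\xi)\,d\nu(\xi)$. Solutions of the finite-dimensional system are Carathéodory solutions. Solution of the PDE system: for a control $\mathbf{u}\in L^\infty([0,T],\mathcal{U})$, a map $(Y,\mu):[0,T]\to\chi$ is a solution if: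 (i) there is $R>0$ with $\mathrm{supp}\,\mu(t)\subset B(0,R)$ for all $t\in[0,T]$; (ii) it is continuous in time with respect to $\|\cdot\|_\chi$; (iii) $Y$ is a Carathéodory solution of $\dot Y_k=\mathbf{u}_k$; (iv) for every $\varphi\in C_c^\infty(\mathbb{R}^d)$, $\frac{d}{dt}\int\varphi\,d\mu(t)=\int\nabla\varphi(x)\cdot\big((H*\mu(t))(x)+\sum_{\ell=1}^d(G^\ell*\mu_{m\,\ell}(t))(x)\big)\,d\mu(t)(x)$. $\Gamma$-convergence means: for every $\mathbf{u}_N\to\mathbf{u}$ one has $\liminf_N J_N(\mathbf{u}_N)\ge J(\mathbf{u})$, and for every $\mathbf{u}$ there is a sequence $\mathbf{u}_N\to\mathbf{u}$ with $\limsup_N J_N(\mathbf{u}_N)\le J(\mathbf{u})$. *)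

theory Defs
  imports "HOL-Probability.Probability"
begin

section \<open>Probability measures with finite first moment\<close>

definition P1 :: "'a::euclidean_space measure set" where
  "P1 = {\<mu>. prob_space \<mu> \<and> sets \<mu> = sets borel \<and> integrable \<mu> norm}"

definition couplings ::
    "'a::euclidean_space measure \<Rightarrow> 'a measure \<Rightarrow> ('a \<times> 'a) measure set" where
  "couplings \<mu> \<nu> = {\<pi>. prob_space \<pi> \<and> sets \<pi> = sets borel \<and>
      distr \<pi> borel fst = \<mu> \<and> distr \<pi> borel snd = \<nu>}"

text \<open>
  Only meaningful for measures in \<^const>\<open>P1\<close>: there the set of couplings is nonempty and the
  distance is integrable with respect to each of them.
\<close>

definition W1 :: "'a::euclidean_space measure \<Rightarrow> 'a measure \<Rightarrow> real" where
  "W1 \<mu> \<nu> = (INF \<pi>\<in>couplings \<mu> \<nu>. \<integral>z. dist (fst z) (snd z) \<partial>\<pi>)"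

definition measure_support :: "'a::topological_space measure \<Rightarrow> 'a set" where
  "measure_support \<mu> = {x. \<forall>S. open S \<longrightarrow> x \<in> S \<longrightarrow> emeasure \<mu> S > 0}"

definition narrowly_converges ::
    "(nat \<Rightarrow> 'a::euclidean_space measure) \<Rightarrow> 'a measure \<Rightarrow> bool" where
  "narrowly_converges \<mu>s \<mu> \<longleftrightarrow>
     (\<forall>f :: 'a \<Rightarrow> real. continuous_on UNIV f \<longrightarrow> bounded (range f) \<longrightarrow>
        (\<lambda>j. \<integral>x. f x \<partial>(\<mu>s j)) \<longlonglongrightarrow> (\<integral>x. f x \<partial>\<mu>))"

text \<open>
  The empirical measure \<open>(1/N) \<Sum>\<^sub>i \<delta>\<^bsub>X i\<^esub>\<close> of \<open>X 0, \<dots>, X (N - 1)\<close> (particles are numbered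
  from \<open>0\<close>), written as the law of \<open>X\<close> under the uniform distribution on the indices.
\<close>

definition empirical :: "nat \<Rightarrow> (nat \<Rightarrow> 'a::euclidean_space) \<Rightarrow> 'a measure" where
  "empirical N X = distr (uniform_count_measure {..<N}) borel X"

text \<open>
  The space \<open>\<chi>\<close> is the set of pairs \<open>(Y, \<mu>)\<close> with \<open>\<mu> \<in> P1\<close>.  The index type \<open>'m\<close> numbers the
  \<open>m = CARD('m)\<close> controlled agents and \<open>'d\<close> the coordinates of the state space.
\<close>

definition chi_dist ::
    "((real^'d)^'m) \<times> (real^'d) measure \<Rightarrow> ((real^'d)^'m) \<times> (real^'d) measure \<Rightarrow> real" where
  "chi_dist p q =
     (\<Sum>k\<in>UNIV. norm (fst p $ k - fst q $ k)) / real CARD('m) + W1 (snd p) (snd q)"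

definition continuous_on_chi ::
    "((real^'d)^'m \<Rightarrow> (real^'d) measure \<Rightarrow> real) \<Rightarrow> bool" where
  "continuous_on_chi L \<longleftrightarrow>
     (\<forall>Y. \<forall>\<mu>\<in>P1. \<forall>\<epsilon>>0. \<exists>\<delta>>0. \<forall>Y'. \<forall>\<mu>'\<in>P1.
        chi_dist (Y', \<mu>') (Y, \<mu>) < \<delta> \<longrightarrow> \<bar>L Y' \<mu>' - L Y \<mu>\<bar> < \<epsilon>)"


section \<open>Differential equations in the sense of Caratheodory\<close>

text \<open>
  In the sums below \<open>D\<close> is a finite family of compact intervals with disjoint interiors.
\<close>

definition abs_continuous_on :: "real \<Rightarrow> real \<Rightarrow> (real \<Rightarrow> 'a::real_normed_vector) \<Rightarrow> bool" where
  "abs_continuous_on a b f \<longleftrightarrow>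
     (\<forall>\<epsilon>>0. \<exists>\<delta>>0. \<forall>D. D division_of \<Union>D \<longrightarrow> \<Union>D \<subseteq> {a..b} \<longrightarrow>
        (\<Sum>K\<in>D. Sup K - Inf K) < \<delta> \<longrightarrow> (\<Sum>K\<in>D. norm (f (Sup K) - f (Inf K))) < \<epsilon>)"

text \<open>
  \<open>y\<close> is a Caratheodory solution of \<open>y' = g\<close> on \<open>[0,T]\<close>; for an equation \<open>y' = F(t, y)\<close> the
  right-hand side \<open>g t\<close> is \<open>F(t, y t)\<close>.
\<close>

definition caratheodory :: "real \<Rightarrow> (real \<Rightarrow> 'a::real_normed_vector) \<Rightarrow> (real \<Rightarrow> 'a) \<Rightarrow> bool" where
  "caratheodory T y g \<longleftrightarrow> abs_continuous_on 0 T y \<and>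
     (AE t in lebesgue_on {0..T}. (y has_vector_derivative g t) (at t within {0..T}))"


section \<open>Test functions\<close>

definition gradient :: "(real^'d \<Rightarrow> real) \<Rightarrow> real^'d \<Rightarrow> real^'d" where
  "gradient \<phi> x = (\<chi> i. frechet_derivative \<phi> (at x) (axis i 1))"

primrec C_k :: "nat \<Rightarrow> (real^'d \<Rightarrow> real) \<Rightarrow> bool" where
  "C_k 0 \<phi> \<longleftrightarrow> continuous_on UNIV \<phi>"
| "C_k (Suc k) \<phi> \<longleftrightarrow> (\<forall>x. \<phi> differentiable (at x)) \<and> (\<forall>i. C_k k (\<lambda>x. gradient \<phi> x $ i))"

definition test_functions :: "(real^'d \<Rightarrow> real) set" where
  "test_functions = {\<phi>. (\<forall>k. C_k k \<phi>) \<and> compact (closure {x. \<phi> x \<noteq> 0})}"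


section \<open>The controlled particle system and its mean-field limit\<close>

definition convolve :: "(real^'d \<Rightarrow> real^'d) \<Rightarrow> (real^'d) measure \<Rightarrow> real^'d \<Rightarrow> real^'d" where
  "convolve F \<nu> x = (\<integral>\<xi>. F (x - \<xi>) \<partial>\<nu>)"

text \<open>
  Convolution with the signed (hence not expressible as a \<^typ>\<open>'a measure\<close>) atomic measure
  \<open>\<Sum>\<^sub>k w\<^sub>k \<delta>\<^bsub>y k\<^esub>\<close>.
\<close>

definition convolve_atomic ::
    "(real^'d \<Rightarrow> real^'d) \<Rightarrow> ('m::finite \<Rightarrow> real) \<Rightarrow> ('m \<Rightarrow> real^'d) \<Rightarrow> real^'d \<Rightarrow> real^'d" where
  "convolve_atomic F w y x = (\<Sum>k\<in>UNIV. w k *\<^sub>R F (x - y k))"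

text \<open>
  The field \<open>H * \<mu> + \<Sum>\<^sub>l G\<^sup>l * \<mu>\<^sub>m\<^sub>l\<close> with \<open>\<mu>\<^sub>m\<^sub>l = (1/m) \<Sum>\<^sub>k u\<^sub>k\<^sub>l \<delta>\<^bsub>Y k\<^esub>\<close>, at a fixed time.
\<close>

definition velocity ::
    "(real^'d \<Rightarrow> real^'d) \<Rightarrow> ('d \<Rightarrow> real^'d \<Rightarrow> real^'d) \<Rightarrow>
     (real^'d)^'m \<Rightarrow> (real^'d)^'m \<Rightarrow> (real^'d) measure \<Rightarrow> real^'d \<Rightarrow> real^'d" where
  "velocity H G u Y \<mu> x = convolve H \<mu> x +
     (\<Sum>l\<in>UNIV. convolve_atomic (G l) (\<lambda>k. (u $ k $ l) / real CARD('m)) (\<lambda>k. Y $ k) x)"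

definition particle_solution ::
    "real \<Rightarrow> (real^'d \<Rightarrow> real^'d) \<Rightarrow> ('d \<Rightarrow> real^'d \<Rightarrow> real^'d) \<Rightarrow> nat \<Rightarrow>
     (real^'d)^'m \<Rightarrow> (nat \<Rightarrow> real^'d) \<Rightarrow> (real \<Rightarrow> (real^'d)^'m) \<Rightarrow>
     (real \<Rightarrow> (real^'d)^'m) \<Rightarrow> (nat \<Rightarrow> real \<Rightarrow> real^'d) \<Rightarrow> bool" where
  "particle_solution T H G N Y0 X0 u Y X \<longleftrightarrow>
     Y 0 = Y0 \<and> (\<forall>i<N. X i 0 = X0 i) \<and>
     caratheodory T Y u \<and>
     (\<forall>i<N. caratheodory T (X i)
        (\<lambda>t. velocity H G (u t) (Y t) (empirical N (\<lambda>j. X j t)) (X i t)))"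

text \<open>
  As controls are only measurable in time, the weak form of the continuity equation is required
  in the same sense as the ordinary differential equations: the map \<open>t \<mapsto> \<integral>\<phi> d\<mu>(t)\<close> is
  absolutely continuous with the prescribed derivative at almost every time.
\<close>

definition pde_solution ::
    "real \<Rightarrow> (real^'d \<Rightarrow> real^'d) \<Rightarrow> ('d \<Rightarrow> real^'d \<Rightarrow> real^'d) \<Rightarrow>
     (real^'d)^'m \<Rightarrow> (real^'d) measure \<Rightarrow> (real \<Rightarrow> (real^'d)^'m) \<Rightarrow>
     (real \<Rightarrow> (real^'d)^'m) \<Rightarrow> (real \<Rightarrow> (real^'d) measure) \<Rightarrow> bool" where
  "pde_solution T H G Y0 \<mu>0 u Y \<mu> \<longleftrightarrow>
     Y 0 = Y0 \<and> \<mu> 0 = \<mu>0 \<and> (\<forall>t\<in>{0..T}. \<mu> t \<in> P1) \<and>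
     (\<exists>R>0. \<forall>t\<in>{0..T}. measure_support (\<mu> t) \<subseteq> ball 0 R) \<and>
     (\<forall>t\<in>{0..T}. ((\<lambda>s. chi_dist (Y s, \<mu> s) (Y t, \<mu> t)) \<longlongrightarrow> 0) (at t within {0..T})) \<and>
     caratheodory T Y u \<and>
     (\<forall>\<phi>\<in>test_functions. caratheodory T (\<lambda>t. \<integral>x. \<phi> x \<partial>\<mu> t)
        (\<lambda>t. \<integral>x. gradient \<phi> x \<bullet> velocity H G (u t) (Y t) (\<mu> t) x \<partial>\<mu> t))"


section \<open>Controls and cost functionals\<close>

text \<open>
  Elements of \<open>L\<^sup>\<infinity>([0,T], U)\<close> are represented by functions rather than by classes modulo almost
  everywhere equality.
\<close>

definition Linf :: "real \<Rightarrow> 'a::euclidean_space set \<Rightarrow> (real \<Rightarrow> 'a) set" where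
  "Linf T U = {u. u \<in> borel_measurable (lebesgue_on {0..T}) \<and>
     esssup (lebesgue_on {0..T}) (\<lambda>t. ereal (norm (u t))) < \<infinity> \<and>
     (AE t in lebesgue_on {0..T}. u t \<in> U)}"

definition Linf_converges ::
    "real \<Rightarrow> (nat \<Rightarrow> real \<Rightarrow> 'a::euclidean_space) \<Rightarrow> (real \<Rightarrow> 'a) \<Rightarrow> bool" where
  "Linf_converges T us u \<longleftrightarrow>
     (\<lambda>n. esssup (lebesgue_on {0..T}) (\<lambda>t. ereal (norm (us n t - u t)))) \<longlonglongrightarrow> 0"

definition cost ::
    "real \<Rightarrow> ((real^'d)^'m \<Rightarrow> (real^'d) measure \<Rightarrow> real) \<Rightarrow> (real \<Rightarrow> (real^'d)^'m) \<Rightarrow>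
     (real \<Rightarrow> (real^'d)^'m) \<Rightarrow> (real \<Rightarrow> (real^'d) measure) \<Rightarrow> real" where
  "cost T L u Y \<mu> =
     (\<integral>t. L (Y t) (\<mu> t) + (\<Sum>k\<in>UNIV. (norm (u t $ k))\<^sup>2) \<partial>lebesgue_on {0..T})"

text \<open>
  The cost of the solution with control \<open>u\<close>.  A solution is determined by its control and initial
  datum on \<open>[0,T]\<close>, but not as a HOL function outside this interval, so the definite description
  is applied to the cost and not to the solution itself.
\<close>

definition J_particle ::
    "real \<Rightarrow> (real^'d \<Rightarrow> real^'d) \<Rightarrow> ('d \<Rightarrow> real^'d \<Rightarrow> real^'d) \<Rightarrow>
     ((real^'d)^'m \<Rightarrow> (real^'d) measure \<Rightarrow> real) \<Rightarrow>
     (real^'d)^'m \<Rightarrow> nat \<Rightarrow> (nat \<Rightarrow> real^'d) \<Rightarrow> (real \<Rightarrow> (real^'d)^'m) \<Rightarrow> real" where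
  "J_particle T H G L Y0 N X0 u =
     (THE c. \<exists>Y X. particle_solution T H G N Y0 X0 u Y X \<and>
        c = cost T L u Y (\<lambda>t. empirical N (\<lambda>i. X i t)))"

definition J_pde ::
    "real \<Rightarrow> (real^'d \<Rightarrow> real^'d) \<Rightarrow> ('d \<Rightarrow> real^'d \<Rightarrow> real^'d) \<Rightarrow>
     ((real^'d)^'m \<Rightarrow> (real^'d) measure \<Rightarrow> real) \<Rightarrow>
     (real^'d)^'m \<Rightarrow> (real^'d) measure \<Rightarrow> (real \<Rightarrow> (real^'d)^'m) \<Rightarrow> real" where
  "J_pde T H G L Y0 \<mu>0 u =
     (THE c. \<exists>Y \<mu>. pde_solution T H G Y0 \<mu>0 u Y \<mu> \<and> c = cost T L u Y \<mu>)"

definition Gamma_converges ::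
    "'a set \<Rightarrow> ((nat \<Rightarrow> 'a) \<Rightarrow> 'a \<Rightarrow> bool) \<Rightarrow> (nat \<Rightarrow> 'a \<Rightarrow> ereal) \<Rightarrow> ('a \<Rightarrow> ereal) \<Rightarrow> bool" where
  "Gamma_converges A conv J J0 \<longleftrightarrow>
     (\<forall>u\<in>A. \<forall>us. range us \<subseteq> A \<longrightarrow> conv us u \<longrightarrow> J0 u \<le> liminf (\<lambda>n. J n (us n))) \<and>
     (\<forall>u\<in>A. \<exists>us. range us \<subseteq> A \<and> conv us u \<and> limsup (\<lambda>n. J n (us n)) \<le> J0 u)"

end

theory Submission
  imports Defs
begin

text \<open>
  The particle system is the mean-field equation started from an empirical measure, so both costs
  are values of one functional of the initial measure and the control.  The theorem holds because
  this functional is continuous: along every sequence of controls converging in \<open>L\<^sup>\<infinity>\<close> the particle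
  costs converge to the cost of the limit (\<open>J_pde_convergence\<close>, \<open>J_particle_eq\<close>).  The inequality
  for the lower limit follows, and constant sequences are recovery sequences.

  Stability (\<open>weak_solution_stability\<close>).  Solutions are compared in the dual distance \<open>lipdist\<close>, the
  supremum of \<open>\<integral>\<phi> d\<mu> - \<integral>\<phi> d\<nu>\<close> over 1-Lipschitz \<open>\<phi>\<close>.  It is bounded by \<open>W1\<close>, and for measures carried
  by one ball convergence in it implies narrow convergence, under which the running cost converges.
  The weak form of the equation only accepts smooth test functions; hence the
  Lipschitz functions are first mollified at a scale \<open>\<epsilon>\<close>.  For a fixed mollifier, the weak form shows
  that over a short interval \<open>[s, s + d]\<close> the integrals of mollified functions change, up to
  \<open>o(d)\<close>, as if \<open>\<mu> s\<close> were moved by the single Euler step \<open>x \<mapsto> x + d w(x)\<close>, where \<open>w\<close> is the velocity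
  field at time \<open>s\<close> with the control replaced by its mean over the interval (\<open>euler_step\<close>).  Passing to the mean is possible
  because the velocity is affine in the control.  Mollification commutes with an Euler step up to
  \<open>O(d \<epsilon>)\<close>, since \<open>w\<close> is Lipschitz, and composition with the step enlarges Lipschitz
  constants by a factor \<open>1 + O(d)\<close>.  So the mollified distance \<open>\<Delta>\<close> of two solutions satisfies
  \<open>\<Delta>(s + d) \<le> \<Delta>(s) + d (c \<Delta>(s) + O(\<epsilon>) + O(\<parallel>u - u'\<parallel>)) + o(d)\<close> (\<open>moll_dist_step\<close>), and a Gronwall
  argument followed by \<open>\<epsilon> \<rightarrow> 0\<close> bounds \<open>lipdist\<close> at all times.  Equal data give equal
  costs, so the descriptions in \<open>J_particle\<close> and \<open>J_pde\<close> denote the cost of any solution.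

  Existence (\<open>solutions_exist\<close>).  The characteristics \<open>X(t, x)\<close> are the fixed point of a contraction
  on bounded continuous displacements.  Almost every time is a point of
  differentiability of \<open>\<integral>u\<close>, and at such a time all characteristics are differentiable at once.
  Therefore the image of the initial measure under \<open>X(t, \<cdot>)\<close> solves the equation, and for an
  empirical initial measure the characteristics of its atoms solve the particle system.

  Localisation.  Fields and controls are bounded, so solutions stay in a ball that is independent
  of the number of particles.  Composing the fields with the projection onto a larger
  ball makes them globally Lipschitz without changing the solutions.

  Cost.  Convergence of the states is uniform in time, and continuity of the
  running cost together with compactness of \<open>[0, T]\<close> makes the convergence of the running cost
  uniform in time as well (\<open>L_uniform\<close>).
\<close>

section \<open>Absolutely continuous functions and Caratheodory solutions\<close>

lemma AE_lebesgue_on_negligible: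
  assumes S: "S \<in> sets lebesgue"
  shows "(AE t in lebesgue_on S. P t) \<longleftrightarrow> (\<exists>N. negligible N \<and> (\<forall>t\<in>S - N. P t))"
proof -
  have "(AE t in lebesgue_on S. P t) \<longleftrightarrow> (AE t in lebesgue. t \<in> S \<longrightarrow> P t)"
    using S by (simp add: AE_restrict_space_iff)
  also have "\<dots> \<longleftrightarrow> (\<exists>N. negligible N \<and> {t. \<not> (t \<in> S \<longrightarrow> P t)} \<subseteq> N)"
    by (rule eventually_ae_filter_negligible)
  also have "\<dots> \<longleftrightarrow> (\<exists>N. negligible N \<and> (\<forall>t\<in>S - N. P t))"
    by (intro arg_cong[where f=Ex] ext) auto
  finally show ?thesis .
qed

lemma has_vector_derivative_straddle:
  fixes f :: "real \<Rightarrow> 'a::real_normed_vector"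
  assumes "(f has_vector_derivative g) (at t within S)" "0 < e"
  obtains d where "0 < d"
    "\<And>u v. u \<in> S \<Longrightarrow> v \<in> S \<Longrightarrow> u \<le> t \<Longrightarrow> t \<le> v \<Longrightarrow> \<bar>u - t\<bar> < d \<Longrightarrow> \<bar>v - t\<bar> < d \<Longrightarrow>
       norm (f v - f u - (v - u) *\<^sub>R g) \<le> e * (v - u)"
proof -
  from assms obtain d where d: "0 < d"
    "\<And>y. y \<in> S \<Longrightarrow> \<bar>y - t\<bar> < d \<Longrightarrow> norm (f y - f t - (y - t) *\<^sub>R g) \<le> e * \<bar>y - t\<bar>"
    unfolding has_vector_derivative_def has_derivative_within_alt by (metis real_norm_def)
  show thesis
  proof (rule that[OF d(1)])
    fix u v assume *: "u \<in> S" "v \<in> S" "u \<le> t" "t \<le> v" "\<bar>u - t\<bar> < d" "\<bar>v - t\<bar> < d"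
    have "f v - f u - (v - u) *\<^sub>R g = (f v - f t - (v - t) *\<^sub>R g) - (f u - f t - (u - t) *\<^sub>R g)"
      by (simp add: algebra_simps)
    also have "norm \<dots> \<le> e * \<bar>v - t\<bar> + e * \<bar>u - t\<bar>"
      using d(2)[of v] d(2)[of u] * by (intro order_trans[OF norm_triangle_ineq4 add_mono]) auto
    also have "\<dots> = e * (v - u)" using * by (simp add: algebra_simps)
    finally show "norm (f v - f u - (v - u) *\<^sub>R g) \<le> e * (v - u)" .
  qed
qed

text \<open>
  The fundamental theorem of calculus for absolutely continuous functions, straight from the gauge
  definition of the integral.  At a point of differentiability the gauge makes increments close to
  \<open>g t\<close> times the length.  At an exceptional point it keeps the interval inside an open
  set of small measure, and absolute continuity makes the sum of these increments small.
\<close>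

lemma abs_continuous_has_integral:
  fixes f :: "real \<Rightarrow> 'a::euclidean_space"
  assumes car: "caratheodory T f g" and ab: "0 \<le> a" "a \<le> b" "b \<le> T"
  shows "(g has_integral (f b - f a)) {a..b}"
proof -
  have ac: "abs_continuous_on 0 T f"
    and "AE t in lebesgue_on {0..T}. (f has_vector_derivative g t) (at t within {0..T})"
    using car unfolding caratheodory_def by auto
  then obtain N where N: "negligible N"
    and deriv: "\<And>t. t \<in> {0..T} - N \<Longrightarrow> (f has_vector_derivative g t) (at t within {0..T})"
    by (subst (asm) AE_lebesgue_on_negligible) auto
  define h where "h = (\<lambda>t. if t \<in> N then 0 else g t)"
  have h: "(h has_integral (f b - f a)) (cbox a b)"
    unfolding has_integral
  proof (intro allI impI)
    fix e :: real assume e: "0 < e"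
    have e2: "0 < e / 2" using e by simp
    obtain d where d0: "0 < d"
      and "\<forall>D. D division_of \<Union>D \<longrightarrow> \<Union>D \<subseteq> {0..T} \<longrightarrow> (\<Sum>K\<in>D. Sup K - Inf K) < d \<longrightarrow>
       (\<Sum>K\<in>D. norm (f (Sup K) - f (Inf K))) < e / 2"
      using ac[unfolded abs_continuous_on_def, THEN spec, THEN mp, OF e2] by (elim exE conjE)
    then have dD: "(\<Sum>K\<in>D. norm (f (Sup K) - f (Inf K))) < e / 2"
      if "D division_of \<Union>D" "\<Union>D \<subseteq> {0..T}" "(\<Sum>K\<in>D. Sup K - Inf K) < d" for D
      using that by simp
    note d = d0 dD
    have "N \<in> sets lebesgue" using N by (rule negligible_imp_sets)
    then obtain W where W: "open W" "N \<subseteq> W" "W - N \<in> lmeasurable" "emeasure lebesgue (W - N) < ennreal d"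
      using sets_lebesgue_outer_open d(1) by metis
    have Wm: "W \<in> lmeasurable"
      using W N by (meson fmeasurable_Diff_D negligible_imp_measurable N)
    have "emeasure lebesgue W = emeasure lebesgue (W - N)"
      using N W by (simp add: emeasure_Diff_null_set negligible_iff_null_sets)
    then have "emeasure lebesgue W < ennreal d" using W by simp
    then have Wd: "measure lebesgue W < d"
      using d(1) Wm by (simp add: emeasure_eq_measure2 ennreal_less_iff)
    \<comment> \<open>The summand 1 keeps the denominator positive when \<open>a = b\<close>.\<close>
    define e' where "e' = e / (2 * (b - a) + 1)"
    have e': "0 < e'" using e ab by (simp add: e'_def)
    have "\<exists>r>0. (t \<in> N \<longrightarrow> ball t r \<subseteq> W) \<and>
        (t \<in> {0..T} - N \<longrightarrow> (\<forall>u\<in>{0..T}. \<forall>v\<in>{0..T}. u \<le> t \<longrightarrow> t \<le> v \<longrightarrow> \<bar>u - t\<bar> < r \<longrightarrow> \<bar>v - t\<bar> < r \<longrightarrow>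
          norm (f v - f u - (v - u) *\<^sub>R g t) \<le> e' * (v - u)))" for t
    proof (cases "t \<in> N")
      case True
      then show ?thesis using W(1,2) by (auto simp: open_contains_ball)
    next
      case False
      show ?thesis
      proof (cases "t \<in> {0..T}")
        case True
        then show ?thesis
          using has_vector_derivative_straddle[OF deriv[of t] e'] False by (smt (verit) DiffI)
      qed (use False in \<open>auto intro: exI[of _ 1]\<close>)
    qed
    then obtain r where r: "\<And>t. r t > 0" "\<And>t. t \<in> N \<Longrightarrow> ball t (r t) \<subseteq> W"
      "\<And>t u v. t \<in> {0..T} - N \<Longrightarrow> u \<in> {0..T} \<Longrightarrow> v \<in> {0..T} \<Longrightarrow> u \<le> t \<Longrightarrow> t \<le> v \<Longrightarrow> \<bar>u - t\<bar> < r t \<Longrightarrow> \<bar>v - t\<bar> < r t \<Longrightarrow>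
          norm (f v - f u - (v - u) *\<^sub>R g t) \<le> e' * (v - u)"
      by metis
    show "\<exists>\<gamma>. gauge \<gamma> \<and> (\<forall>D. D tagged_division_of cbox a b \<and> \<gamma> fine D \<longrightarrow>
        norm ((\<Sum>(x,k)\<in>D. measure lborel k *\<^sub>R h x) - (f b - f a)) < e)"
    proof (intro exI conjI allI impI)
      show "gauge (\<lambda>t. ball t (r t))" using r(1) by (auto simp: gauge_def)
      fix D assume D: "D tagged_division_of cbox a b \<and> (\<lambda>t. ball t (r t)) fine D"
      have fin: "finite D" using D by (auto simp: tagged_division_of_def tagged_partial_division_of_def)
      have piece: "\<exists>u v. K = {u..v} \<and> u \<le> x \<and> x \<le> v \<and> u \<in> {a..b} \<and> v \<in> {a..b} \<and>
          Inf K = u \<and> Sup K = v \<and> measure lborel K = v - u \<and> \<bar>u - x\<bar> < r x \<and> \<bar>v - x\<bar> < r x \<and> K \<subseteq> ball x (r x)"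
        if "(x, K) \<in> D" for x K
      proof -
        have "x \<in> K" "K \<subseteq> cbox a b" "\<exists>u v. K = cbox u v" "K \<subseteq> ball x (r x)"
          using D that tagged_division_ofD(2-4)[of D "cbox a b" x K] by (auto simp: fine_def)
        then obtain u v where K: "K = {u..v}" "x \<in> {u..v}" "{u..v} \<subseteq> {a..b}" "{u..v} \<subseteq> ball x (r x)"
          by auto
        then have "u \<in> {u..v}" "v \<in> {u..v}" by auto
        then have "u \<in> ball x (r x)" "v \<in> ball x (r x)" using K by blast+
        then show ?thesis using K
          by (intro exI[of _ u] exI[of _ v]) (auto simp: dist_real_def abs_minus_commute)
      qed
      have tel: "f b - f a = (\<Sum>(x,K)\<in>D. f (Sup K) - f (Inf K))"
        using additive_tagged_division_1[OF ab(2), of D f] D by auto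
      have len: "b - a = (\<Sum>(x,K)\<in>D. Sup K - Inf K)"
        using additive_tagged_division_1[OF ab(2), of D "\<lambda>x. x"] D by auto
      define Bd where "Bd = {p \<in> D. fst p \<in> N}"
      define Gd where "Gd = D - Bd"
      have split: "(\<Sum>p\<in>D. F p) = (\<Sum>p\<in>Gd. F p) + (\<Sum>p\<in>Bd. F p)" for F :: "_ \<Rightarrow> 'a"
        unfolding Gd_def using fin by (intro sum.subset_diff) (auto simp: Bd_def)
      have good: "norm (\<Sum>(x,K)\<in>Gd. measure lborel K *\<^sub>R h x - (f (Sup K) - f (Inf K))) \<le> e' * (b - a)"
      proof -
        have "norm (\<Sum>(x,K)\<in>Gd. measure lborel K *\<^sub>R h x - (f (Sup K) - f (Inf K)))
            \<le> (\<Sum>(x,K)\<in>Gd. e' * (Sup K - Inf K))"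
        proof (intro sum_norm_le, clarify)
          fix x K assume xK: "(x, K) \<in> Gd"
          then have xK': "(x,K) \<in> D" "x \<notin> N" by (auto simp: Gd_def Bd_def)
          then obtain u v where uv: "u \<le> x" "x \<le> v" "u \<in> {a..b}" "v \<in> {a..b}"
            "Inf K = u" "Sup K = v" "measure lborel K = v - u" "\<bar>u - x\<bar> < r x" "\<bar>v - x\<bar> < r x"
            using piece by metis
          have "norm (f v - f u - (v - u) *\<^sub>R g x) \<le> e' * (v - u)"
            using r(3)[of x u v] uv xK'(2) ab by auto
          then show "norm (measure lborel K *\<^sub>R h x - (f (Sup K) - f (Inf K))) \<le> e' * (Sup K - Inf K)"
            using uv xK'(2) by (simp add: h_def norm_minus_commute)
        qed
        also have "\<dots> \<le> (\<Sum>(x,K)\<in>D. e' * (Sup K - Inf K))"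
        proof (intro sum_mono2)
          fix p assume "p \<in> D - Gd"
          then obtain x K where p: "p = (x, K)" "(x, K) \<in> D" by (cases p) auto
          obtain u v where "u \<le> x" "x \<le> v" "Inf K = u" "Sup K = v" using piece[OF p(2)] by blast
          then show "0 \<le> (case p of (x, K) \<Rightarrow> e' * (Sup K - Inf K))" using e' p(1) by simp
        qed (use fin in \<open>auto simp: Gd_def\<close>)
        also have "\<dots> = e' * (b - a)"
          unfolding len sum_distrib_left by (simp add: case_prod_unfold)
        finally show ?thesis .
      qed
      have bad: "norm (\<Sum>(x,K)\<in>Bd. measure lborel K *\<^sub>R h x - (f (Sup K) - f (Inf K))) < e / 2"
      proof -
        have "norm (\<Sum>(x,K)\<in>Bd. measure lborel K *\<^sub>R h x - (f (Sup K) - f (Inf K)))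
            \<le> (\<Sum>(x,K)\<in>Bd. norm (f (Sup K) - f (Inf K)))"
          by (intro sum_norm_le) (auto simp: Bd_def h_def norm_minus_commute)
        also have "\<dots> = (\<Sum>p\<in>Bd. norm (f (Sup (snd p)) - f (Inf (snd p))))"
          by (simp add: case_prod_unfold)
        \<comment> \<open>Two tags of one interval force it to be degenerate, and then its term is zero.\<close>
        also have "\<dots> = (\<Sum>K\<in>snd ` Bd. norm (f (Sup K) - f (Inf K)))"
        proof (rule sum.reindex_nontrivial[symmetric, unfolded comp_def])
          show "finite Bd" using fin by (auto simp: Bd_def)
          fix p q assume pq: "p \<in> Bd" "q \<in> Bd" "p \<noteq> q" "snd p = snd q"
          then have "interior (snd p) \<inter> interior (snd q) = {}"
            using D unfolding tagged_division_of_def tagged_partial_division_of_def Bd_def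
            using tagged_division_ofD(5)[of D "cbox a b" "fst p" "snd p" "fst q" "snd q"] D
            by (simp add: Bd_def prod_eq_iff) (metis prod.collapse)
          then have "interior (snd p) = {}" using pq by simp
          moreover obtain u v where "snd p = {u..v}" "u \<le> v"
            using piece[of "fst p" "snd p"] pq(1) unfolding Bd_def by fastforce
          ultimately have "snd p = {u..u}" by (auto simp: interior_atLeastAtMost_real)
          then show "norm (f (Sup (snd p)) - f (Inf (snd p))) = 0" by auto
        qed
        also have "\<dots> < e / 2"
        proof (rule d(2))
          have "snd ` D division_of cbox a b" using D division_of_tagged_division by blast
          then have "snd ` D division_of \<Union> (snd ` D)" using division_ofD(6) by metis
          moreover have "snd ` Bd \<subseteq> snd ` D" by (intro image_mono) (simp add: Bd_def)
          ultimately show div: "snd ` Bd division_of \<Union> (snd ` Bd)" by (rule division_of_subset)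
          show "\<Union> (snd ` Bd) \<subseteq> {0..T}"
          proof (clarify)
            fix y x K assume "(x, K) \<in> Bd" "y \<in> snd (x, K)"
            then have "y \<in> cbox a b" using D tagged_division_ofD(3)[of D "cbox a b" x K] by (auto simp: Bd_def)
            then show "y \<in> {0..T}" using ab by simp
          qed
          have "(\<Sum>K\<in>snd ` Bd. Sup K - Inf K) = (\<Sum>K\<in>snd ` Bd. measure lebesgue K)"
          proof (rule sum.cong[OF refl])
            fix K assume "K \<in> snd ` Bd"
            then obtain x where "(x,K) \<in> D" by (auto simp: Bd_def)
            then obtain u v where "K = {u..v}" "u \<le> x" "x \<le> v" using piece by blast
            then show "Sup K - Inf K = measure lebesgue K" by simp
          qed
          also have "\<dots> = measure lebesgue (\<Union> (snd ` Bd))"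
            using div by (rule content_division)
          also have "\<dots> \<le> measure lebesgue W"
          proof (rule measure_mono_fmeasurable[OF _ _ Wm])
            show "\<Union> (snd ` Bd) \<subseteq> W"
            proof
              fix y assume "y \<in> \<Union> (snd ` Bd)"
              then obtain x K where "(x,K) \<in> D" "x \<in> N" "y \<in> K" by (auto simp: Bd_def)
              then show "y \<in> W" using piece[of x K] r(2)[of x] by blast
            qed
            show "\<Union> (snd ` Bd) \<in> sets lebesgue"
              using div by (intro fmeasurableD lmeasurable_division)
          qed
          finally show "(\<Sum>K\<in>snd ` Bd. Sup K - Inf K) < d" using Wd by simp
        qed
        finally show ?thesis .
      qed
      have "(\<Sum>(x,k)\<in>D. measure lborel k *\<^sub>R h x) - (f b - f a)
          = (\<Sum>(x,K)\<in>D. measure lborel K *\<^sub>R h x - (f (Sup K) - f (Inf K)))"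
        unfolding tel by (simp add: case_prod_unfold sum_subtractf)
      also have "norm \<dots> < e' * (b - a) + e / 2"
        unfolding split using good bad by (intro norm_triangle_lt add_le_less_mono)
      also have "\<dots> \<le> e"
      proof -
        have "e' * (b - a) \<le> e / 2"
          using e ab by (simp add: e'_def field_simps)
        then show ?thesis by simp
      qed
      finally show "norm ((\<Sum>(x,k)\<in>D. measure lborel k *\<^sub>R h x) - (f b - f a)) < e" .
    qed
  qed
  show ?thesis
    by (rule has_integral_spike[OF N _ h[unfolded box_real]]) (simp add: h_def)
qed


text \<open>
  With \<open>g\<close> the identity this covers Lipschitz functions; with \<open>f = \<phi> \<circ> g\<close> it covers the composition of
  an absolutely continuous function with a Lipschitz one.
\<close>

lemma abs_continuous_on_lipschitz:
  fixes f :: "real \<Rightarrow> 'a::real_normed_vector"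
  assumes lip: "\<And>s t. s \<in> {a..b} \<Longrightarrow> t \<in> {a..b} \<Longrightarrow> norm (f t - f s) \<le> C * norm (g t - g s)" and "0 \<le> C"
    and ac: "abs_continuous_on a b g"
  shows "abs_continuous_on a b f"
  unfolding abs_continuous_on_def
proof (intro allI impI)
  fix e :: real assume "0 < e"
  then have e: "0 < e / (C + 1)" using assms by simp
  obtain d where d: "0 < d"
    and g: "\<forall>D. D division_of \<Union>D \<longrightarrow> \<Union>D \<subseteq> {a..b} \<longrightarrow>
      (\<Sum>K\<in>D. Sup K - Inf K) < d \<longrightarrow> (\<Sum>K\<in>D. norm (g (Sup K) - g (Inf K))) < e / (C + 1)"
    using ac[unfolded abs_continuous_on_def, THEN spec, THEN mp, OF e] by (elim exE conjE)
  show "\<exists>d>0. \<forall>D. D division_of \<Union>D \<longrightarrow> \<Union>D \<subseteq> {a..b} \<longrightarrow>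
      (\<Sum>K\<in>D. Sup K - Inf K) < d \<longrightarrow> (\<Sum>K\<in>D. norm (f (Sup K) - f (Inf K))) < e"
  proof (intro exI[of _ d] conjI d allI impI)
    fix D assume D: "D division_of \<Union>D" "\<Union>D \<subseteq> {a..b}" "(\<Sum>K\<in>D. Sup K - Inf K) < d"
    have "(\<Sum>K\<in>D. norm (f (Sup K) - f (Inf K))) \<le> (\<Sum>K\<in>D. C * norm (g (Sup K) - g (Inf K)))"
    proof (rule sum_mono)
      fix K assume K: "K \<in> D"
      then obtain u v where uv: "K = cbox u v" "K \<noteq> {}" using division_ofD(3,4)[OF D(1)] by metis
      then have "u \<in> K" "v \<in> K" "Inf K = u" "Sup K = v" by auto
      then have "Inf K \<in> {a..b}" "Sup K \<in> {a..b}" using D(2) K by blast+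
      then show "norm (f (Sup K) - f (Inf K)) \<le> C * norm (g (Sup K) - g (Inf K))" by (rule lip)
    qed
    also have "\<dots> \<le> C * (e / (C + 1))"
      unfolding sum_distrib_left[symmetric] using g[THEN spec[of _ D]] D \<open>0 \<le> C\<close>
      by (intro mult_left_mono) simp_all
    also have "\<dots> < e" using \<open>0 < e\<close> \<open>0 \<le> C\<close> by (simp add: field_simps)
    finally show "(\<Sum>K\<in>D. norm (f (Sup K) - f (Inf K))) < e" .
  qed
qed

lemma abs_continuous_on_id: "abs_continuous_on a b (\<lambda>t::real. t)"
  unfolding abs_continuous_on_def
proof (intro allI impI)
  fix e :: real assume "0 < e"
  show "\<exists>d>0. \<forall>D. D division_of \<Union>D \<longrightarrow> \<Union>D \<subseteq> {a..b} \<longrightarrow>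
      (\<Sum>K\<in>D. Sup K - Inf K) < d \<longrightarrow> (\<Sum>K\<in>D. norm (Sup K - Inf K)) < e"
  proof (intro exI[of _ e] conjI \<open>0 < e\<close> allI impI)
    fix D assume D: "D division_of \<Union>D" "\<Union>D \<subseteq> {a..b}" "(\<Sum>K\<in>D. Sup K - Inf K) < e"
    have "norm (Sup K - Inf K) = Sup K - Inf K" if K: "K \<in> D" for K
    proof -
      obtain u v where uv: "K = cbox u v" "K \<noteq> {}" using division_ofD(3,4)[OF D(1) K] by metis
      then have "Inf K = u" "Sup K = v" "u \<le> v" by auto
      then show ?thesis by simp
    qed
    then show "(\<Sum>K\<in>D. norm (Sup K - Inf K)) < e" using D(3) by simp
  qed
qed

lemma abs_continuous_on_add:
  fixes f g :: "real \<Rightarrow> 'a::real_normed_vector"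
  assumes "abs_continuous_on a b f" "abs_continuous_on a b g" shows "abs_continuous_on a b (\<lambda>t. f t + g t)"
  unfolding abs_continuous_on_def
proof (intro allI impI)
  fix e :: real assume "0 < e"
  then have e: "0 < e / 2" by simp
  obtain d1 where d1: "0 < d1" "\<forall>D. D division_of \<Union>D \<longrightarrow> \<Union>D \<subseteq> {a..b} \<longrightarrow>
      (\<Sum>K\<in>D. Sup K - Inf K) < d1 \<longrightarrow> (\<Sum>K\<in>D. norm (f (Sup K) - f (Inf K))) < e / 2"
    using assms(1)[unfolded abs_continuous_on_def, THEN spec, THEN mp, OF e] by (elim exE conjE)
  obtain d2 where d2: "0 < d2" "\<forall>D. D division_of \<Union>D \<longrightarrow> \<Union>D \<subseteq> {a..b} \<longrightarrow>
      (\<Sum>K\<in>D. Sup K - Inf K) < d2 \<longrightarrow> (\<Sum>K\<in>D. norm (g (Sup K) - g (Inf K))) < e / 2"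
    using assms(2)[unfolded abs_continuous_on_def, THEN spec, THEN mp, OF e] by (elim exE conjE)
  show "\<exists>d>0. \<forall>D. D division_of \<Union>D \<longrightarrow> \<Union>D \<subseteq> {a..b} \<longrightarrow>
      (\<Sum>K\<in>D. Sup K - Inf K) < d \<longrightarrow> (\<Sum>K\<in>D. norm (f (Sup K) + g (Sup K) - (f (Inf K) + g (Inf K)))) < e"
  proof (intro exI[of _ "min d1 d2"] conjI allI impI)
    fix D assume D: "D division_of \<Union>D" "\<Union>D \<subseteq> {a..b}" "(\<Sum>K\<in>D. Sup K - Inf K) < min d1 d2"
    have "(\<Sum>K\<in>D. norm (f (Sup K) + g (Sup K) - (f (Inf K) + g (Inf K))))
      \<le> (\<Sum>K\<in>D. norm (f (Sup K) - f (Inf K)) + norm (g (Sup K) - g (Inf K)))"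
      by (intro sum_mono) (simp add: norm_diff_triangle_ineq)
    also have "\<dots> < e"
      using d1(2)[THEN spec, of D] d2(2)[THEN spec, of D] D by (simp add: sum.distrib)
    finally show "(\<Sum>K\<in>D. norm (f (Sup K) + g (Sup K) - (f (Inf K) + g (Inf K)))) < e" .
  qed (use d1 d2 in auto)
qed

lemma abs_continuous_on_sum:
  fixes f :: "'i \<Rightarrow> real \<Rightarrow> 'a::real_normed_vector"
  assumes "finite I" "\<And>i. i \<in> I \<Longrightarrow> abs_continuous_on a b (f i)" shows "abs_continuous_on a b (\<lambda>t. \<Sum>i\<in>I. f i t)"
  using assms
proof (induction I rule: finite_induct)
  case empty
  have "abs_continuous_on a b (\<lambda>_::real. 0::'a)"
    by (rule abs_continuous_on_lipschitz[OF _ order_refl abs_continuous_on_id]) simp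
  then show ?case by simp
qed (auto intro: abs_continuous_on_add)

lemma indefinite_integral_right_derivative:
  fixes f :: "real \<Rightarrow> 'a::euclidean_space"
  assumes "\<And>a b. f integrable_on {a..b}"
  obtains N where "negligible N"
    "\<And>x e. x \<notin> N \<Longrightarrow> 0 < e \<Longrightarrow>
      \<exists>d>0. \<forall>h. 0 < h \<and> h < d \<longrightarrow> norm (integral {x..x + h} f - h *\<^sub>R f x) \<le> e * h"
proof -
  obtain N where N: "negligible N" "\<And>x e. x \<notin> N \<Longrightarrow> 0 < e \<Longrightarrow>
      \<exists>d>0. \<forall>h. 0 < h \<and> h < d \<longrightarrow> norm (integral {x..x + h} f /\<^sub>R h - f x) < e"
    using integrable_ccontinuous_explicit[of f] assms by auto
  have "\<exists>d>0. \<forall>h. 0 < h \<and> h < d \<longrightarrow> norm (integral {x..x + h} f - h *\<^sub>R f x) \<le> e * h"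
    if xe: "x \<notin> N" "0 < e" for x e
  proof -
    obtain d where d: "d > 0" "\<forall>h. 0 < h \<and> h < d \<longrightarrow> norm (integral {x..x + h} f /\<^sub>R h - f x) < e"
      using N(2)[OF xe] by auto
    have "norm (integral {x..x + h} f - h *\<^sub>R f x) \<le> e * h" if h: "0 < h" "h < d" for h
    proof -
      have "integral {x..x + h} f - h *\<^sub>R f x = h *\<^sub>R (integral {x..x + h} f /\<^sub>R h - f x)"
        using h by (simp add: scaleR_right_diff_distrib)
      also have "norm \<dots> \<le> e * h" using d(2) h by (simp add: less_imp_le mult.commute)
      finally show ?thesis .
    qed
    then show ?thesis using d(1) by blast
  qed
  with N(1) show thesis by (rule that)
qed

text \<open>
  \<open>integrable_ccontinuous_explicit\<close> averages over intervals to the right of the point only; applied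
  to the reflected function it also yields the derivative from the left.
\<close>

lemma lebesgue_differentiation:
  fixes f :: "real \<Rightarrow> 'a::euclidean_space"
  assumes f: "f integrable_on {0..T}"
  shows "AE t in lebesgue_on {0..T}.
    ((\<lambda>t. integral {0..t} f) has_vector_derivative f t) (at t within {0..T})"
proof -
  define g where "g = (\<lambda>t. if t \<in> {0..T} then f t else 0)"
  have "g integrable_on UNIV"
    unfolding g_def using f by (subst integrable_restrict_UNIV)
  then have g: "g integrable_on {a..b}" for a b by (rule integrable_on_subinterval) auto
  have gr: "(\<lambda>t. g (- t)) integrable_on {a..b}" for a b
    using g[of "- b" "- a"] Henstock_Kurzweil_Integration.integrable_reflect_real[where f=g and a="- b" and b="- a"] by simp
  obtain N1 where N1: "negligible N1"
    "\<And>x e. x \<notin> N1 \<Longrightarrow> 0 < e \<Longrightarrow>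
      \<exists>d>0. \<forall>h. 0 < h \<and> h < d \<longrightarrow> norm (integral {x..x + h} g - h *\<^sub>R g x) \<le> e * h"
    using indefinite_integral_right_derivative[of g] g by metis
  obtain N2 where N2: "negligible N2"
    "\<And>x e. x \<notin> N2 \<Longrightarrow> 0 < e \<Longrightarrow>
      \<exists>d>0. \<forall>h. 0 < h \<and> h < d \<longrightarrow> norm (integral {x..x + h} (\<lambda>t. g (- t)) - h *\<^sub>R g (- x)) \<le> e * h"
    using indefinite_integral_right_derivative[of "\<lambda>t. g (- t)"] gr by metis
  define N where "N = N1 \<union> (\<lambda>t. - t) ` N2"
  have N: "negligible N"
    unfolding N_def using N1(1) N2(1)
    by (intro negligible_Un negligible_differentiable_image_negligible) (auto intro!: derivative_intros)
  have "((\<lambda>t. integral {0..t} f) has_vector_derivative f t) (at t within {0..T})"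
    if t: "t \<in> {0..T} - N" for t
    unfolding has_vector_derivative_def has_derivative_within_alt
  proof (intro conjI allI impI)
    show "bounded_linear (\<lambda>x. x *\<^sub>R f t)" by (rule bounded_linear_scaleR_left)
    fix e :: real assume e: "0 < e"
    have "t \<notin> N1" "- t \<notin> N2" using t unfolding N_def by force+
    note tN = this
    obtain d1 where d1: "d1 > 0"
      "\<forall>h. 0 < h \<and> h < d1 \<longrightarrow> norm (integral {t..t + h} g - h *\<^sub>R g t) \<le> e * h"
      using N1(2)[OF tN(1) e] by (elim exE conjE)
    obtain d2 where d2: "d2 > 0"
      "\<forall>h. 0 < h \<and> h < d2 \<longrightarrow> norm (integral {-t..-t + h} (\<lambda>t. g (- t)) - h *\<^sub>R g t) \<le> e * h"
      using N2(2)[OF tN(2) e] unfolding minus_minus by (elim exE conjE)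
    note d12 = d1 d2
    from d12 have d: "d1 > 0" "d2 > 0"
      "\<And>h. 0 < h \<Longrightarrow> h < d1 \<Longrightarrow> norm (integral {t..t + h} g - h *\<^sub>R g t) \<le> e * h"
      "\<And>h. 0 < h \<Longrightarrow> h < d2 \<Longrightarrow> norm (integral {-t..-t + h} (\<lambda>t. g (- t)) - h *\<^sub>R g t) \<le> e * h"
      by simp_all
    have gf: "integral {u..v} g = integral {u..v} f" if "u \<in> {0..T}" "v \<in> {0..T}" for u v
      using that by (intro integral_cong) (auto simp: g_def)
    have fi: "f integrable_on {u..v}" if "u \<in> {0..T}" "v \<in> {0..T}" for u v
      using f by (rule integrable_on_subinterval) (use that in auto)
    show "\<exists>d>0. \<forall>y\<in>{0..T}. norm (y - t) < d \<longrightarrow>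
        norm (integral {0..y} f - integral {0..t} f - (y - t) *\<^sub>R f t) \<le> e * norm (y - t)"
    proof (intro exI[of _ "min d1 d2"] conjI ballI impI)
      fix y assume y: "y \<in> {0..T}" "norm (y - t) < min d1 d2"
      consider "y = t" | "t < y" | "y < t" by linarith
      then show "norm (integral {0..y} f - integral {0..t} f - (y - t) *\<^sub>R f t) \<le> e * norm (y - t)"
      proof cases
        case 2
        have "integral {0..t} f + integral {t..y} f = integral {0..y} f"
          using 2 y t by (intro Henstock_Kurzweil_Integration.integral_combine fi) auto
        then have "integral {0..y} f - integral {0..t} f = integral {t..t + (y - t)} g"
          using gf[of t y] y t 2 by (simp add: algebra_simps)
        then show ?thesis using d(3)[of "y - t"] 2 y t by (auto simp: g_def)
      next
        case 3
        have "integral {0..y} f + integral {y..t} f = integral {0..t} f"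
          using 3 y t by (intro Henstock_Kurzweil_Integration.integral_combine fi) auto
        moreover have "integral {-t..-t + (t - y)} (\<lambda>t. g (- t)) = integral {y..t} g"
          using Henstock_Kurzweil_Integration.integral_reflect_real[where f=g and a=y and b=t] by simp
        ultimately have "integral {0..y} f - integral {0..t} f - (y - t) *\<^sub>R f t
            = - (integral {-t..-t + (t - y)} (\<lambda>t. g (- t)) - (t - y) *\<^sub>R g t)"
          using gf[of y t] y t 3 by (simp add: algebra_simps g_def)
        then have "norm (integral {0..y} f - integral {0..t} f - (y - t) *\<^sub>R f t) \<le> e * (t - y)"
          using d(4)[of "t - y"] 3 y(2) by (simp add: norm_minus_cancel del: minus_diff_eq)
        then show ?thesis using 3 by simp
      qed simp
    qed (use d in auto)
  qed
  then show ?thesis using N by (subst AE_lebesgue_on_negligible) auto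
qed

lemma caratheodory_cong:
  assumes "caratheodory T f g" "AE t in lebesgue_on {0..T}. g t = h t" shows "caratheodory T f h"
  using assms unfolding caratheodory_def by (auto elim!: eventually_elim2)

lemma caratheodory_continuous:
  fixes Y :: "real \<Rightarrow> 'a::euclidean_space"
  assumes "caratheodory T Y u" "0 \<le> T" shows "continuous_on {0..T} Y"
proof -
  have I: "(u has_integral (Y t - Y 0)) {0..t}" if "t \<in> {0..T}" for t
    using abs_continuous_has_integral[OF assms(1), of 0 t] that by auto
  have "continuous_on {0..T} (\<lambda>t. integral {0..t} u)"
    using I[of T] assms(2) by (intro indefinite_integral_continuous_1) (auto simp: integrable_on_def)
  then have "continuous_on {0..T} (\<lambda>t. Y 0 + integral {0..t} u)" by (intro continuous_intros)
  then show ?thesis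
    by (rule continuous_on_eq) (simp add: integral_unique[OF I])
qed

lemma norm_average_le:
  fixes v :: "'a::real_normed_vector"
  assumes "0 < d" "norm v \<le> c * d" shows "norm (v /\<^sub>R d) \<le> c"
proof -
  have "norm (v /\<^sub>R d) = norm v / d" using assms(1) by (simp add: divide_inverse mult.commute)
  then show ?thesis using assms by (simp add: pos_divide_le_eq)
qed

lemma norm_integral_le:
  fixes f :: "real \<Rightarrow> 'a::euclidean_space"
  assumes "f integrable_on {s..t}" "s \<le> t" "\<And>r. norm (f r) \<le> c"
  shows "norm (integral {s..t} f) \<le> c * (t - s)"
  using has_integral_bound[of c f "integral {s..t} f" s t] assms order_trans[OF norm_ge_zero assms(3)]
  by (simp add: integrable_integral)

lemma caratheodory_lipschitz:
  fixes Y :: "real \<Rightarrow> 'a::euclidean_space"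
  assumes car: "caratheodory T Y u" and u: "\<And>t. norm (u t) \<le> B" and st: "0 \<le> s" "s \<le> t" "t \<le> T"
  shows "norm (Y t - Y s) \<le> B * (t - s)"
  using has_integral_bound[of B u "Y t - Y s" s t] abs_continuous_has_integral[OF car st] u norm_ge_zero[of "u 0"]
    order_trans[OF norm_ge_zero u] st by auto

lemma caratheodory_diff_bound:
  fixes Y Y' :: "real \<Rightarrow> 'a::euclidean_space"
  assumes Y: "caratheodory T Y u" and Y': "caratheodory T Y' u'"
    and k: "\<And>t. norm (u t - u' t) \<le> \<kappa>" and st: "0 \<le> s" "s \<le> t" "t \<le> T"
  shows "norm ((Y t - Y s) - (Y' t - Y' s)) \<le> \<kappa> * (t - s)"
proof -
  have "((\<lambda>r. u r - u' r) has_integral ((Y t - Y s) - (Y' t - Y' s))) {s..t}"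
    by (intro has_integral_diff abs_continuous_has_integral[OF Y st] abs_continuous_has_integral[OF Y' st])
  moreover have "0 \<le> \<kappa>" using k norm_ge_zero order_trans by blast
  ultimately show ?thesis using has_integral_bound[of \<kappa> "\<lambda>r. u r - u' r" _ s t] k st by auto
qed

section \<open>The dual Lipschitz distance\<close>

lemma P1_D:
  assumes "\<mu> \<in> P1"
  shows "prob_space \<mu>" "sets \<mu> = sets borel" "space \<mu> = UNIV" "integrable \<mu> norm"
  using assms sets_eq_imp_space_eq[of \<mu> borel] by (auto simp: P1_def)

lemma P1_measurable: "\<mu> \<in> P1 \<Longrightarrow> f \<in> borel_measurable borel \<Longrightarrow> f \<in> borel_measurable \<mu>"
  using measurable_cong_sets[OF P1_D(2) refl] by blast

lemma (in prob_space) norm_integral_diff_le: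
  fixes f g :: "'a \<Rightarrow> 'b::{banach, second_countable_topology}"
  assumes "integrable M f" "integrable M g" "AE x in M. norm (f x - g x) \<le> c"
  shows "norm ((\<integral>x. f x \<partial>M) - (\<integral>x. g x \<partial>M)) \<le> c"
proof -
  have "norm (\<integral>x. f x - g x \<partial>M) \<le> (\<integral>x. norm (f x - g x) \<partial>M)" by (rule integral_norm_bound)
  also have "\<dots> \<le> (\<integral>x. c \<partial>M)" using assms by (intro integral_mono_AE) auto
  finally show ?thesis using assms by (simp add: prob_space)
qed

lemma lipschitz_measurable:
  fixes f :: "'a::euclidean_space \<Rightarrow> 'b::{euclidean_space}"
  assumes "L-lipschitz_on UNIV f" shows "f \<in> borel_measurable borel"
  using lipschitz_on_continuous_on[OF assms] by (rule borel_measurable_continuous_onI)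

lemma lipschitz_growth:
  fixes f :: "'a::real_normed_vector \<Rightarrow> 'b::real_normed_vector"
  assumes "L-lipschitz_on UNIV f" shows "norm (f x) \<le> norm (f 0) + L * norm x"
  using lipschitz_onD[OF assms, of x 0] norm_triangle_sub[of "f x" "f 0"] by (simp add: dist_norm)

lemma P1_lipschitz_integrable:
  fixes f :: "'a::euclidean_space \<Rightarrow> 'b::{euclidean_space}"
  assumes "\<mu> \<in> P1" "L-lipschitz_on UNIV f" shows "integrable \<mu> f"
proof -
  interpret prob_space \<mu> using P1_D(1)[OF assms(1)] .
  show ?thesis
  proof (rule Bochner_Integration.integrable_bound)
    show "integrable \<mu> (\<lambda>x. norm (f 0) + L * norm x)" using P1_D(4)[OF assms(1)] by simp
    show "f \<in> borel_measurable \<mu>" using P1_measurable[OF assms(1) lipschitz_measurable[OF assms(2)]] .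
    show "AE x in \<mu>. norm (f x) \<le> norm (norm (f 0) + L * norm x)"
      using lipschitz_growth[OF assms(2)] lipschitz_on_nonneg[OF assms(2)] by (intro AE_I2) simp
  qed
qed

text \<open>
  The dual side of the Kantorovich-Rubinstein formula for \<open>W1\<close>.  No couplings occur in it, so the
  triangle inequality is immediate, and it can be estimated by transforming test functions.
\<close>

definition lipdist :: "'a::euclidean_space measure \<Rightarrow> 'a measure \<Rightarrow> real" where
  "lipdist \<mu> \<nu> = (SUP \<phi>\<in>{\<phi>. 1-lipschitz_on UNIV \<phi>}. (\<integral>x. \<phi> x \<partial>\<mu>) - (\<integral>x. \<phi> x \<partial>\<nu>))"

lemma lipschitz_integral_deviation:
  fixes \<phi> :: "'a::euclidean_space \<Rightarrow> real"
  assumes "\<mu> \<in> P1" "1-lipschitz_on UNIV \<phi>"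
  shows "\<bar>(\<integral>x. \<phi> x \<partial>\<mu>) - \<phi> 0\<bar> \<le> (\<integral>x. norm x \<partial>\<mu>)"
proof -
  interpret prob_space \<mu> using P1_D(1)[OF assms(1)] .
  note int = P1_lipschitz_integrable[OF assms]
  have "(\<integral>x. \<phi> x \<partial>\<mu>) - \<phi> 0 = (\<integral>x. \<phi> x - \<phi> 0 \<partial>\<mu>)" using int by (simp add: prob_space)
  also have "\<bar>\<dots>\<bar> \<le> (\<integral>x. \<bar>\<phi> x - \<phi> 0\<bar> \<partial>\<mu>)" by (rule integral_abs_bound)
  also have "\<dots> \<le> (\<integral>x. norm x \<partial>\<mu>)"
    using int P1_D(4)[OF assms(1)] lipschitz_onD[OF assms(2), of _ 0]
    by (intro integral_mono) (auto simp: dist_real_def)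
  finally show ?thesis .
qed

lemma lipdist_upper1:
  fixes \<phi> :: "'a::euclidean_space \<Rightarrow> real"
  assumes "\<mu> \<in> P1" "\<nu> \<in> P1" "1-lipschitz_on UNIV \<phi>"
  shows "(\<integral>x. \<phi> x \<partial>\<mu>) - (\<integral>x. \<phi> x \<partial>\<nu>) \<le> lipdist \<mu> \<nu>"
  unfolding lipdist_def
proof (rule cSUP_upper[where x=\<phi> and f="\<lambda>\<phi>. (\<integral>x. (\<phi> x :: real) \<partial>\<mu>) - (\<integral>x. \<phi> x \<partial>\<nu>)"])
  show "\<phi> \<in> {\<phi>. 1-lipschitz_on UNIV \<phi>}" using assms by simp
  show "bdd_above ((\<lambda>\<phi>. (\<integral>x. (\<phi> x :: real) \<partial>\<mu>) - (\<integral>x. \<phi> x \<partial>\<nu>)) ` {\<phi>. 1-lipschitz_on UNIV \<phi>})"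
  proof (rule bdd_aboveI2)
    fix \<phi> :: "'a \<Rightarrow> real" assume "\<phi> \<in> {\<phi>. 1-lipschitz_on UNIV \<phi>}"
    then show "(\<integral>x. \<phi> x \<partial>\<mu>) - (\<integral>x. \<phi> x \<partial>\<nu>) \<le> (\<integral>x. norm x \<partial>\<mu>) + (\<integral>x. norm x \<partial>\<nu>)"
      using lipschitz_integral_deviation[OF assms(1), of \<phi>] lipschitz_integral_deviation[OF assms(2), of \<phi>] by auto
  qed
qed

lemma lipdist_least:
  assumes "\<And>\<phi>::'a::euclidean_space \<Rightarrow> real. 1-lipschitz_on UNIV \<phi> \<Longrightarrow> (\<integral>x. \<phi> x \<partial>\<mu>) - (\<integral>x. \<phi> x \<partial>\<nu>) \<le> c"
  shows "lipdist \<mu> \<nu> \<le> c"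
  unfolding lipdist_def
  by (rule cSUP_least) (use assms in \<open>auto intro!: exI[of _ "\<lambda>_. 0"] lipschitz_on_mono[OF lipschitz_on_constant]\<close>)

lemma lipdist_nonneg: "\<mu> \<in> P1 \<Longrightarrow> \<nu> \<in> P1 \<Longrightarrow> 0 \<le> lipdist \<mu> \<nu>"
  using lipdist_upper1[of \<mu> \<nu> "\<lambda>_. 0", OF _ _ lipschitz_onI] by simp

lemma lipdist_le_sym:
  assumes "\<mu> \<in> P1" "\<nu> \<in> P1" shows "lipdist \<mu> \<nu> \<le> lipdist \<nu> \<mu>"
proof (rule lipdist_least)
  fix \<phi> :: "'a \<Rightarrow> real" assume "1-lipschitz_on UNIV \<phi>"
  then show "(\<integral>x. \<phi> x \<partial>\<mu>) - (\<integral>x. \<phi> x \<partial>\<nu>) \<le> lipdist \<nu> \<mu>"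
    using lipdist_upper1[OF assms(2,1), of "\<lambda>x. - \<phi> x"] by simp
qed

lemma lipdist_sym: "\<mu> \<in> P1 \<Longrightarrow> \<nu> \<in> P1 \<Longrightarrow> lipdist \<mu> \<nu> = lipdist \<nu> \<mu>"
  by (intro antisym lipdist_le_sym)

lemma lipdist_refl: "\<mu> \<in> P1 \<Longrightarrow> lipdist \<mu> \<mu> = 0"
  using lipdist_nonneg[of \<mu> \<mu>] lipdist_least[of \<mu> \<mu> 0] by simp

lemma lipdist_triangle:
  assumes "\<mu> \<in> P1" "\<nu> \<in> P1" "\<rho> \<in> P1" shows "lipdist \<mu> \<rho> \<le> lipdist \<mu> \<nu> + lipdist \<nu> \<rho>"
proof (rule lipdist_least)
  fix \<phi> :: "'a \<Rightarrow> real" assume "1-lipschitz_on UNIV \<phi>"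
  then show "(\<integral>x. \<phi> x \<partial>\<mu>) - (\<integral>x. \<phi> x \<partial>\<rho>) \<le> lipdist \<mu> \<nu> + lipdist \<nu> \<rho>"
    using lipdist_upper1[OF assms(1,2), of \<phi>] lipdist_upper1[OF assms(2,3), of \<phi>] by simp
qed

lemma lipdist_upper:
  fixes \<phi> :: "'a::euclidean_space \<Rightarrow> real"
  assumes "\<mu> \<in> P1" "\<nu> \<in> P1" "K-lipschitz_on UNIV \<phi>"
  shows "(\<integral>x. \<phi> x \<partial>\<mu>) - (\<integral>x. \<phi> x \<partial>\<nu>) \<le> K * lipdist \<mu> \<nu>"
proof (cases "K = 0")
  case True
  interpret M: prob_space \<mu> using P1_D(1)[OF assms(1)] .
  interpret N: prob_space \<nu> using P1_D(1)[OF assms(2)] .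
  have "\<phi> = (\<lambda>_. \<phi> 0)"
    using lipschitz_onD[OF assms(3), of _ 0] True by auto
  then have "(\<integral>x. \<phi> x \<partial>\<mu>) = \<phi> 0" "(\<integral>x. \<phi> x \<partial>\<nu>) = \<phi> 0"
    by (metis M.prob_space lebesgue_integral_const scaleR_one, metis N.prob_space lebesgue_integral_const scaleR_one)
  then show ?thesis using True by simp
next
  case False
  then have K: "0 < K" using lipschitz_on_nonneg[OF assms(3)] by simp
  have "1-lipschitz_on UNIV (\<lambda>x. (1 / K) * \<phi> x)"
    using lipschitz_on_cmult_real[OF assms(3), of "1 / K"] K by simp
  then have "(\<integral>x. (1 / K) * \<phi> x \<partial>\<mu>) - (\<integral>x. (1 / K) * \<phi> x \<partial>\<nu>) \<le> lipdist \<mu> \<nu>"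
    using lipdist_upper1[OF assms(1,2)] by blast
  then show ?thesis using K by (simp add: field_simps)
qed

text \<open>
  Vector-valued integrands reduce to scalar ones by testing in the direction of the difference.
\<close>

lemma lipdist_upper_norm:
  fixes f :: "'a::euclidean_space \<Rightarrow> 'b::euclidean_space"
  assumes "\<mu> \<in> P1" "\<nu> \<in> P1" "K-lipschitz_on UNIV f"
  shows "norm ((\<integral>x. f x \<partial>\<mu>) - (\<integral>x. f x \<partial>\<nu>)) \<le> K * lipdist \<mu> \<nu>"
proof -
  define a where "a = (\<integral>x. f x \<partial>\<mu>) - (\<integral>x. f x \<partial>\<nu>)"
  define e where "e = sgn a"
  have e: "norm e \<le> 1" by (simp add: e_def norm_sgn)
  have "K-lipschitz_on UNIV (\<lambda>x. f x \<bullet> e)"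
  proof (rule lipschitz_onI)
    fix x y
    have "dist (f x \<bullet> e) (f y \<bullet> e) = \<bar>(f x - f y) \<bullet> e\<bar>" by (simp add: dist_real_def inner_diff_left)
    also have "\<dots> \<le> norm (f x - f y) * norm e" by (rule Cauchy_Schwarz_ineq2)
    also have "\<dots> \<le> norm (f x - f y)" using e by (simp add: mult_left_le)
    also have "\<dots> \<le> K * dist x y" using lipschitz_onD[OF assms(3), of x y] by (simp add: dist_norm)
    finally show "dist (f x \<bullet> e) (f y \<bullet> e) \<le> K * dist x y" .
  qed (rule lipschitz_on_nonneg[OF assms(3)])
  then have "(\<integral>x. f x \<bullet> e \<partial>\<mu>) - (\<integral>x. f x \<bullet> e \<partial>\<nu>) \<le> K * lipdist \<mu> \<nu>"
    using lipdist_upper[OF assms(1,2)] by blast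
  moreover have "(\<integral>x. f x \<bullet> e \<partial>\<mu>) - (\<integral>x. f x \<bullet> e \<partial>\<nu>) = a \<bullet> e"
    using assms by (simp add: a_def inner_diff_left P1_lipschitz_integrable)
  moreover have "a \<bullet> e = norm a"
    by (cases "a = 0") (simp_all add: e_def sgn_div_norm power2_norm_eq_inner[symmetric] power2_eq_square)
  ultimately show ?thesis by (simp add: a_def)
qed

lemma lipdist_upper_abs:
  fixes \<phi> :: "'a::euclidean_space \<Rightarrow> real"
  assumes "\<mu> \<in> P1" "\<nu> \<in> P1" "K-lipschitz_on UNIV \<phi>"
  shows "\<bar>(\<integral>x. \<phi> x \<partial>\<mu>) - (\<integral>x. \<phi> x \<partial>\<nu>)\<bar> \<le> K * lipdist \<mu> \<nu>"
  using lipdist_upper_norm[OF assms] by simp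

lemma coupling_integrable:
  assumes "\<mu> \<in> P1" "\<nu> \<in> P1" "\<pi> \<in> couplings \<mu> \<nu>"
  shows "integrable \<pi> (\<lambda>z. norm (fst z))" "integrable \<pi> (\<lambda>z. norm (snd z))"
    "integrable \<pi> (\<lambda>z. dist (fst z) (snd z))" "sets \<pi> = sets borel"
    "distr \<pi> borel fst = \<mu>" "distr \<pi> borel snd = \<nu>" "fst \<in> borel_measurable \<pi>" "snd \<in> borel_measurable \<pi>"
proof -
  show s: "sets \<pi> = sets borel" and d: "distr \<pi> borel fst = \<mu>" "distr \<pi> borel snd = \<nu>"
    using assms(3) by (auto simp: couplings_def)
  have cont: "h \<in> borel_measurable \<pi>" if "continuous_on UNIV h" for h :: "'a \<times> 'a \<Rightarrow> 'c::topological_space"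
    using borel_measurable_continuous_onI[OF that] measurable_cong_sets[OF s refl, of borel] by blast
  have f: "fst \<in> borel_measurable \<pi>" and g: "snd \<in> borel_measurable \<pi>"
    by (intro cont continuous_intros)+
  then show "fst \<in> borel_measurable \<pi>" "snd \<in> borel_measurable \<pi>" .
  show 1: "integrable \<pi> (\<lambda>z. norm (fst z))"
    using P1_D(4)[OF assms(1)] unfolding d(1)[symmetric] by (subst (asm) integrable_distr_eq[OF f]) auto
  show 2: "integrable \<pi> (\<lambda>z. norm (snd z))"
    using P1_D(4)[OF assms(2)] unfolding d(2)[symmetric] by (subst (asm) integrable_distr_eq[OF g]) auto
  show "integrable \<pi> (\<lambda>z. dist (fst z) (snd z))"
  proof (rule Bochner_Integration.integrable_bound[OF Bochner_Integration.integrable_add[OF 1 2]])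
    show "(\<lambda>z. dist (fst z) (snd z)) \<in> borel_measurable \<pi>"
      by (intro cont continuous_intros)
    show "AE z in \<pi>. norm (dist (fst z) (snd z)) \<le> norm (norm (fst z) + norm (snd z))"
      by (intro AE_I2) (simp add: dist_norm norm_triangle_ineq4)
  qed
qed

lemma couplings_nonempty:
  assumes "\<mu> \<in> P1" "\<nu> \<in> P1" shows "couplings \<mu> \<nu> \<noteq> {}"
proof -
  interpret M: prob_space \<mu> using P1_D(1)[OF assms(1)] .
  interpret N: prob_space \<nu> using P1_D(1)[OF assms(2)] .
  interpret P: pair_prob_space \<mu> \<nu> ..
  have s: "sets (\<mu> \<Otimes>\<^sub>M \<nu>) = sets borel"
    using sets_pair_measure_cong[OF P1_D(2)[OF assms(1)] P1_D(2)[OF assms(2)]]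
    unfolding borel_prod .
  have 1: "distr (\<mu> \<Otimes>\<^sub>M \<nu>) borel fst = \<mu>"
    using N.distr_pair_fst[of \<mu>] distr_cong[OF refl P1_D(2)[OF assms(1), symmetric], of "\<mu> \<Otimes>\<^sub>M \<nu>" fst fst]
    by simp
  have 2: "distr (\<mu> \<Otimes>\<^sub>M \<nu>) borel snd = \<nu>"
  proof (rule measure_eqI)
    fix A assume "A \<in> sets (distr (\<mu> \<Otimes>\<^sub>M \<nu>) borel snd)"
    then have A: "A \<in> sets \<nu>" "A \<in> sets borel" using P1_D(2)[OF assms(2)] by auto
    have m: "snd \<in> measurable (\<mu> \<Otimes>\<^sub>M \<nu>) borel"
      using measurable_cong_sets[OF refl P1_D(2)[OF assms(2)]] measurable_snd by blast
    have "emeasure (distr (\<mu> \<Otimes>\<^sub>M \<nu>) borel snd) A = emeasure (\<mu> \<Otimes>\<^sub>M \<nu>) (space \<mu> \<times> A)"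
      using A m sets.sets_into_space[OF A(1)]
      by (subst emeasure_distr) (auto simp: space_pair_measure intro!: arg_cong[where f="emeasure (\<mu> \<Otimes>\<^sub>M \<nu>)"])
    also have "\<dots> = emeasure \<nu> A" using A by (subst N.emeasure_pair_measure_Times) (auto simp: M.emeasure_space_1)
    finally show "emeasure (distr (\<mu> \<Otimes>\<^sub>M \<nu>) borel snd) A = emeasure \<nu> A" .
  qed (simp add: P1_D(2)[OF assms(2)])
  have "\<mu> \<Otimes>\<^sub>M \<nu> \<in> couplings \<mu> \<nu>"
    unfolding couplings_def using s 1 2 P.prob_space_axioms by auto
  then show ?thesis by blast
qed

lemma lipdist_le_W1:
  assumes "\<mu> \<in> P1" "\<nu> \<in> P1" shows "lipdist \<mu> \<nu> \<le> W1 \<mu> \<nu>"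
  unfolding W1_def
proof (rule cINF_greatest[OF couplings_nonempty[OF assms]])
  fix \<pi> assume p: "\<pi> \<in> couplings \<mu> \<nu>"
  note c = coupling_integrable[OF assms p]
  show "lipdist \<mu> \<nu> \<le> (\<integral>z. dist (fst z) (snd z) \<partial>\<pi>)"
  proof (rule lipdist_least)
    fix \<phi> :: "'a \<Rightarrow> real" assume L: "1-lipschitz_on UNIV \<phi>"
    note m = lipschitz_measurable[OF L]
    have i1: "integrable \<pi> (\<lambda>z. \<phi> (fst z))"
      using P1_lipschitz_integrable[OF assms(1) L] integrable_distr_eq[OF c(7) m] c(5) by simp
    have i2: "integrable \<pi> (\<lambda>z. \<phi> (snd z))"
      using P1_lipschitz_integrable[OF assms(2) L] integrable_distr_eq[OF c(8) m] c(6) by simp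
    have "(\<integral>x. \<phi> x \<partial>\<mu>) - (\<integral>x. \<phi> x \<partial>\<nu>) = (\<integral>z. \<phi> (fst z) \<partial>\<pi>) - (\<integral>z. \<phi> (snd z) \<partial>\<pi>)"
      using integral_distr[OF c(7) m] integral_distr[OF c(8) m] c(5,6) by simp
    also have "\<dots> = (\<integral>z. \<phi> (fst z) - \<phi> (snd z) \<partial>\<pi>)" using i1 i2 by simp
    also have "\<dots> \<le> (\<integral>z. dist (fst z) (snd z) \<partial>\<pi>)"
    proof (rule integral_mono[OF Bochner_Integration.integrable_diff[OF i1 i2] c(3)])
      fix z show "\<phi> (fst z) - \<phi> (snd z) \<le> dist (fst z) (snd z)"
        using lipschitz_onD[OF L, of "fst z" "snd z"] by (auto simp: dist_real_def)
    qed
    finally show "(\<integral>x. \<phi> x \<partial>\<mu>) - (\<integral>x. \<phi> x \<partial>\<nu>) \<le> (\<integral>z. dist (fst z) (snd z) \<partial>\<pi>)" .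
  qed
qed

lemma W1_nonneg: "\<mu> \<in> P1 \<Longrightarrow> \<nu> \<in> P1 \<Longrightarrow> 0 \<le> W1 \<mu> \<nu>"
  using lipdist_le_W1 lipdist_nonneg by (meson order_trans)

text \<open>
  The joint law of \<open>f\<close> and \<open>g\<close> is a coupling.
\<close>

lemma W1_distr_le:
  fixes f g :: "'b \<Rightarrow> 'a::euclidean_space"
  assumes "prob_space M" and [measurable]: "f \<in> borel_measurable M" "g \<in> borel_measurable M"
  shows "W1 (distr M borel f) (distr M borel g) \<le> (\<integral>x. dist (f x) (g x) \<partial>M)"
proof -
  interpret prob_space M by fact
  have m[measurable]: "(\<lambda>x. (f x, g x)) \<in> borel_measurable M" by measurable
  define \<pi> where "\<pi> = distr M borel (\<lambda>x. (f x, g x))"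
  have "fst \<in> borel_measurable (borel :: ('a \<times> 'a) measure)" "snd \<in> borel_measurable (borel :: ('a \<times> 'a) measure)"
    by (auto intro!: borel_measurable_continuous_onI continuous_intros)
  then have "\<pi> \<in> couplings (distr M borel f) (distr M borel g)"
    unfolding couplings_def \<pi>_def using m by (auto simp: distr_distr comp_def intro!: prob_space_distr)
  then have "W1 (distr M borel f) (distr M borel g) \<le> (\<integral>z. dist (fst z) (snd z) \<partial>\<pi>)"
    unfolding W1_def by (rule cINF_lower[rotated]) (auto intro!: bdd_belowI2[of _ 0] integral_nonneg)
  also have "\<dots> = (\<integral>x. dist (f x) (g x) \<partial>M)"
    unfolding \<pi>_def by (subst integral_distr[OF m]) (auto intro!: borel_measurable_continuous_onI continuous_intros)
  finally show ?thesis .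
qed

lemma W1_refl:
  assumes "\<mu> \<in> P1" shows "W1 \<mu> \<mu> = 0"
proof -
  have m: "(\<lambda>x. x) \<in> borel_measurable \<mu>" by (intro P1_measurable[OF assms]) simp
  have "distr \<mu> borel (\<lambda>x. x) = \<mu>"
    using distr_id2[of borel \<mu>] P1_D(2)[OF assms] by simp
  then have "W1 \<mu> \<mu> \<le> 0" using W1_distr_le[OF P1_D(1)[OF assms] m m] by simp
  then show ?thesis using W1_nonneg[OF assms assms] by simp
qed

lemma W1_le_chi_dist: "W1 \<mu> \<nu> \<le> chi_dist (Y, \<mu>) (Y', \<nu>)"
  by (simp add: chi_dist_def sum_nonneg)

lemma chi_dist_eq: "chi_dist (Y, \<mu>) (Y', \<nu>) = (\<Sum>k\<in>UNIV. norm (Y $ k - Y' $ k)) / real CARD('m) + W1 \<mu> \<nu>"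
  for Y Y' :: "(real^'d)^'m"
  by (simp add: chi_dist_def)

lemma chi_dist_le: "chi_dist (Y, \<mu>) (Y', \<nu>) \<le> norm (Y - Y') + W1 \<mu> \<nu>"
  for Y Y' :: "(real^'d)^'m"
proof -
  have "norm (Y $ k - Y' $ k) \<le> norm (Y - Y')" for k
    using Finite_Cartesian_Product.norm_nth_le[of "Y - Y'" k] by simp
  then have "(\<Sum>k\<in>UNIV. norm (Y $ k - Y' $ k)) \<le> (\<Sum>k\<in>(UNIV::'m set). norm (Y - Y'))" by (intro sum_mono)
  then have "(\<Sum>k\<in>UNIV. norm (Y $ k - Y' $ k)) / real CARD('m) \<le> norm (Y - Y')"
    by (simp add: divide_le_eq mult.commute)
  then show ?thesis by (simp add: chi_dist_eq)
qed

lemma chi_dist_nonneg: "\<mu> \<in> P1 \<Longrightarrow> \<nu> \<in> P1 \<Longrightarrow> 0 \<le> chi_dist (Y, \<mu>) (Y', \<nu>)"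
  for Y Y' :: "(real^'d)^'m"
  using W1_nonneg[of \<mu> \<nu>] W1_le_chi_dist[of \<mu> \<nu> Y Y'] by simp

lemma P1_distr:
  fixes f :: "'b \<Rightarrow> 'a::euclidean_space"
  assumes "prob_space M" "f \<in> borel_measurable M" "integrable M (\<lambda>x. norm (f x))"
  shows "distr M borel f \<in> P1"
  unfolding P1_def using assms by (auto simp: prob_space.prob_space_distr integrable_distr_eq)

text \<open>
  By the Lindelof property countably many open null sets cover the complement of the support.
\<close>

lemma AE_measure_support:
  fixes \<mu> :: "'a::euclidean_space measure"
  assumes s: "sets \<mu> = sets borel"
  shows "AE x in \<mu>. x \<in> measure_support \<mu>"
proof -
  define \<F> where "\<F> = {S::'a set. open S \<and> emeasure \<mu> S = 0}"
  obtain \<F>' where F: "\<F>' \<subseteq> \<F>" "countable \<F>'" "\<Union>\<F>' = \<Union>\<F>"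
    using Lindelof[of \<F>] by (auto simp: \<F>_def)
  have "(\<Union>S\<in>\<F>'. S) \<in> null_sets \<mu>"
    using F s by (intro null_sets_UN') (auto simp: \<F>_def null_sets_def)
  moreover have "{x \<in> space \<mu>. x \<notin> measure_support \<mu>} \<subseteq> (\<Union>S\<in>\<F>'. S)"
    using F(3) by (auto simp: measure_support_def \<F>_def)
  ultimately show ?thesis by (rule AE_I')
qed

lemma AE_support_imp:
  fixes \<mu> :: "'a::euclidean_space measure"
  assumes "sets \<mu> = sets borel" "measure_support \<mu> \<subseteq> ball 0 R" shows "AE x in \<mu>. norm x \<le> R"
  using AE_measure_support[OF assms(1)] by eventually_elim (use assms(2) in force)

lemma support_subset_ball:
  fixes \<mu> :: "'a::euclidean_space measure"
  assumes s: "sets \<mu> = sets borel" and ae: "AE x in \<mu>. norm x \<le> R"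
  shows "measure_support \<mu> \<subseteq> cball 0 R"
proof
  fix x assume x: "x \<in> measure_support \<mu>"
  have "emeasure \<mu> (- cball 0 R) = 0"
    using ae s sets_eq_imp_space_eq[OF s]
    by (subst (asm) AE_iff_measurable[of "- cball 0 R"]) auto
  then show "x \<in> cball 0 R" using x unfolding measure_support_def by (metis (mono_tags, lifting) ComplI closed_cball less_irrefl mem_Collect_eq open_Compl)
qed

lemma lipschitz_mult_bounded:
  fixes f g :: "'a::metric_space \<Rightarrow> real"
  assumes "A-lipschitz_on S f" "B-lipschitz_on S g" "\<And>x. x \<in> S \<Longrightarrow> \<bar>f x\<bar> \<le> M" "\<And>x. x \<in> S \<Longrightarrow> \<bar>g x\<bar> \<le> N" "0 \<le> M" "0 \<le> N"
  shows "(A * N + M * B)-lipschitz_on S (\<lambda>x. f x * g x)"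
proof (rule lipschitz_onI)
  note A = lipschitz_on_nonneg[OF assms(1)] and B = lipschitz_on_nonneg[OF assms(2)]
  show "0 \<le> A * N + M * B" using A B assms by simp
  fix x y assume xy: "x \<in> S" "y \<in> S"
  have "\<bar>f x * g x - f y * g y\<bar> = \<bar>(f x - f y) * g x + f y * (g x - g y)\<bar>" by (simp add: algebra_simps)
  also have "\<dots> \<le> \<bar>f x - f y\<bar> * \<bar>g x\<bar> + \<bar>f y\<bar> * \<bar>g x - g y\<bar>"
    by (metis abs_mult abs_triangle_ineq)
  also have "\<dots> \<le> (A * dist x y) * N + M * (B * dist x y)"
    using lipschitz_onD[OF assms(1) xy] lipschitz_onD[OF assms(2) xy] assms(3,4) xy A B assms(5,6)
    by (intro add_mono mult_mono) (auto simp: dist_real_def)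
  finally show "dist (f x * g x) (f y * g y) \<le> (A * N + M * B) * dist x y"
    by (simp add: dist_real_def algebra_simps)
qed

lemma real_polynomial_function_lipschitz:
  fixes p :: "'a::euclidean_space \<Rightarrow> real"
  assumes "real_polynomial_function p" shows "\<exists>C. C-lipschitz_on (cball 0 R) p"
  using assms
proof induction
  case (linear f)
  then obtain K where "\<And>x. norm (f x) \<le> norm x * K" "0 \<le> K"
    using bounded_linear.nonneg_bounded by blast
  then have "K-lipschitz_on (cball 0 R) f"
    using linear by (intro lipschitz_onI) (auto simp: dist_norm bounded_linear.linear linear_diff[symmetric] mult.commute simp del: real_norm_def)
  then show ?case by blast
next
  case (const c)
  then show ?case using lipschitz_on_constant by blast
next
  case (add f g)
  then show ?case using lipschitz_on_add by blast
next
  case (mult f g)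
  then obtain A B where AB: "A-lipschitz_on (cball 0 R) f" "B-lipschitz_on (cball 0 R) g" by blast
  have "bounded (f ` cball 0 R)" "bounded (g ` cball 0 R)"
    using AB lipschitz_on_continuous_on by (blast intro: compact_imp_bounded compact_continuous_image compact_cball)+
  then obtain M N where MN: "0 < M" "\<forall>y\<in>f ` cball 0 R. norm y \<le> M" "0 < N" "\<forall>y\<in>g ` cball 0 R. norm y \<le> N"
    unfolding bounded_pos by blast
  have "(A * N + M * B)-lipschitz_on (cball 0 R) (\<lambda>x. f x * g x)"
    using MN by (intro lipschitz_mult_bounded[OF AB]) auto
  then show ?case by blast
qed

lemma closest_point_cball:
  "1-lipschitz_on UNIV (closest_point (cball (0::'a::euclidean_space) R))" if "0 \<le> R"
  using that by (intro lipschitz_onI) (auto intro!: closest_point_lipschitz)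

text \<open>
  On the ball that carries all the measures, a continuous function is uniformly close to a polynomial,
  and the polynomial composed with the projection onto the ball is Lipschitz on the whole space.
\<close>

lemma lipdist_narrow:
  fixes \<mu> :: "'a::euclidean_space measure"
  assumes mu: "\<mu> \<in> P1" "\<And>j. \<mu>s j \<in> P1"
    and conv: "(\<lambda>j. lipdist (\<mu>s j) \<mu>) \<longlonglongrightarrow> 0"
    and supp: "AE x in \<mu>. norm x \<le> R" "\<And>j. AE x in \<mu>s j. norm x \<le> R"
    and R: "0 \<le> R"
  shows "narrowly_converges \<mu>s \<mu>"
  unfolding narrowly_converges_def
proof (intro allI impI)
  fix f :: "'a \<Rightarrow> real" assume f: "continuous_on UNIV f" "bounded (range f)"
  let ?c = "closest_point (cball (0::'a) R)"
  obtain B where B: "\<And>x. \<bar>f x\<bar> \<le> B" using f(2) unfolding bounded_iff by auto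
  have fint: "integrable \<nu> f" if "\<nu> \<in> P1" for \<nu>
  proof -
    interpret prob_space \<nu> using P1_D(1)[OF that] .
    show ?thesis using B P1_measurable[OF that borel_measurable_continuous_onI[OF f(1)]]
      by (intro integrable_const_bound[of _ B]) auto
  qed
  show "(\<lambda>j. \<integral>x. f x \<partial>\<mu>s j) \<longlonglongrightarrow> (\<integral>x. f x \<partial>\<mu>)"
  proof (rule LIMSEQ_I)
    fix r :: real assume r: "0 < r"
    obtain p where p: "real_polynomial_function p" "\<And>x. x \<in> cball 0 R \<Longrightarrow> \<bar>f x - p x\<bar> < r / 3"
      using Stone_Weierstrass_real_polynomial_function[of "cball 0 R" f "r/3"] r
        continuous_on_subset[OF f(1)] by auto
    obtain C where C: "C-lipschitz_on (cball 0 R) p"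
      using real_polynomial_function_lipschitz[OF p(1)] by blast
    have cin: "?c x \<in> cball 0 R" for x using R by (intro closest_point_in_set) auto
    have q: "(C * 1)-lipschitz_on UNIV (\<lambda>x. p (?c x))"
      using closest_point_cball[OF R] cin
      by (intro lipschitz_on_compose2[of 1]) (auto intro!: lipschitz_on_subset[OF C] simp del: mem_cball)
    have near: "\<bar>(\<integral>x. f x \<partial>\<nu>) - (\<integral>x. p (?c x) \<partial>\<nu>)\<bar> \<le> r / 3"
      if nu: "\<nu> \<in> P1" "AE x in \<nu>. norm x \<le> R" for \<nu>
    proof -
      interpret prob_space \<nu> using P1_D(1)[OF nu(1)] .
      have "norm ((\<integral>x. f x \<partial>\<nu>) - (\<integral>x. p (?c x) \<partial>\<nu>)) \<le> r / 3"
      proof (rule norm_integral_diff_le[OF fint[OF nu(1)] P1_lipschitz_integrable[OF nu(1) q]])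
        show "AE x in \<nu>. norm (f x - p (?c x)) \<le> r / 3"
          using nu(2) by eventually_elim (use p(2) in \<open>auto simp: closest_point_self less_imp_le\<close>)
      qed
      then show ?thesis by simp
    qed
    have "\<forall>\<^sub>F j in sequentially. C * lipdist (\<mu>s j) \<mu> < r / 3"
      using tendsto_mult_right_zero[OF conv, of C] r by (intro order_tendstoD(2)) auto
    then obtain n0 where n0: "\<And>j. j \<ge> n0 \<Longrightarrow> C * lipdist (\<mu>s j) \<mu> < r / 3"
      by (auto simp: eventually_sequentially)
    have "norm ((\<integral>x. f x \<partial>\<mu>s j) - (\<integral>x. f x \<partial>\<mu>)) < r" if "j \<ge> n0" for j
      using near[OF mu(1) supp(1)] near[OF mu(2) supp(2), of j] n0[OF that]
        lipdist_upper_abs[OF mu(2) mu(1) q, of j] unfolding real_norm_def mult_1_right by linarith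
    then show "\<exists>n0. \<forall>j\<ge>n0. norm ((\<integral>x. f x \<partial>\<mu>s j) - (\<integral>x. f x \<partial>\<mu>)) < r" by blast
  qed
qed

section \<open>Smooth test functions\<close>

lemma has_derivative_gradient:
  fixes \<phi> :: "real^'d \<Rightarrow> real"
  assumes "\<phi> differentiable (at x)"
  shows "(\<phi> has_derivative (\<lambda>h. gradient \<phi> x \<bullet> h)) (at x)"
proof -
  let ?D = "frechet_derivative \<phi> (at x)"
  have D: "(\<phi> has_derivative ?D) (at x)" using assms by (simp add: frechet_derivative_works)
  interpret D: linear ?D using D by (rule has_derivative_linear)
  have "?D h = gradient \<phi> x \<bullet> h" for h
  proof -
    have "(\<Sum>i\<in>UNIV. h $ i *\<^sub>R axis i 1) = h" using basis_expansion[of h] by (simp add: scalar_mult_eq_scaleR)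
    then have "?D h = ?D (\<Sum>i\<in>UNIV. h $ i *\<^sub>R axis i 1)" by simp
    also have "\<dots> = (\<Sum>i\<in>UNIV. h $ i * ?D (axis i 1))" by (simp add: D.sum D.scaleR)
    also have "\<dots> = gradient \<phi> x \<bullet> h" by (simp add: inner_vec_def gradient_def mult.commute)
    finally show ?thesis .
  qed
  then have "?D = (\<lambda>h. gradient \<phi> x \<bullet> h)" by (rule ext)
  then show ?thesis using D by simp
qed

lemma gradient_eqI:
  fixes \<phi> :: "real^'d \<Rightarrow> real"
  assumes "(\<phi> has_derivative (\<lambda>h. g \<bullet> h)) (at x)"
  shows "gradient \<phi> x = g"
  unfolding gradient_def frechet_derivative_at[OF assms, symmetric] by (simp add: vec_eq_iff inner_axis)

lemma C_k_SucI:
  assumes "\<And>x. (\<phi> has_derivative (\<lambda>h. g x \<bullet> h)) (at x)" "\<And>i. C_k k (\<lambda>x. g x $ i)"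
  shows "C_k (Suc k) \<phi>"
proof -
  have "gradient \<phi> x = g x" for x by (rule gradient_eqI[OF assms(1)])
  then show ?thesis using assms by (auto simp: differentiable_def)
qed

lemma C_k_SucD:
  assumes "C_k (Suc k) \<phi>"
  shows "(\<phi> has_derivative (\<lambda>h. gradient \<phi> x \<bullet> h)) (at x)" "C_k k (\<lambda>x. gradient \<phi> x $ i)"
  using assms has_derivative_gradient by auto

lemma C_k_continuous: "C_k k \<phi> \<Longrightarrow> continuous_on UNIV \<phi>"
  by (cases k) (auto intro!: continuous_at_imp_continuous_on differentiable_imp_continuous_within)

declare C_k.simps(2) [simp del]

lemma C_k_mono: "C_k (Suc k) \<phi> \<Longrightarrow> C_k k \<phi>"
proof (induction k arbitrary: \<phi>)
  case 0 then show ?case using C_k_continuous[of "Suc 0" \<phi>] by simp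
next
  case (Suc k)
  then show ?case using C_k_SucD[OF Suc.prems] by (metis C_k_SucI)
qed

lemma C_k_const: "C_k k (\<lambda>x::real^'d. c)"
proof (induction k arbitrary: c)
  case (Suc k)
  have "((\<lambda>x. c) has_derivative (\<lambda>h. 0 \<bullet> h)) (at x)" for x :: "real^'d" by simp
  from C_k_SucI[OF this] show ?case using Suc by simp
qed simp

lemma C_k_add: "C_k k f \<Longrightarrow> C_k k g \<Longrightarrow> C_k k (\<lambda>x. f x + g x)"
proof (induction k arbitrary: f g)
  case (Suc k)
  have "((\<lambda>x. f x + g x) has_derivative (\<lambda>h. (gradient f x + gradient g x) \<bullet> h)) (at x)" for x
    using has_derivative_add[OF C_k_SucD(1)[OF Suc.prems(1)] C_k_SucD(1)[OF Suc.prems(2)]]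
    by (simp add: inner_add_left)
  from C_k_SucI[OF this] show ?case
    using Suc.IH C_k_SucD(2)[OF Suc.prems(1)] C_k_SucD(2)[OF Suc.prems(2)] by simp
qed (auto intro: continuous_intros)

lemma C_k_mult: "C_k k f \<Longrightarrow> C_k k g \<Longrightarrow> C_k k (\<lambda>x. f x * g x)"
proof (induction k arbitrary: f g)
  case (Suc k)
  have "((\<lambda>x. f x * g x) has_derivative (\<lambda>h. (f x *\<^sub>R gradient g x + g x *\<^sub>R gradient f x) \<bullet> h)) (at x)" for x
    using has_derivative_mult[OF C_k_SucD(1)[OF Suc.prems(1)] C_k_SucD(1)[OF Suc.prems(2)]]
    by (simp add: inner_add_left mult.commute)
  then show ?case
  proof (rule C_k_SucI)
    fix i show "C_k k (\<lambda>x. (f x *\<^sub>R gradient g x + g x *\<^sub>R gradient f x) $ i)"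
      using C_k_add[OF Suc.IH[OF C_k_mono[OF Suc.prems(1)] C_k_SucD(2)[OF Suc.prems(2), of i]]
          Suc.IH[OF C_k_mono[OF Suc.prems(2)] C_k_SucD(2)[OF Suc.prems(1), of i]]] by simp
  qed
qed (auto intro: continuous_intros)

lemma C_k_prod: "finite I \<Longrightarrow> (\<And>i. i \<in> I \<Longrightarrow> C_k k (f i)) \<Longrightarrow> C_k k (\<lambda>x. \<Prod>i\<in>I. f i x)"
  by (induction I rule: finite_induct) (auto intro: C_k_const C_k_mult)

text \<open>
  Smoothness in one variable is expressed by the sequence of all derivatives, since \<open>C_k\<close> itself only
  concerns functions on \<open>real^'d\<close>.
\<close>

lemma C_k_coordinate:
  assumes "\<And>n t. (D n has_real_derivative D (Suc n) t) (at t)"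
  shows "C_k k (\<lambda>x::real^'d. D n (x $ i))"
proof (induction k arbitrary: n)
  case 0
  have "continuous_on UNIV (D n)"
    using assms by (intro continuous_at_imp_continuous_on) (auto intro: DERIV_isCont)
  then show ?case by (auto intro!: continuous_on_compose2[of UNIV "D n"] continuous_intros)
next
  case (Suc k)
  have "((\<lambda>x::real^'d. D n (x $ i)) has_derivative (\<lambda>h. axis i (D (Suc n) (x $ i)) \<bullet> h)) (at x)" for x
  proof -
    have "((\<lambda>x::real^'d. D n (x $ i)) has_derivative (\<lambda>h. D (Suc n) (x $ i) * h $ i)) (at x)"
      using assms[of n "x $ i"] unfolding has_field_derivative_def
      by (rule has_derivative_compose[rotated]) (auto intro!: bounded_linear_imp_has_derivative bounded_linear_vec_nth)
    then show ?thesis by (simp add: inner_axis')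
  qed
  moreover have "C_k k (\<lambda>x. axis i (D (Suc n) (x $ i)) $ j)" for j
    using Suc C_k_const by (cases "i = j") (auto simp: axis_def)
  ultimately show ?case by (rule C_k_SucI)
qed

text \<open>
  For \<open>p = 1\<close> this is the standard flat function \<open>exp (- 1 / t)\<close>; the polynomials in \<open>1 / t\<close> make the
  family closed under differentiation.
\<close>

definition flat :: "real poly \<Rightarrow> real \<Rightarrow> real" where
  "flat p t = (if 0 < t then poly p (1 / t) * exp (- (1 / t)) else 0)"

lemma poly_exp_tendsto_0: "((\<lambda>x. poly p x * exp (- x)) \<longlongrightarrow> (0::real)) at_top"
proof -
  have "((\<lambda>x. \<Sum>i\<le>degree p. coeff p i * (x ^ i / exp x)) \<longlongrightarrow> (\<Sum>i\<le>degree p. coeff p i * 0)) at_top"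
    by (intro tendsto_intros tendsto_power_div_exp_0)
  then show ?thesis by (simp add: poly_altdef sum_distrib_right exp_minus divide_inverse mult.assoc)
qed

lemma flat_derivative:
  "(flat p has_real_derivative flat (monom 1 2 * (p - pderiv p)) t) (at t)"
proof -
  consider "t < 0" | "t = 0" | "0 < t" by linarith
  then show ?thesis
  proof cases
    case 1
    have "((\<lambda>t. 0) has_real_derivative 0) (at t)" by simp
    then have "(flat p has_real_derivative 0) (at t)"
      by (rule has_field_derivative_transform_within_open[of _ _ _ "{..<0}"]) (use 1 in \<open>auto simp: flat_def\<close>)
    then show ?thesis using 1 by (simp add: flat_def)
  next
    case 2
    have lim: "((\<lambda>h. poly (pCons 0 p) (1 / h) * exp (- (1 / h))) \<longlongrightarrow> 0) (at_right 0)"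
      using filterlim_compose[OF poly_exp_tendsto_0[of "pCons 0 p"] filterlim_inverse_at_top_right]
      by (simp add: inverse_eq_divide)
    have "((\<lambda>h. flat p h / h) \<longlongrightarrow> 0) (at_right 0)"
      by (rule Lim_transform_eventually[OF lim])
        (use eventually_at_right_less[of "0::real"] in eventually_elim, simp add: flat_def)
    moreover have "((\<lambda>h. flat p h / h) \<longlongrightarrow> 0) (at_left 0)"
      by (rule Lim_transform_eventually[OF tendsto_const])
        (auto simp: flat_def eventually_at_filter)
    ultimately have "((\<lambda>h. flat p h / h) \<longlongrightarrow> 0) (at 0)" by (simp add: filterlim_split_at)
    then show ?thesis using 2 by (simp add: has_field_derivative_iff flat_def)
  next
    case 3
    have "((\<lambda>t. poly p (1 / t) * exp (- (1 / t))) has_real_derivative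
        flat (monom 1 2 * (p - pderiv p)) t) (at t)"
      using 3 by (auto intro!: derivative_eq_intros poly_DERIV[THEN DERIV_chain2]
          simp: flat_def poly_monom power2_eq_square field_simps)
    then show ?thesis
      by (rule has_field_derivative_transform_within_open[of _ _ _ "{0<..}"]) (use 3 in \<open>auto simp: flat_def\<close>)
  qed
qed

lemma C_k_flat:
  fixes i :: "'d::finite"
  assumes "\<bar>s\<bar> = 1"
  shows "C_k k (\<lambda>x::real^'d. flat p (e + s * x $ i))"
proof -
  define q where "q = (\<lambda>n. ((\<lambda>p. monom 1 2 * (p - pderiv p)) ^^ n) p)"
  define D where "D = (\<lambda>n t. s ^ n * flat (q n) (e + s * t))"
  have "(D n has_real_derivative D (Suc n) t) (at t)" for n t
  proof -
    have "((\<lambda>t. flat (q n) (e + s * t)) has_real_derivative flat (q (Suc n)) (e + s * t) * s) (at t)"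
      unfolding q_def funpow.simps comp_def
      by (rule DERIV_chain2[OF flat_derivative]) (auto intro!: derivative_eq_intros)
    then show ?thesis unfolding D_def by (auto intro!: derivative_eq_intros simp: mult_ac)
  qed
  from C_k_coordinate[of D, OF this, of k 0 i] show ?thesis by (simp add: D_def q_def)
qed

lemma continuous_compact_support_integrable:
  fixes f :: "'a::euclidean_space \<Rightarrow> real"
  assumes "continuous_on UNIV f" "compact (closure {x. f x \<noteq> 0})"
  shows "integrable lborel f"
proof -
  have "integrable lborel (\<lambda>x. indicator (closure {x. f x \<noteq> 0}) x *\<^sub>R f x)"
    using assms continuous_on_subset by (intro borel_integrable_compact) blast+
  moreover have "indicator (closure {x. f x \<noteq> 0}) x *\<^sub>R f x = f x" for x
    using closure_subset[of "{x. f x \<noteq> 0}"] by (cases "f x = 0") (auto simp: indicator_def)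
  ultimately show ?thesis by (simp only:)
qed

lemma compact_supportI:
  fixes f :: "'a::euclidean_space \<Rightarrow> 'b::zero"
  assumes "\<And>x. R < norm x \<Longrightarrow> f x = 0"
  shows "compact (closure {x. f x \<noteq> 0})"
proof -
  have "{x. f x \<noteq> 0} \<subseteq> cball 0 R" using assms by (force simp: not_le[symmetric])
  then show ?thesis by (meson bounded_cball bounded_subset compact_closure)
qed

lemma compact_supportE:
  fixes f :: "'a::euclidean_space \<Rightarrow> 'b::zero"
  assumes "compact (closure {x. f x \<noteq> 0})"
  obtains R where "0 < R" "\<And>x. R < norm x \<Longrightarrow> f x = 0"
proof -
  obtain R where "0 < R" "\<forall>x\<in>{x. f x \<noteq> 0}. norm x \<le> R"
    using assms bounded_pos compact_closure by metis
  then show thesis by (intro that) force+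
qed

lemma test_functionsD:
  assumes "\<phi> \<in> test_functions"
  shows "C_k k \<phi>" "continuous_on UNIV \<phi>" "compact (closure {x. \<phi> x \<noteq> 0})" "integrable lborel \<phi>"
    "(\<phi> has_derivative (\<lambda>h. gradient \<phi> x \<bullet> h)) (at x)"
proof -
  show 1: "C_k k \<phi>" for k using assms by (auto simp: test_functions_def)
  show 2: "compact (closure {x. \<phi> x \<noteq> 0})" using assms by (auto simp: test_functions_def)
  show "continuous_on UNIV \<phi>" using C_k_continuous 1 by blast
  then show "integrable lborel \<phi>" using 2 by (rule continuous_compact_support_integrable)
  show "(\<phi> has_derivative (\<lambda>h. gradient \<phi> x \<bullet> h)) (at x)" using 1[of "Suc 0"] C_k_SucD(1) by blast
qed

text \<open>
  A product over the coordinates of flat functions, supported in a cube that lies in the ball of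
  radius \<open>e\<close>, divided by its integral.
\<close>

lemma mollifier_exists:
  assumes "0 < e"
  obtains \<rho> :: "real^'d \<Rightarrow> real" where "\<rho> \<in> test_functions" "\<And>x. 0 \<le> \<rho> x"
    "\<And>x. e < norm x \<Longrightarrow> \<rho> x = 0" "(\<integral>x. \<rho> x \<partial>lborel) = 1"
proof -
  define r where "r = e / CARD('d)"
  have r: "0 < r" using assms by (simp add: r_def)
  define b :: "real^'d \<Rightarrow> real" where "b = (\<lambda>x. \<Prod>i\<in>UNIV. flat 1 (r + 1 * x $ i) * flat 1 (r + (-1) * x $ i))"
  have bC: "C_k k b" for k
    unfolding b_def by (intro C_k_prod C_k_mult C_k_flat) auto
  have b0: "0 \<le> b x" for x by (auto simp: b_def flat_def intro!: prod_nonneg)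
  have bz: "b x = 0" if "e < norm x" for x
  proof -
    have "\<exists>i. r \<le> \<bar>x $ i\<bar>"
    proof (rule ccontr)
      assume "\<nexists>i. r \<le> \<bar>x $ i\<bar>"
      then have "(\<Sum>i\<in>UNIV. \<bar>x $ i\<bar>) \<le> (\<Sum>i\<in>(UNIV::'d set). r)" by (intro sum_mono) (auto simp: not_le less_imp_le)
      then show False using that norm_le_l1_cart[of x] by (simp add: r_def)
    qed
    then obtain i where "r \<le> \<bar>x $ i\<bar>" by blast
    then have "flat 1 (r + 1 * x $ i) * flat 1 (r + (-1) * x $ i) = 0" by (auto simp: flat_def)
    then show ?thesis unfolding b_def by (intro prod_zero) auto
  qed
  have bt: "b \<in> test_functions" using bC compact_supportI[of e b] bz by (auto simp: test_functions_def)
  note i = test_functionsD(4)[OF bt]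
  have "b 0 > 0" using r by (auto simp: b_def flat_def intro!: prod_pos)
  moreover have "(\<integral>x. b x \<partial>lborel) \<noteq> 0"
  proof
    assume "(\<integral>x. b x \<partial>lborel) = 0"
    then have "AE x in lborel. b x = 0" using i b0 by (subst (asm) integral_nonneg_eq_0_iff_AE) auto
    then have "AE x in lebesgue. x \<notin> {x. b x \<noteq> 0}" by (intro AE_completion) auto
    then have "negligible {x. b x \<noteq> 0}"
      by (simp add: negligible_iff_null_sets eventually_ae_filter_negligible) (meson negligible_iff_null_sets negligible_subset)
    moreover have "open {x. b x \<noteq> 0}"
      using test_functionsD(2)[OF bt] by (intro open_Collect_neq) auto
    ultimately have "{x. b x \<noteq> 0} = {}" using open_not_negligible by blast
    then show False using \<open>b 0 > 0\<close> by auto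
  qed
  ultimately have I: "(\<integral>x. b x \<partial>lborel) > 0"
    using Bochner_Integration.integral_nonneg[of lborel b, OF b0] by linarith
  define c where "c = 1 / (\<integral>x. b x \<partial>lborel)"
  show thesis
  proof (rule that[of "\<lambda>x. c * b x"])
    show "(\<lambda>x. c * b x) \<in> test_functions"
      using C_k_mult[OF C_k_const bC] compact_supportI[of e "\<lambda>x. c * b x"] bz by (auto simp: test_functions_def)
    show "(\<integral>x. c * b x \<partial>lborel) = 1" using I by (simp add: c_def)
  qed (use b0 bz I in \<open>auto simp: c_def\<close>)
qed

lemma test_gradient:
  assumes "\<phi> \<in> test_functions" shows "(\<lambda>x. gradient \<phi> x $ i) \<in> test_functions"
proof -
  obtain R where R: "0 < R" "\<And>x. R < norm x \<Longrightarrow> \<phi> x = 0"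
    using compact_supportE[OF test_functionsD(3)[OF assms]] by metis
  have "gradient \<phi> x = 0" if "R < norm x" for x
  proof (rule gradient_eqI)
    have "((\<lambda>_. 0) has_derivative (\<lambda>h. 0 \<bullet> h)) (at x)" by simp
    then show "(\<phi> has_derivative (\<lambda>h. 0 \<bullet> h)) (at x)"
      by (rule has_derivative_transform_within_open[of _ _ _ _ "- cball 0 R"]) (use that R in auto)
  qed
  then have "compact (closure {x. gradient \<phi> x $ i \<noteq> 0})" by (intro compact_supportI[of R]) auto
  moreover have "C_k k (\<lambda>x. gradient \<phi> x $ i)" for k
    using C_k_SucD(2)[OF test_functionsD(1)[OF assms]] .
  ultimately show ?thesis by (auto simp: test_functions_def)
qed

lemma test_bounded:
  assumes "\<phi> \<in> test_functions" obtains B where "0 \<le> B" "\<And>x. \<bar>\<phi> x\<bar> \<le> B"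
proof -
  let ?K = "closure {x. \<phi> x \<noteq> 0}"
  have "bounded (\<phi> ` ?K)"
    by (intro compact_imp_bounded compact_continuous_image test_functionsD(3)[OF assms]
        continuous_on_subset[OF test_functionsD(2)[OF assms]] subset_UNIV)
  then obtain B where B: "0 < B" "\<forall>y\<in>\<phi> ` ?K. norm y \<le> B" unfolding bounded_pos by auto
  have "\<bar>\<phi> x\<bar> \<le> B" for x
  proof (cases "\<phi> x = 0")
    case False
    then have "x \<in> ?K" using subsetD[OF closure_subset, of x "{x. \<phi> x \<noteq> 0}"] by simp
    then show ?thesis using B(2) by simp
  qed (use B(1) in simp)
  then show thesis using B(1) by (intro that[of B]) auto
qed

lemma gradient_bounded:
  fixes \<phi> :: "real^'d \<Rightarrow> real"
  assumes "\<phi> \<in> test_functions" obtains B where "0 \<le> B" "\<And>x. norm (gradient \<phi> x) \<le> B"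
proof -
  have "\<exists>B. \<forall>x. \<bar>gradient \<phi> x $ i\<bar> \<le> B" for i
    using test_bounded[OF test_gradient[OF assms, of i]] by metis
  then obtain B where B: "\<And>i x. \<bar>gradient \<phi> x $ i\<bar> \<le> B i" by metis
  have "norm (gradient \<phi> x) \<le> (\<Sum>i\<in>UNIV. B i)" for x
    using norm_le_l1_cart[of "gradient \<phi> x"] sum_mono[of UNIV "\<lambda>i. \<bar>gradient \<phi> x $ i\<bar>" B] B by force
  then show thesis by (metis that norm_ge_zero order_trans)
qed

lemma test_lipschitz:
  assumes "\<phi> \<in> test_functions" obtains K where "K-lipschitz_on UNIV \<phi>"
proof -
  obtain B where B: "0 \<le> B" "\<And>x. norm (gradient \<phi> x) \<le> B" using gradient_bounded[OF assms] by metis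
  have "B-lipschitz_on UNIV \<phi>"
  proof (rule lipschitz_onI[OF _ B(1)])
    fix x y
    have "norm (\<phi> x - \<phi> y) \<le> B * norm (x - y)"
    proof (rule differentiable_bound[of UNIV \<phi> "\<lambda>x h. gradient \<phi> x \<bullet> h"])
      show "onorm ((\<bullet>) (gradient \<phi> x)) \<le> B" for x
        using order_trans[OF Cauchy_Schwarz_ineq2 mult_right_mono[OF B(2) norm_ge_zero]]
        by (intro onorm_le) simp
    qed (use test_functionsD(5)[OF assms] in auto)
    then show "dist (\<phi> x) (\<phi> y) \<le> B * dist x y" by (simp add: dist_norm)
  qed
  then show thesis by (rule that)
qed

lemma lipschitz_vecI:
  fixes f :: "'a::metric_space \<Rightarrow> real^'d"
  assumes "\<And>i. (K i)-lipschitz_on S (\<lambda>x. f x $ i)"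
  shows "(\<Sum>i\<in>UNIV. K i)-lipschitz_on S f"
proof (rule lipschitz_onI)
  fix x y assume xy: "x \<in> S" "y \<in> S"
  have "dist (f x) (f y) \<le> (\<Sum>i\<in>UNIV. \<bar>(f x - f y) $ i\<bar>)" unfolding dist_norm by (rule norm_le_l1_cart)
  also have "\<dots> \<le> (\<Sum>i\<in>UNIV. K i * dist x y)"
    using lipschitz_onD[OF assms xy] by (intro sum_mono) (simp add: dist_real_def)
  finally show "dist (f x) (f y) \<le> (\<Sum>i\<in>UNIV. K i) * dist x y" by (simp add: sum_distrib_right)
qed (auto intro!: sum_nonneg lipschitz_on_nonneg[OF assms])

lemma test_gradient_lipschitz:
  assumes "\<phi> \<in> test_functions" obtains K where "K-lipschitz_on UNIV (gradient \<phi>)"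
proof -
  have "\<exists>K. K-lipschitz_on UNIV (\<lambda>x. gradient \<phi> x $ i)" for i
    using test_lipschitz[OF test_gradient[OF assms, of i]] by metis
  then obtain K where "\<And>i. (K i)-lipschitz_on UNIV (\<lambda>x. gradient \<phi> x $ i)" by metis
  then show thesis using lipschitz_vecI that by blast
qed

lemma gradient_taylor:
  fixes \<phi> :: "real^'d \<Rightarrow> real"
  assumes d: "\<And>x. (\<phi> has_derivative (\<lambda>h. g x \<bullet> h)) (at x)" and K: "K-lipschitz_on UNIV g"
  shows "\<bar>\<phi> (x + h) - \<phi> x - g x \<bullet> h\<bar> \<le> K * (norm h)\<^sup>2"
proof -
  have "((\<lambda>t. \<phi> (x + t *\<^sub>R h)) has_derivative (\<lambda>s. g (x + t *\<^sub>R h) \<bullet> (s *\<^sub>R h))) (at t within {0..1})" for t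
  proof -
    have "((\<lambda>t. x + t *\<^sub>R h) has_derivative (\<lambda>s. s *\<^sub>R h)) (at t within {0..1})"
      by (auto intro!: derivative_eq_intros)
    from has_derivative_compose[OF this d] show ?thesis .
  qed
  then obtain t where t: "t \<in> {0<..<1}" "\<phi> (x + 1 *\<^sub>R h) - \<phi> (x + 0 *\<^sub>R h) = g (x + t *\<^sub>R h) \<bullet> ((1 - 0) *\<^sub>R h)"
    using mvt_simple[of 0 1 "\<lambda>t. \<phi> (x + t *\<^sub>R h)" "\<lambda>t s. g (x + t *\<^sub>R h) \<bullet> (s *\<^sub>R h)"] by auto
  then have "\<bar>\<phi> (x + h) - \<phi> x - g x \<bullet> h\<bar> = \<bar>(g (x + t *\<^sub>R h) - g x) \<bullet> h\<bar>" by (simp add: inner_diff_left)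
  also have "\<dots> \<le> norm (g (x + t *\<^sub>R h) - g x) * norm h" by (rule Cauchy_Schwarz_ineq2)
  also have "\<dots> \<le> (K * norm h) * norm h"
  proof (rule mult_right_mono)
    have "norm (g (x + t *\<^sub>R h) - g x) \<le> K * norm (t *\<^sub>R h)"
      using lipschitz_onD[OF K, of "x + t *\<^sub>R h" x] by (simp add: dist_norm)
    also have "\<dots> \<le> K * norm h"
      using t(1) lipschitz_on_nonneg[OF K] by (intro mult_left_mono) (auto simp: mult_left_le_one_le)
    finally show "norm (g (x + t *\<^sub>R h) - g x) \<le> K * norm h" .
  qed simp
  finally show ?thesis by (simp add: power2_eq_square mult.assoc)
qed


section \<open>Mollification of Lipschitz functions\<close>

definition mollify :: "('a::euclidean_space \<Rightarrow> real) \<Rightarrow> ('a \<Rightarrow> real) \<Rightarrow> 'a \<Rightarrow> real" where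
  "mollify \<rho> \<phi> x = (\<integral>z. \<rho> z * \<phi> (x - z) \<partial>lborel)"

lemma mollify_integrable:
  fixes \<rho> \<phi> :: "real^'d \<Rightarrow> real"
  assumes "\<rho> \<in> test_functions" "continuous_on UNIV \<phi>"
  shows "integrable lborel (\<lambda>z. \<rho> z * \<phi> (x - z))"
proof -
  obtain R where R: "0 < R" "\<And>x. R < norm x \<Longrightarrow> \<rho> x = 0"
    using compact_supportE[OF test_functionsD(3)[OF assms(1)]] by metis
  have "continuous_on UNIV (\<lambda>z. \<phi> (x - z))"
    by (rule continuous_on_compose2[OF assms(2)]) (auto intro!: continuous_intros)
  then show ?thesis
    using R test_functionsD(2)[OF assms(1)]
    by (intro continuous_compact_support_integrable continuous_on_mult compact_supportI[of R]) auto
qed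

lemma mollify_reflect:
  fixes \<rho> \<phi> :: "real^'d \<Rightarrow> real"
  assumes "\<rho> \<in> test_functions" "continuous_on UNIV \<phi>"
  shows "mollify \<rho> \<phi> x = (\<integral>z. \<rho> (x - z) * \<phi> z \<partial>lborel)"
    "compact (closure {x. \<phi> x \<noteq> 0}) \<Longrightarrow> integrable lborel (\<lambda>z. \<rho> (x - z) * \<phi> z)"
proof -
  let ?f = "\<lambda>z. \<rho> z * \<phi> (x - z)"
  have f: "?f \<in> borel_measurable borel"
    using borel_measurable_integrable[OF mollify_integrable[OF assms]] by simp
  have d: "distr lborel borel (\<lambda>z::real^'d. x - z) = lborel"
    using lborel_affine[of "-1" x] by (simp add: density_1)
  have "(\<integral>z. ?f z \<partial>distr lborel borel (\<lambda>z::real^'d. x - z)) = (\<integral>z. ?f (x - z) \<partial>lborel)"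
    by (rule integral_distr[OF _ f]) simp
  then show "mollify \<rho> \<phi> x = (\<integral>z. \<rho> (x - z) * \<phi> z \<partial>lborel)"
    unfolding d by (simp add: mollify_def)
  assume "compact (closure {x. \<phi> x \<noteq> 0})"
  then obtain R where R: "0 < R" "\<And>x. R < norm x \<Longrightarrow> \<phi> x = 0"
    using compact_supportE by metis
  have "continuous_on UNIV (\<lambda>z. \<rho> (x - z))"
    by (rule continuous_on_compose2[OF test_functionsD(2)[OF assms(1)]]) (auto intro!: continuous_intros)
  then show "integrable lborel (\<lambda>z. \<rho> (x - z) * \<phi> z)"
    using R assms(2)
    by (intro continuous_compact_support_integrable continuous_on_mult compact_supportI[of R]) auto
qed

text \<open>
  After reflection the variable sits in \<open>\<rho>\<close>, whose first-order expansion has a quadratic error that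
  is uniform in the point; integrating it against the compactly supported \<open>\<phi>\<close> keeps it quadratic.
\<close>

lemma mollify_has_derivative:
  fixes \<rho> \<phi> :: "real^'d \<Rightarrow> real"
  assumes \<rho>: "\<rho> \<in> test_functions" and \<phi>: "continuous_on UNIV \<phi>" "compact (closure {x. \<phi> x \<noteq> 0})"
  shows "(mollify \<rho> \<phi> has_derivative (\<lambda>h. (\<chi> i. mollify (\<lambda>x. gradient \<rho> x $ i) \<phi> x) \<bullet> h)) (at x)"
proof -
  define g where "g = (\<lambda>x. \<chi> i. mollify (\<lambda>x. gradient \<rho> x $ i) \<phi> x)"
  obtain K where K: "K-lipschitz_on UNIV (gradient \<rho>)" using test_gradient_lipschitz[OF \<rho>] by metis
  define A where "A = (\<integral>z. \<bar>\<phi> z\<bar> \<partial>lborel)"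
  have ia: "integrable lborel (\<lambda>z. \<bar>\<phi> z\<bar>)"
    using continuous_compact_support_integrable[OF \<phi>] by simp
  have A: "0 \<le> A" by (simp add: A_def)
  have g: "g x \<bullet> h = (\<integral>z. (gradient \<rho> (x - z) \<bullet> h) * \<phi> z \<partial>lborel)"
    "integrable lborel (\<lambda>z. (gradient \<rho> (x - z) \<bullet> h) * \<phi> z)" for h
  proof -
    note 1 = mollify_reflect(1)[OF test_gradient[OF \<rho>] \<phi>(1)]
    note 2 = mollify_reflect(2)[OF test_gradient[OF \<rho>] \<phi>(1) \<phi>(2)]
    have eq: "(gradient \<rho> (x - z) \<bullet> h) * \<phi> z = (\<Sum>i\<in>UNIV. (gradient \<rho> (x - z) $ i * \<phi> z) * h $ i)" for z
      unfolding inner_vec_def sum_distrib_right by (intro sum.cong) simp_all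
    show "integrable lborel (\<lambda>z. (gradient \<rho> (x - z) \<bullet> h) * \<phi> z)"
      unfolding eq by (intro Bochner_Integration.integrable_sum integrable_mult_left 2)
    have "g x \<bullet> h = (\<Sum>i\<in>UNIV. (\<integral>z. (gradient \<rho> (x - z) $ i * \<phi> z) * h $ i \<partial>lborel))"
      by (simp add: inner_vec_def g_def 1)
    also have "\<dots> = (\<integral>z. (gradient \<rho> (x - z) \<bullet> h) * \<phi> z \<partial>lborel)"
      unfolding eq by (rule Bochner_Integration.integral_sum[symmetric]) (intro integrable_mult_left 2)
    finally show "g x \<bullet> h = (\<integral>z. (gradient \<rho> (x - z) \<bullet> h) * \<phi> z \<partial>lborel)" .
  qed
  have bound: "\<bar>mollify \<rho> \<phi> (x + h) - mollify \<rho> \<phi> x - g x \<bullet> h\<bar> \<le> A * K * (norm h)\<^sup>2" for h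
  proof -
    note r = mollify_reflect(1)[OF \<rho> \<phi>(1)] and i = mollify_reflect(2)[OF \<rho> \<phi>(1) \<phi>(2)]
    let ?e = "\<lambda>z. \<rho> (x + h - z) - \<rho> (x - z) - gradient \<rho> (x - z) \<bullet> h"
    have int: "integrable lborel (\<lambda>z. ?e z * \<phi> z)"
      using i[of "x + h"] i[of x] g(2)[of h] by (simp add: left_diff_distrib)
    have eq: "mollify \<rho> \<phi> (x + h) - mollify \<rho> \<phi> x - g x \<bullet> h = (\<integral>z. ?e z * \<phi> z \<partial>lborel)"
      using i[of "x + h"] i[of x] g(2)[of h] unfolding r g(1) by (simp add: left_diff_distrib)
    have "\<bar>\<integral>z. ?e z * \<phi> z \<partial>lborel\<bar> \<le> (\<integral>z. \<bar>?e z * \<phi> z\<bar> \<partial>lborel)" by (rule integral_abs_bound)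
    also have "\<dots> \<le> (\<integral>z. K * (norm h)\<^sup>2 * \<bar>\<phi> z\<bar> \<partial>lborel)"
    proof (rule integral_mono)
      fix z
      have "\<bar>?e z\<bar> \<le> K * (norm h)\<^sup>2"
        using gradient_taylor[OF test_functionsD(5)[OF \<rho>] K, of "x - z" h] by (simp add: algebra_simps)
      then show "\<bar>?e z * \<phi> z\<bar> \<le> K * (norm h)\<^sup>2 * \<bar>\<phi> z\<bar>"
        unfolding abs_mult by (rule mult_right_mono) simp
    qed (use int ia in auto)
    also have "\<dots> = A * K * (norm h)\<^sup>2" by (simp add: A_def)
    finally show ?thesis unfolding eq .
  qed
  have AK: "0 \<le> A * K" using A lipschitz_on_nonneg[OF K] by simp
  have gx: "(\<chi> i. mollify (\<lambda>x. gradient \<rho> x $ i) \<phi> x) = g x" by (simp add: g_def)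
  show ?thesis
    unfolding has_derivative_at_alt gx
  proof (intro conjI allI impI bounded_linear_inner_right)
    fix e :: real assume e: "0 < e"
    show "\<exists>d>0. \<forall>y. norm (y - x) < d \<longrightarrow> norm (mollify \<rho> \<phi> y - mollify \<rho> \<phi> x - g x \<bullet> (y - x)) \<le> e * norm (y - x)"
    proof (intro exI[of _ "e / (A * K + 1)"] conjI allI impI)
      fix y assume y: "norm (y - x) < e / (A * K + 1)"
      then have "(A * K + 1) * norm (y - x) < e" using AK by (simp add: pos_less_divide_eq mult.commute)
      then have "(A * K) * norm (y - x) \<le> e" using norm_ge_zero[of "y - x"] unfolding distrib_right by linarith
      then have "A * K * (norm (y - x))\<^sup>2 \<le> e * norm (y - x)"
        by (simp add: power2_eq_square mult.assoc[symmetric] mult_right_mono)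
      then show "norm (mollify \<rho> \<phi> y - mollify \<rho> \<phi> x - g x \<bullet> (y - x)) \<le> e * norm (y - x)"
        using bound[of "y - x"] by simp
    qed (use AK e in simp)
  qed
qed

lemma gradient_mollify:
  fixes \<rho> \<phi> :: "real^'d \<Rightarrow> real"
  assumes "\<rho> \<in> test_functions" "continuous_on UNIV \<phi>" "compact (closure {x. \<phi> x \<noteq> 0})"
  shows "gradient (mollify \<rho> \<phi>) x $ i = mollify (\<lambda>x. gradient \<rho> x $ i) \<phi> x"
  using gradient_eqI[OF mollify_has_derivative[OF assms]] by simp

lemma mollify_test:
  fixes \<rho> \<phi> :: "real^'d \<Rightarrow> real"
  assumes \<rho>: "\<rho> \<in> test_functions" and \<phi>: "continuous_on UNIV \<phi>" "compact (closure {x. \<phi> x \<noteq> 0})"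
  shows "mollify \<rho> \<phi> \<in> test_functions"
proof -
  have "C_k k (mollify \<rho> \<phi>)" for k
    using \<rho>
  proof (induction k arbitrary: \<rho>)
    case 0
    have "isCont (mollify \<rho> \<phi>) x" for x
      using mollify_has_derivative[OF 0 \<phi>] has_derivative_continuous by blast
    then show ?case by (simp add: continuous_at_imp_continuous_on)
  next
    case (Suc k)
    show ?case
      by (rule C_k_SucI[OF mollify_has_derivative[OF Suc.prems \<phi>]])
        (simp add: Suc.IH[OF test_gradient[OF Suc.prems]])
  qed
  moreover
  obtain R where R: "0 < R" "\<And>x. R < norm x \<Longrightarrow> \<rho> x = 0"
    using compact_supportE[OF test_functionsD(3)[OF \<rho>]] by metis
  obtain S where S: "0 < S" "\<And>x. S < norm x \<Longrightarrow> \<phi> x = 0"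
    using compact_supportE[OF \<phi>(2)] by metis
  have "mollify \<rho> \<phi> x = 0" if "R + S < norm x" for x
  proof -
    have "\<rho> z * \<phi> (x - z) = 0" for z
    proof (cases "R < norm z")
      case False
      then have "S < norm (x - z)" using that norm_triangle_sub[of x z] by linarith
      then show ?thesis using S by simp
    qed (use R in simp)
    then show ?thesis unfolding mollify_def by (simp only: lebesgue_integral_const) simp
  qed
  then have "compact (closure {x. mollify \<rho> \<phi> x \<noteq> 0})" by (rule compact_supportI)
  ultimately show ?thesis by (simp add: test_functions_def)
qed

lemma mollify_diff_bound:
  fixes \<rho> :: "real^'d \<Rightarrow> real"
  assumes \<rho>: "\<rho> \<in> test_functions" and f: "continuous_on UNIV f" "continuous_on UNIV g"
    and b: "\<And>z. \<rho> z \<noteq> 0 \<Longrightarrow> \<bar>f (x - z) - g (y - z)\<bar> \<le> c"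
  shows "\<bar>mollify \<rho> f x - mollify \<rho> g y\<bar> \<le> c * (\<integral>z. \<bar>\<rho> z\<bar> \<partial>lborel)"
proof -
  note i = mollify_integrable[OF \<rho> f(1), of x] mollify_integrable[OF \<rho> f(2), of y]
  have eq: "mollify \<rho> f x - mollify \<rho> g y = (\<integral>z. \<rho> z * f (x - z) - \<rho> z * g (y - z) \<partial>lborel)"
    unfolding mollify_def using i by simp
  have "\<bar>\<integral>z. \<rho> z * f (x - z) - \<rho> z * g (y - z) \<partial>lborel\<bar> \<le> (\<integral>z. \<bar>\<rho> z * f (x - z) - \<rho> z * g (y - z)\<bar> \<partial>lborel)" by (rule integral_abs_bound)
  also have "\<dots> \<le> (\<integral>z. c * \<bar>\<rho> z\<bar> \<partial>lborel)"
  proof (rule integral_mono)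
    fix z
    show "\<bar>\<rho> z * f (x - z) - \<rho> z * g (y - z)\<bar> \<le> c * \<bar>\<rho> z\<bar>"
    proof (cases "\<rho> z = 0")
      case False
      then have "\<bar>\<rho> z\<bar> * \<bar>f (x - z) - g (y - z)\<bar> \<le> \<bar>\<rho> z\<bar> * c" using b by (intro mult_left_mono) auto
      then show ?thesis by (simp add: abs_mult[symmetric] right_diff_distrib mult.commute)
    qed simp
  qed (use i test_functionsD(4)[OF \<rho>] in auto)
  also have "\<dots> = c * (\<integral>z. \<bar>\<rho> z\<bar> \<partial>lborel)" by simp
  finally show ?thesis unfolding eq .
qed

lemma mollify_lipschitz:
  fixes \<rho> :: "real^'d \<Rightarrow> real"
  assumes \<rho>: "\<rho> \<in> test_functions" and \<phi>: "C-lipschitz_on UNIV \<phi>"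
  shows "(C * (\<integral>z. \<bar>\<rho> z\<bar> \<partial>lborel))-lipschitz_on UNIV (mollify \<rho> \<phi>)"
proof (rule lipschitz_onI)
  note c = lipschitz_on_continuous_on[OF \<phi>]
  fix x y
  have "\<bar>mollify \<rho> \<phi> x - mollify \<rho> \<phi> y\<bar> \<le> (C * dist x y) * (\<integral>z. \<bar>\<rho> z\<bar> \<partial>lborel)"
  proof (rule mollify_diff_bound[OF \<rho> c c])
    fix z show "\<bar>\<phi> (x - z) - \<phi> (y - z)\<bar> \<le> C * dist x y"
      using lipschitz_onD[OF \<phi>, of "x - z" "y - z"] by (simp add: dist_norm)
  qed
  then show "dist (mollify \<rho> \<phi> x) (mollify \<rho> \<phi> y) \<le> C * (\<integral>z. \<bar>\<rho> z\<bar> \<partial>lborel) * dist x y"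
    by (simp add: dist_real_def mult_ac)
qed (use lipschitz_on_nonneg[OF \<phi>] in simp)

text \<open>
  The constant depends on the mollifier alone, which makes the Euler error \<open>o(d)\<close> uniform over all
  test functions obtained from 1-Lipschitz functions.
\<close>

lemma gradient_mollify_lipschitz:
  fixes \<rho> :: "real^'d \<Rightarrow> real"
  assumes \<rho>: "\<rho> \<in> test_functions"
  obtains K where "\<And>\<phi>. 1-lipschitz_on UNIV \<phi> \<Longrightarrow> compact (closure {x. \<phi> x \<noteq> 0}) \<Longrightarrow>
    K-lipschitz_on UNIV (gradient (mollify \<rho> \<phi>))"
proof (rule that)
  fix \<phi> :: "real^'d \<Rightarrow> real" assume \<phi>: "1-lipschitz_on UNIV \<phi>" "compact (closure {x. \<phi> x \<noteq> 0})"
  show "(\<Sum>i\<in>UNIV. 1 * (\<integral>z. \<bar>gradient \<rho> z $ i\<bar> \<partial>lborel))-lipschitz_on UNIV (gradient (mollify \<rho> \<phi>))"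
    unfolding gradient_mollify[OF \<rho> lipschitz_on_continuous_on[OF \<phi>(1)] \<phi>(2)]
    by (rule lipschitz_vecI)
      (unfold gradient_mollify[OF \<rho> lipschitz_on_continuous_on[OF \<phi>(1)] \<phi>(2)], rule mollify_lipschitz[OF test_gradient[OF \<rho>] \<phi>(1)])
qed

lemma mollify_close:
  fixes \<rho> :: "real^'d \<Rightarrow> real"
  assumes \<rho>: "\<rho> \<in> test_functions" "\<And>x. 0 \<le> \<rho> x" "\<And>x. e < norm x \<Longrightarrow> \<rho> x = 0" "(\<integral>x. \<rho> x \<partial>lborel) = 1"
    and \<phi>: "1-lipschitz_on UNIV \<phi>"
  shows "\<bar>mollify \<rho> \<phi> x - \<phi> x\<bar> \<le> e"
proof -
  have "\<bar>mollify \<rho> \<phi> x - mollify \<rho> (\<lambda>_. \<phi> x) 0\<bar> \<le> e * (\<integral>z. \<bar>\<rho> z\<bar> \<partial>lborel)"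
  proof (rule mollify_diff_bound[OF \<rho>(1) lipschitz_on_continuous_on[OF \<phi>]])
    fix z assume "\<rho> z \<noteq> 0"
    then have "norm z \<le> e" using \<rho>(3) by (meson not_le)
    then show "\<bar>\<phi> (x - z) - \<phi> x\<bar> \<le> e" using lipschitz_onD[OF \<phi>, of "x - z" x] by (simp add: dist_norm)
  qed simp
  moreover have "mollify \<rho> (\<lambda>_. \<phi> x) 0 = \<phi> x" using \<rho>(4) by (simp add: mollify_def)
  moreover have "(\<integral>z. \<bar>\<rho> z\<bar> \<partial>lborel) = 1" using \<rho>(2,4) by simp
  ultimately show ?thesis by simp
qed

lemma mollify_shift:
  fixes \<rho> :: "real^'d \<Rightarrow> real"
  assumes \<rho>: "\<rho> \<in> test_functions" "(\<integral>x. \<rho> x \<partial>lborel) = 1" and \<phi>: "continuous_on UNIV \<phi>"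
  shows "mollify \<rho> (\<lambda>x. \<phi> x - c) x = mollify \<rho> \<phi> x - c"
  using mollify_integrable[OF \<rho>(1) \<phi>, of x] test_functionsD(4)[OF \<rho>(1)] \<rho>(2)
  by (simp add: mollify_def right_diff_distrib)

text \<open>
  Clamping \<open>\<phi> - \<phi> 0\<close> between \<open>- h\<close> and \<open>h\<close>, where \<open>h x = max 0 (2 R - norm x)\<close> is 1-Lipschitz, does not
  increase the Lipschitz constant, and it has no effect where \<open>norm x \<le> R \<le> h x\<close>.
\<close>

lemma lipschitz_cutoff:
  fixes \<phi> :: "'a::euclidean_space \<Rightarrow> real"
  assumes \<phi>: "1-lipschitz_on UNIV \<phi>" and R: "0 \<le> R"
  obtains \<psi> :: "'a \<Rightarrow> real" where "1-lipschitz_on UNIV \<psi>" "compact (closure {x. \<psi> x \<noteq> 0})"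
    "\<And>x. norm x \<le> R \<Longrightarrow> \<psi> x = \<phi> x - \<phi> 0"
proof -
  define h where "h = (\<lambda>x::'a. max 0 (2 * R - norm x))"
  define \<psi> where "\<psi> = (\<lambda>x. max (- h x) (min (h x) (\<phi> x - \<phi> 0)))"
  have h: "\<bar>h x - h y\<bar> \<le> dist x y" for x y
    using norm_triangle_ineq3[of x y] unfolding h_def dist_norm by (auto simp: max_def abs_le_iff)
  have p: "\<bar>\<phi> x - \<phi> y\<bar> \<le> dist x y" for x y using lipschitz_onD[OF \<phi>, of x y] by (simp add: dist_real_def)
  show thesis
  proof (rule that[of \<psi>])
    show "1-lipschitz_on UNIV \<psi>"
    proof (rule lipschitz_onI)
      fix x y
      have "\<bar>\<psi> x - \<psi> y\<bar> \<le> dist x y"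
        using h[of x y] p[of x y] unfolding \<psi>_def max_def min_def by (auto simp: abs_le_iff)
      then show "dist (\<psi> x) (\<psi> y) \<le> 1 * dist x y" by (simp add: dist_real_def)
    qed simp
    show "compact (closure {x. \<psi> x \<noteq> 0})"
      by (rule compact_supportI[of "2 * R"]) (simp add: \<psi>_def h_def)
    fix x :: 'a assume "norm x \<le> R"
    then show "\<psi> x = \<phi> x - \<phi> 0" using p[of x 0] by (simp add: \<psi>_def h_def abs_le_iff)
  qed
qed

section \<open>Bounded and globally Lipschitz velocity fields\<close>

locale lipschitz_field =
  fixes H :: "real^'d \<Rightarrow> real^'d" and G :: "'d \<Rightarrow> real^'d \<Rightarrow> real^'d" and \<Lambda> M B :: real
  assumes H_lip: "\<Lambda>-lipschitz_on UNIV H" and G_lip: "\<And>l. \<Lambda>-lipschitz_on UNIV (G l)"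
    and H_bd: "\<And>x. norm (H x) \<le> M" and G_bd: "\<And>l x. norm (G l x) \<le> M" and B_nonneg: "0 \<le> B"
begin

lemma \<Lambda>_nonneg: "0 \<le> \<Lambda>" using H_lip by (rule lipschitz_on_nonneg)

lemma M_nonneg: "0 \<le> M" using H_bd[of 0] norm_ge_zero order_trans by blast

definition D where "D = real CARD('d)"
definition vmax where "vmax = M + D * B * M"
definition vlip where "vlip = \<Lambda> + D * B * \<Lambda>"

lemma consts_nonneg: "0 \<le> D" "0 \<le> vmax" "0 \<le> vlip"
  using \<Lambda>_nonneg M_nonneg B_nonneg by (auto simp: D_def vmax_def vlip_def)

text \<open>
  The velocity is split because this part is linear in the control, which permits averaging in time,
  while the convolution with \<open>\<mu>\<close> is continuous in time.
\<close>

definition ctrl :: "(real^'d)^'m \<Rightarrow> (real^'d)^'m \<Rightarrow> real^'d \<Rightarrow> real^'d" where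
  "ctrl u Y x = (\<Sum>l\<in>UNIV. \<Sum>k\<in>UNIV. (u $ k $ l / real CARD('m)) *\<^sub>R G l (x - Y $ k))"

lemma velocity_eq: "velocity H G u Y \<mu> x = convolve H \<mu> x + ctrl u Y x"
  by (simp add: velocity_def ctrl_def convolve_atomic_def)

lemma ctrl_sum_bound:
  fixes F :: "'d \<Rightarrow> 'm::finite \<Rightarrow> real^'d"
  assumes "\<And>l k. norm (F l k) \<le> c / real CARD('m)"
  shows "norm (\<Sum>l\<in>UNIV. \<Sum>k\<in>UNIV. F l k) \<le> D * c"
proof -
  have "norm (\<Sum>l\<in>UNIV. \<Sum>k\<in>UNIV. F l k) \<le> (\<Sum>l\<in>(UNIV::'d set). \<Sum>k\<in>(UNIV::'m set). c / real CARD('m))"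
    by (intro sum_norm_le assms)
  also have "\<dots> = D * c" by (simp add: D_def)
  finally show ?thesis .
qed

lemma component_le: "\<bar>u $ k $ l\<bar> \<le> norm (u :: (real^'d)^'m)"
  using component_le_norm_cart[of "u $ k" l] Finite_Cartesian_Product.norm_nth_le[of u k] by simp

lemma ctrl_bound:
  fixes u :: "(real^'d)^'m"
  assumes "norm u \<le> b" "0 \<le> b" shows "norm (ctrl u Y x) \<le> D * (b * M)"
  unfolding ctrl_def
proof (rule ctrl_sum_bound)
  fix l k
  have "\<bar>u $ k $ l\<bar> * norm (G l (x - Y $ k)) \<le> b * M"
    using component_le[of u k l] assms G_bd M_nonneg by (intro mult_mono) auto
  then show "norm ((u $ k $ l / real CARD('m)) *\<^sub>R G l (x - Y $ k)) \<le> b * M / real CARD('m)"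
    by (simp add: divide_right_mono)
qed

lemma ctrl_diff:
  fixes u :: "(real^'d)^'m"
  assumes "norm u \<le> B"
  shows "norm (ctrl u Y x - ctrl u Y' x') \<le> D * (B * (\<Lambda> * (norm (x - x') + norm (Y - Y'))))"
  unfolding ctrl_def sum_subtractf[symmetric]
proof (rule ctrl_sum_bound)
  fix l k
  have "norm (G l (x - Y $ k) - G l (x' - Y' $ k)) \<le> \<Lambda> * norm ((x - Y $ k) - (x' - Y' $ k))"
    using lipschitz_onD[OF G_lip] by (simp add: dist_norm)
  also have "\<dots> \<le> \<Lambda> * (norm (x - x') + norm (Y - Y'))"
  proof (rule mult_left_mono[OF _ \<Lambda>_nonneg])
    have "norm ((x - Y $ k) - (x' - Y' $ k)) = norm ((x - x') - (Y - Y') $ k)" by (simp add: algebra_simps)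
    also have "\<dots> \<le> norm (x - x') + norm ((Y - Y') $ k)" by (rule norm_triangle_ineq4)
    also have "\<dots> \<le> norm (x - x') + norm (Y - Y')" by (intro add_left_mono Finite_Cartesian_Product.norm_nth_le)
    finally show "norm ((x - Y $ k) - (x' - Y' $ k)) \<le> norm (x - x') + norm (Y - Y')" .
  qed
  finally have "\<bar>u $ k $ l\<bar> * norm (G l (x - Y $ k) - G l (x' - Y' $ k)) \<le> B * (\<Lambda> * (norm (x - x') + norm (Y - Y')))"
    using component_le[of u k l] assms B_nonneg by (intro mult_mono) auto
  then show "norm ((u $ k $ l / real CARD('m)) *\<^sub>R G l (x - Y $ k) - (u $ k $ l / real CARD('m)) *\<^sub>R G l (x' - Y' $ k))
      \<le> B * (\<Lambda> * (norm (x - x') + norm (Y - Y'))) / real CARD('m)"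
    unfolding scaleR_right_diff_distrib[symmetric] by (simp add: divide_right_mono)
qed

lemma ctrl_linear: "linear (\<lambda>u. ctrl u Y x)"
  by (rule linearI)
    (simp_all add: ctrl_def scaleR_sum_right sum.distrib[symmetric] add_divide_distrib scaleR_left_distrib)

lemma ctrl_diff_left: "ctrl u Y x - ctrl u' Y x = ctrl (u - u') Y x"
  using linear_diff[OF ctrl_linear[of Y x], of u u'] by simp

lemma H_shift_lip: "\<Lambda>-lipschitz_on UNIV (\<lambda>\<xi>. H (x - \<xi>))"
proof (rule lipschitz_onI[OF _ \<Lambda>_nonneg])
  fix y z show "dist (H (x - y)) (H (x - z)) \<le> \<Lambda> * dist y z"
    using lipschitz_onD[OF H_lip, of "x - y" "x - z"] by (simp add: dist_norm norm_minus_commute)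
qed

lemma convolve_bound:
  assumes "\<mu> \<in> P1" shows "norm (convolve H \<mu> x) \<le> M"
proof -
  interpret prob_space \<mu> using P1_D(1)[OF assms] .
  note i = P1_lipschitz_integrable[OF assms H_shift_lip, of x]
  have "norm (convolve H \<mu> x) \<le> (\<integral>\<xi>. norm (H (x - \<xi>)) \<partial>\<mu>)"
    unfolding convolve_def by (rule integral_norm_bound)
  also have "\<dots> \<le> (\<integral>\<xi>. M \<partial>\<mu>)" using i H_bd by (intro integral_mono) auto
  finally show ?thesis by (simp add: prob_space)
qed

lemma convolve_lip:
  assumes "\<mu> \<in> P1" shows "norm (convolve H \<mu> x - convolve H \<mu> y) \<le> \<Lambda> * norm (x - y)"
proof -
  interpret prob_space \<mu> using P1_D(1)[OF assms] .
  show ?thesis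
    unfolding convolve_def
  proof (rule norm_integral_diff_le[OF P1_lipschitz_integrable[OF assms H_shift_lip] P1_lipschitz_integrable[OF assms H_shift_lip]])
    have "norm (H (x - \<xi>) - H (y - \<xi>)) \<le> \<Lambda> * norm (x - y)" for \<xi>
      using lipschitz_onD[OF H_lip, of "x - \<xi>" "y - \<xi>"] by (simp add: dist_norm)
    then show "AE \<xi> in \<mu>. norm (H (x - \<xi>) - H (y - \<xi>)) \<le> \<Lambda> * norm (x - y)" by simp
  qed
qed

lemma velocity_bound:
  fixes u :: "(real^'d)^'m"
  assumes "\<mu> \<in> P1" "norm u \<le> B" shows "norm (velocity H G u Y \<mu> x) \<le> vmax"
proof -
  have "norm (velocity H G u Y \<mu> x) \<le> norm (convolve H \<mu> x) + norm (ctrl u Y x)"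
    unfolding velocity_eq by (rule norm_triangle_ineq)
  also have "\<dots> \<le> M + D * (B * M)"
    using convolve_bound[OF assms(1)] ctrl_bound[OF assms(2) B_nonneg] by (rule add_mono)
  finally show ?thesis by (simp add: vmax_def mult.assoc)
qed

lemma velocity_lip:
  fixes u :: "(real^'d)^'m"
  assumes "\<mu> \<in> P1" "norm u \<le> B" shows "vlip-lipschitz_on UNIV (velocity H G u Y \<mu>)"
proof (rule lipschitz_onI[OF _ consts_nonneg(3)])
  fix x y
  have "velocity H G u Y \<mu> x - velocity H G u Y \<mu> y
      = (convolve H \<mu> x - convolve H \<mu> y) + (ctrl u Y x - ctrl u Y y)" by (simp add: velocity_eq)
  then have "dist (velocity H G u Y \<mu> x) (velocity H G u Y \<mu> y)
      \<le> norm (convolve H \<mu> x - convolve H \<mu> y) + norm (ctrl u Y x - ctrl u Y y)"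
    by (simp only: dist_norm norm_triangle_ineq)
  also have "\<dots> \<le> \<Lambda> * norm (x - y) + D * (B * (\<Lambda> * (norm (x - y) + norm (Y - Y))))"
    using convolve_lip[OF assms(1)] ctrl_diff[OF assms(2)] by (intro add_mono) blast+
  finally show "dist (velocity H G u Y \<mu> x) (velocity H G u Y \<mu> y) \<le> vlip * dist x y"
    by (simp add: vlip_def dist_norm algebra_simps)
qed

lemma velocity_diff:
  fixes u u' :: "(real^'d)^'m"
  assumes "\<mu> \<in> P1" "\<mu>' \<in> P1" "norm u \<le> B"
  shows "norm (velocity H G u Y \<mu> x - velocity H G u' Y' \<mu>' x)
    \<le> \<Lambda> * lipdist \<mu> \<mu>' + D * (M * norm (u - u') + B * \<Lambda> * norm (Y - Y'))"
proof -
  have "velocity H G u Y \<mu> x - velocity H G u' Y' \<mu>' x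
    = (convolve H \<mu> x - convolve H \<mu>' x) + ((ctrl u Y x - ctrl u Y' x) + ctrl (u - u') Y' x)"
    by (simp add: velocity_eq ctrl_diff_left[symmetric])
  then have "norm (velocity H G u Y \<mu> x - velocity H G u' Y' \<mu>' x)
    \<le> norm (convolve H \<mu> x - convolve H \<mu>' x) + norm ((ctrl u Y x - ctrl u Y' x) + ctrl (u - u') Y' x)"
    by (simp only: norm_triangle_ineq)
  also have "\<dots> \<le> norm (convolve H \<mu> x - convolve H \<mu>' x) + (norm (ctrl u Y x - ctrl u Y' x) + norm (ctrl (u - u') Y' x))"
    by (intro add_left_mono norm_triangle_ineq)
  also have "\<dots> \<le> \<Lambda> * lipdist \<mu> \<mu>' + (D * (B * (\<Lambda> * (norm (x - x) + norm (Y - Y')))) + D * (norm (u - u') * M))"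
  proof (intro add_mono)
    show "norm (convolve H \<mu> x - convolve H \<mu>' x) \<le> \<Lambda> * lipdist \<mu> \<mu>'"
      unfolding convolve_def by (rule lipdist_upper_norm[OF assms(1,2) H_shift_lip])
    show "norm (ctrl u Y x - ctrl u Y' x) \<le> D * (B * (\<Lambda> * (norm (x - x) + norm (Y - Y'))))"
      by (rule ctrl_diff[OF assms(3)])
    show "norm (ctrl (u - u') Y' x) \<le> D * (norm (u - u') * M)" by (rule ctrl_bound) auto
  qed
  finally show ?thesis by (simp add: algebra_simps)
qed

end

section \<open>Elementary estimates\<close>

lemma inner_lipschitz:
  fixes f g :: "'a::metric_space \<Rightarrow> 'b::real_inner"
  assumes f: "K-lipschitz_on UNIV f" "\<And>x. norm (f x) \<le> a" and g: "L-lipschitz_on UNIV g" "\<And>x. norm (g x) \<le> b"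
  shows "(K * b + a * L)-lipschitz_on UNIV (\<lambda>x. f x \<bullet> g x)"
proof (rule lipschitz_onI)
  note K = lipschitz_on_nonneg[OF f(1)] and L = lipschitz_on_nonneg[OF g(1)]
  have ab: "0 \<le> a" "0 \<le> b" using f(2) g(2) norm_ge_zero order_trans by blast+
  then show "0 \<le> K * b + a * L" using K L by simp
  fix x y
  have "f x \<bullet> g x - f y \<bullet> g y = (f x - f y) \<bullet> g x + f y \<bullet> (g x - g y)" by (simp add: inner_diff)
  then have "dist (f x \<bullet> g x) (f y \<bullet> g y) \<le> \<bar>(f x - f y) \<bullet> g x\<bar> + \<bar>f y \<bullet> (g x - g y)\<bar>"
    by (simp only: dist_real_def abs_triangle_ineq)
  also have "\<dots> \<le> norm (f x - f y) * norm (g x) + norm (f y) * norm (g x - g y)"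
    by (intro add_mono Cauchy_Schwarz_ineq2)
  also have "\<dots> \<le> (K * dist x y) * b + a * (L * dist x y)"
    using lipschitz_onD[OF f(1)] lipschitz_onD[OF g(1)] f(2) g(2) K L ab
    by (intro add_mono mult_mono) (auto simp: dist_norm[symmetric])
  finally show "dist (f x \<bullet> g x) (f y \<bullet> g y) \<le> (K * b + a * L) * dist x y" by (simp add: algebra_simps)
qed

text \<open>
  Compare the increment along the gradient with its first-order expansion, whose error is quadratic.
\<close>

lemma norm_gradient_le:
  fixes \<phi> :: "real^'d \<Rightarrow> real"
  assumes \<phi>: "\<phi> \<in> test_functions" and lip: "L-lipschitz_on UNIV \<phi>"
  shows "norm (gradient \<phi> x) \<le> L"
proof -
  define g where "g = gradient \<phi> x"
  obtain K where K: "K-lipschitz_on UNIV (gradient \<phi>)" using test_gradient_lipschitz[OF \<phi>] by metis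
  show ?thesis
  proof (cases "g = 0")
    case True then show ?thesis using lipschitz_on_nonneg[OF lip] by (simp add: g_def)
  next
    case False
    then have n: "0 < norm g" by simp
    have K0: "0 \<le> K" using lipschitz_on_nonneg[OF K] .
    have "norm g \<le> L + e" if e: "0 < e" for e
    proof -
      define t where "t = e / (K * norm g + 1)"
      have t: "0 < t" using e n K0 by (simp add: t_def add_nonneg_pos)
      have "\<bar>\<phi> (x + t *\<^sub>R g) - \<phi> x - g \<bullet> (t *\<^sub>R g)\<bar> \<le> K * (norm (t *\<^sub>R g))\<^sup>2"
        unfolding g_def by (rule gradient_taylor[OF test_functionsD(5)[OF \<phi>] K])
      moreover have "\<bar>\<phi> (x + t *\<^sub>R g) - \<phi> x\<bar> \<le> L * (t * norm g)"
        using lipschitz_onD[OF lip, of "x + t *\<^sub>R g" x] t by (simp add: dist_norm)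
      moreover have "g \<bullet> (t *\<^sub>R g) = t * norm g * norm g"
        by (simp add: dot_square_norm power2_eq_square)
      ultimately have "t * norm g * norm g \<le> L * (t * norm g) + K * (norm (t *\<^sub>R g))\<^sup>2" by linarith
      also have "\<dots> = (t * norm g) * (L + K * norm g * t)"
        using t by (simp add: power2_eq_square algebra_simps)
      finally have "(t * norm g) * norm g \<le> (t * norm g) * (L + K * norm g * t)" by simp
      then have "norm g \<le> L + K * norm g * t" using t n by simp
      also have "K * norm g * t \<le> e"
      proof -
        have "(K * norm g + 1) * t = e" using n K0 by (simp add: t_def add_nonneg_eq_0_iff)
        then show ?thesis using t by (simp add: distrib_right)
      qed
      finally show ?thesis by simp
    qed
    then show ?thesis unfolding g_def by (rule field_le_epsilon)
  qed
qed

text \<open>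
  Only one-sided difference quotients are controlled, at each time on its own scale.  The comparison
  function \<open>exp (c t) (f 0 + b t)\<close> grows over every step at least as fast as the hypothesis
  allows \<open>f\<close> to grow, so the last time at which \<open>f\<close> lies below it cannot be before \<open>t\<close>.
\<close>

lemma dini_gronwall:
  fixes f :: "real \<Rightarrow> real"
  assumes cont: "continuous_on {0..T} f" and c: "0 \<le> c" "0 \<le> b"
    and step: "\<And>s. 0 \<le> s \<Longrightarrow> s < T \<Longrightarrow> \<exists>d0>0. \<forall>d. 0 < d \<and> d < d0 \<and> s + d \<le> T \<longrightarrow> f (s + d) \<le> f s + d * (c * f s + b)"
    and f0: "0 \<le> f 0" and t: "0 \<le> t" "t \<le> T"
  shows "f t \<le> exp (c * t) * (f 0 + b * t)"
proof -
  define g where "g = (\<lambda>t. exp (c * t) * (f 0 + b * t))"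
  have gstep: "g s + d * (c * g s + b) \<le> g (s + d)" if "0 \<le> s" "0 < d" for s d
  proof -
    have "exp (c * s) * (1 + c * d) \<le> exp (c * s) * exp (c * d)"
      by (intro mult_left_mono exp_ge_add_one_self) simp
    then have e: "exp (c * s) * (1 + c * d) \<le> exp (c * (s + d))"
      by (simp add: exp_add distrib_left[of c])
    have e1: "1 \<le> exp (c * (s + d))" using c that by simp
    have "g s + d * (c * g s + b) = (exp (c * s) * (1 + c * d)) * (f 0 + b * s) + 1 * (b * d)"
      by (simp add: g_def algebra_simps)
    also have "\<dots> \<le> exp (c * (s + d)) * (f 0 + b * s) + exp (c * (s + d)) * (b * d)"
      using e e1 f0 c that by (intro add_mono mult_right_mono) auto
    also have "\<dots> = g (s + d)" by (simp add: g_def algebra_simps)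
    finally show ?thesis .
  qed
  have cont': "continuous_on {0..T} (\<lambda>t. f t - g t)"
    unfolding g_def using cont by (intro continuous_intros)
  have "f t \<le> g t"
  proof (rule ccontr)
    assume neg: "\<not> f t \<le> g t"
    define S where "S = {s \<in> {0..t}. f s - g s \<le> 0}"
    have S0: "0 \<in> S" using t by (simp add: S_def g_def)
    have clS: "closed S"
      unfolding S_def using continuous_closed_preimage[OF continuous_on_subset[OF cont'], of "{0..t}" "{..0}"] t
      by (simp add: vimage_def Int_def)
    have bS: "bounded S" by (rule bounded_subset[OF bounded_closed_interval[of 0 t]]) (auto simp: S_def)
    define s where "s = Sup S"
    have sS: "s \<in> S" unfolding s_def
      using closed_contains_Sup[OF _ bounded_imp_bdd_above[OF bS] clS] S0 by auto
    have up: "r \<le> s" if "r \<in> S" for r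
      unfolding s_def using that bounded_imp_bdd_above[OF bS] by (rule cSup_upper)
    have s: "0 \<le> s" "s \<le> t" "f s \<le> g s" using sS by (auto simp: S_def)
    have "s \<noteq> t" using neg s by auto
    then have st: "s < t" using s by simp
    then obtain d0 where d0: "0 < d0" "\<forall>d. 0 < d \<and> d < d0 \<and> s + d \<le> T \<longrightarrow> f (s + d) \<le> f s + d * (c * f s + b)"
      using step[of s] s t by auto
    define d where "d = min (d0 / 2) (t - s)"
    have d: "0 < d" "d < d0" "s + d \<le> t" using d0 st by (auto simp: d_def)
    have "f (s + d) \<le> f s + d * (c * f s + b)" using d0(2) d t by auto
    also have "\<dots> \<le> g s + d * (c * g s + b)"
      using s c d by (intro add_mono mult_left_mono) auto
    also have "\<dots> \<le> g (s + d)" using gstep s d by simp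
    finally have "s + d \<in> S" using d s by (simp add: S_def)
    then show False using up d by force
  qed
  then show ?thesis by (simp add: g_def)
qed

section \<open>Stability of weak solutions\<close>

text \<open>
  The distance \<open>lipdist\<close> of the measures after convolution with the reflected mollifier, written with
  the mollifier on the side of the test functions.
\<close>

definition moll_dist :: "(real^'d \<Rightarrow> real) \<Rightarrow> (real^'d) measure \<Rightarrow> (real^'d) measure \<Rightarrow> real" where
  "moll_dist \<rho> \<mu> \<nu> =
     (SUP \<phi>\<in>{\<phi>. 1-lipschitz_on UNIV \<phi>}. (\<integral>x. mollify \<rho> \<phi> x \<partial>\<mu>) - (\<integral>x. mollify \<rho> \<phi> x \<partial>\<nu>))"

locale mollifier =
  fixes \<rho> :: "real^'d \<Rightarrow> real" and \<epsilon> :: real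
  assumes rho: "\<rho> \<in> test_functions" "\<And>x. 0 \<le> \<rho> x" "\<And>x. \<epsilon> < norm x \<Longrightarrow> \<rho> x = 0" "(\<integral>x. \<rho> x \<partial>lborel) = 1"
begin

lemma rho_abs: "(\<integral>z. \<bar>\<rho> z\<bar> \<partial>lborel) = 1" using rho by simp

lemma mollify_lip: "C-lipschitz_on UNIV \<phi> \<Longrightarrow> C-lipschitz_on UNIV (mollify \<rho> \<phi>)"
  using mollify_lipschitz[OF rho(1), of C \<phi>] by (simp add: rho_abs)

lemma moll_dist_upper1:
  assumes "\<mu> \<in> P1" "\<nu> \<in> P1" "1-lipschitz_on UNIV \<phi>"
  shows "(\<integral>x. mollify \<rho> \<phi> x \<partial>\<mu>) - (\<integral>x. mollify \<rho> \<phi> x \<partial>\<nu>) \<le> moll_dist \<rho> \<mu> \<nu>"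
  unfolding moll_dist_def
proof (rule cSUP_upper[where x=\<phi> and f="\<lambda>\<phi>. (\<integral>x. mollify \<rho> \<phi> x \<partial>\<mu>) - (\<integral>x. mollify \<rho> \<phi> x \<partial>\<nu>)"])
  show "\<phi> \<in> {\<phi>. 1-lipschitz_on UNIV \<phi>}" using assms by simp
  show "bdd_above ((\<lambda>\<phi>. (\<integral>x. mollify \<rho> \<phi> x \<partial>\<mu>) - (\<integral>x. mollify \<rho> \<phi> x \<partial>\<nu>)) ` {\<phi>. 1-lipschitz_on UNIV \<phi>})"
    using lipdist_upper1[OF assms(1,2) mollify_lip] by (intro bdd_aboveI2[where M="lipdist \<mu> \<nu>"]) auto
qed

lemma moll_dist_least:
  assumes "\<And>\<phi>. 1-lipschitz_on UNIV \<phi> \<Longrightarrow> (\<integral>x. mollify \<rho> \<phi> x \<partial>\<mu>) - (\<integral>x. mollify \<rho> \<phi> x \<partial>\<nu>) \<le> c"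
  shows "moll_dist \<rho> \<mu> \<nu> \<le> c"
  unfolding moll_dist_def
  by (rule cSUP_least) (use assms in \<open>auto intro!: exI[of _ "\<lambda>_. 0"] lipschitz_on_mono[OF lipschitz_on_constant]\<close>)

lemma moll_dist_le_lipdist: "\<mu> \<in> P1 \<Longrightarrow> \<nu> \<in> P1 \<Longrightarrow> moll_dist \<rho> \<mu> \<nu> \<le> lipdist \<mu> \<nu>"
  by (intro moll_dist_least lipdist_upper1 mollify_lip)

lemma moll_dist_nonneg:
  assumes "\<mu> \<in> P1" "\<nu> \<in> P1" shows "0 \<le> moll_dist \<rho> \<mu> \<nu>"
proof -
  have "1-lipschitz_on UNIV (\<lambda>_::real^'d. 0::real)" by (intro lipschitz_onI) auto
  from moll_dist_upper1[OF assms this] show ?thesis by (simp add: mollify_def)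
qed

lemma moll_dist_upper:
  assumes "\<mu> \<in> P1" "\<nu> \<in> P1" "C-lipschitz_on UNIV \<phi>" "0 < C"
  shows "(\<integral>x. mollify \<rho> \<phi> x \<partial>\<mu>) - (\<integral>x. mollify \<rho> \<phi> x \<partial>\<nu>) \<le> C * moll_dist \<rho> \<mu> \<nu>"
proof -
  have l: "1-lipschitz_on UNIV (\<lambda>x. (1 / C) * \<phi> x)"
    using lipschitz_on_cmult_real[OF assms(3), of "1 / C"] assms(4) by simp
  have "mollify \<rho> \<phi> x = C * mollify \<rho> (\<lambda>x. (1 / C) * \<phi> x) x" for x
  proof -
    have "\<rho> z * ((1 / C) * \<phi> (x - z)) = (1 / C) * (\<rho> z * \<phi> (x - z))" for z by simp
    then show ?thesis using assms(4) unfolding mollify_def by (simp only: integral_mult_right_zero) simp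
  qed
  then have "(\<integral>x. mollify \<rho> \<phi> x \<partial>\<kappa>) = C * (\<integral>x. mollify \<rho> (\<lambda>x. (1 / C) * \<phi> x) x \<partial>\<kappa>)" for \<kappa>
    by (simp only: integral_mult_right_zero)
  then show ?thesis
    using mult_left_mono[OF moll_dist_upper1[OF assms(1,2) l], of C] assms(4) by (simp only: right_diff_distrib)
qed

lemma lipdist_le_moll_dist:
  assumes "\<mu> \<in> P1" "\<nu> \<in> P1" shows "lipdist \<mu> \<nu> \<le> moll_dist \<rho> \<mu> \<nu> + 2 * \<epsilon>"
proof (rule lipdist_least)
  fix \<phi> :: "real^'d \<Rightarrow> real" assume l: "1-lipschitz_on UNIV \<phi>"
  have c: "\<bar>(\<integral>x. mollify \<rho> \<phi> x \<partial>\<mu>) - (\<integral>x. \<phi> x \<partial>\<mu>)\<bar> \<le> \<epsilon>" if "\<mu> \<in> P1" for \<mu>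
  proof -
    interpret prob_space \<mu> using P1_D(1)[OF that] .
    show ?thesis
      using norm_integral_diff_le[OF P1_lipschitz_integrable[OF that mollify_lip[OF l]] P1_lipschitz_integrable[OF that l], of \<epsilon>]
        mollify_close[OF rho l] by simp
  qed
  show "(\<integral>x. \<phi> x \<partial>\<mu>) - (\<integral>x. \<phi> x \<partial>\<nu>) \<le> moll_dist \<rho> \<mu> \<nu> + 2 * \<epsilon>"
    using c[OF assms(1)] c[OF assms(2)] moll_dist_upper1[OF assms l] by linarith
qed

lemma moll_dist_triangle:
  assumes "\<mu> \<in> P1" "\<nu> \<in> P1" "\<mu>' \<in> P1" "\<nu>' \<in> P1"
  shows "moll_dist \<rho> \<mu> \<nu> \<le> moll_dist \<rho> \<mu>' \<nu>' + lipdist \<mu> \<mu>' + lipdist \<nu> \<nu>'"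
proof (rule moll_dist_least)
  fix \<phi> :: "real^'d \<Rightarrow> real" assume l: "1-lipschitz_on UNIV \<phi>"
  show "(\<integral>x. mollify \<rho> \<phi> x \<partial>\<mu>) - (\<integral>x. mollify \<rho> \<phi> x \<partial>\<nu>) \<le> moll_dist \<rho> \<mu>' \<nu>' + lipdist \<mu> \<mu>' + lipdist \<nu> \<nu>'"
    using lipdist_upper_abs[OF assms(1,3) mollify_lip[OF l]] lipdist_upper_abs[OF assms(2,4) mollify_lip[OF l]]
      moll_dist_upper1[OF assms(3,4) l] by linarith
qed

end

text \<open>
  The Euler step needs velocity bounds at every time, so the bound on the control is not relaxed to
  almost every time; the common ball is where test functions may be cut off.
\<close>

definition weak_solution ::
  "real \<Rightarrow> (real^'d \<Rightarrow> real^'d) \<Rightarrow> ('d \<Rightarrow> real^'d \<Rightarrow> real^'d) \<Rightarrow> real \<Rightarrow> real \<Rightarrow>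
   (real \<Rightarrow> (real^'d)^'m) \<Rightarrow> (real \<Rightarrow> (real^'d)^'m) \<Rightarrow> (real \<Rightarrow> (real^'d) measure) \<Rightarrow> bool" where
  "weak_solution T H G B R u Y \<mu> \<longleftrightarrow>
     (\<forall>t. norm (u t) \<le> B) \<and>
     (\<forall>t\<in>{0..T}. \<mu> t \<in> P1 \<and> (AE x in \<mu> t. norm x \<le> R)) \<and>
     (\<forall>t\<in>{0..T}. ((\<lambda>s. lipdist (\<mu> s) (\<mu> t)) \<longlongrightarrow> 0) (at t within {0..T})) \<and>
     caratheodory T Y u \<and>
     (\<forall>\<phi>\<in>test_functions. caratheodory T (\<lambda>t. \<integral>x. \<phi> x \<partial>\<mu> t)
        (\<lambda>t. \<integral>x. gradient \<phi> x \<bullet> velocity H G (u t) (Y t) (\<mu> t) x \<partial>\<mu> t))"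

context lipschitz_field begin

text \<open>
  For a frozen state the integral against \<open>\<mu>\<close> is an affine function of the control, so integrating in
  time only averages the control.
\<close>

lemma averaged_velocity_has_integral:
  fixes u :: "real \<Rightarrow> (real^'d)^'m"
  assumes \<mu>: "\<mu> \<in> P1" and F: "K-lipschitz_on UNIV F" "\<And>x. norm (F x) \<le> a"
    and u: "\<And>t. norm (u t) \<le> B" and I: "(u has_integral d *\<^sub>R ub) {s..s + d}" and ub: "norm ub \<le> B" and d: "0 < d"
  shows "((\<lambda>r. \<integral>x. F x \<bullet> velocity H G (u r) Y \<mu> x \<partial>\<mu>) has_integral
           d * (\<integral>x. F x \<bullet> velocity H G ub Y \<mu> x \<partial>\<mu>)) {s..s + d}"
proof -
  interpret prob_space \<mu> using P1_D(1)[OF \<mu>] .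
  have Fm: "F \<in> borel_measurable \<mu>" by (rule P1_measurable[OF \<mu> lipschitz_measurable[OF F(1)]])
  have cont: "continuous_on UNIV (ctrl w Y)" for w :: "(real^'d)^'m"
  proof -
    have "continuous_on UNIV (\<lambda>x. G l (x - y))" for l y
      by (rule continuous_on_compose2[OF lipschitz_on_continuous_on[OF G_lip]]) (auto intro!: continuous_intros)
    then show ?thesis unfolding ctrl_def by (intro continuous_intros)
  qed
  have a: "0 \<le> a" using F(2) norm_ge_zero order_trans by blast
  have ic: "integrable \<mu> (\<lambda>x. F x \<bullet> ctrl w Y x)" for w :: "(real^'d)^'m"
  proof (rule integrable_const_bound[of _ "a * (D * (norm w * M))"])
    show "(\<lambda>x. F x \<bullet> ctrl w Y x) \<in> borel_measurable \<mu>"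
      using Fm P1_measurable[OF \<mu> borel_measurable_continuous_onI[OF cont, of w]] by measurable
    have "\<bar>F x \<bullet> ctrl w Y x\<bar> \<le> a * (D * (norm w * M))" for x
      using order_trans[OF Cauchy_Schwarz_ineq2 mult_mono[OF F(2) ctrl_bound[OF order_refl norm_ge_zero] a norm_ge_zero]] .
    then show "AE x in \<mu>. norm (F x \<bullet> ctrl w Y x) \<le> a * (D * (norm w * M))" by simp
  qed
  have il: "integrable \<mu> (\<lambda>x. F x \<bullet> convolve H \<mu> x)"
  proof -
    have "\<Lambda>-lipschitz_on UNIV (convolve H \<mu>)"
      using convolve_lip[OF \<mu>] \<Lambda>_nonneg by (intro lipschitz_onI) (auto simp: dist_norm)
    from P1_lipschitz_integrable[OF \<mu> inner_lipschitz[OF F this convolve_bound[OF \<mu>]]] show ?thesis .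
  qed
  define c where "c = (\<integral>x. F x \<bullet> convolve H \<mu> x \<partial>\<mu>)"
  define lin where "lin = (\<lambda>w::(real^'d)^'m. \<integral>x. F x \<bullet> ctrl w Y x \<partial>\<mu>)"
  have eq: "(\<integral>x. F x \<bullet> velocity H G w Y \<mu> x \<partial>\<mu>) = c + lin w" for w
    unfolding velocity_eq inner_add_right c_def lin_def using il ic by simp
  have "linear lin"
    by (rule linearI) (simp_all add: lin_def linear_add[OF ctrl_linear] linear_scale[OF ctrl_linear] inner_add_right ic)
  then have "(lin \<circ> u has_integral lin (d *\<^sub>R ub)) {s..s + d}"
    using I by (intro has_integral_linear linear_conv_bounded_linear[THEN iffD1])
  then have "(lin \<circ> u has_integral d * lin ub) {s..s + d}"
    using linear_scale[OF \<open>linear lin\<close>, of d ub] by simp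
  moreover have "((\<lambda>_. c) has_integral d * c) {s..s + d}"
    using has_integral_const_real[of c s "s + d"] d by simp
  ultimately have "((\<lambda>r. c + (lin \<circ> u) r) has_integral (d * c + d * lin ub)) {s..s + d}"
    by (intro has_integral_add)
  then show ?thesis unfolding eq by (simp add: distrib_left)
qed

text \<open>
  The quotient \<open>(Y (s + d) - Y s) / d\<close> is the mean of the control over \<open>[s, s + d]\<close>.
\<close>

definition euler_defect ::
  "(real \<Rightarrow> (real^'d)^'m) \<Rightarrow> (real \<Rightarrow> (real^'d) measure) \<Rightarrow> real \<Rightarrow> real \<Rightarrow> (real^'d \<Rightarrow> real) \<Rightarrow> real" where
  "euler_defect Y \<mu> s d \<psi> = \<bar>(\<integral>x. \<psi> x \<partial>\<mu> (s + d))
     - (\<integral>x. \<psi> (x + d *\<^sub>R velocity H G ((Y (s + d) - Y s) /\<^sub>R d) (Y s) (\<mu> s) x) \<partial>\<mu> s)\<bar>"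

text \<open>
  In the weak form the state at time \<open>r \<in> [s, s + d]\<close> may be replaced by the state at time \<open>s\<close> at
  the price of an error \<open>w r\<close> that tends to 0 as \<open>r \<rightarrow> s\<close>; the time integral then only averages the
  control.  The resulting first-order term is the increment of \<open>\<psi>\<close> along the Euler
  step up to a Taylor error of order \<open>d\<^sup>2\<close>.  Since \<open>\<psi>\<close> enters through its Lipschitz constants alone, \<open>d0\<close> is the
  same for all \<open>\<psi>\<close>.
\<close>

lemma euler_step:
  fixes u :: "real \<Rightarrow> (real^'d)^'m"
  assumes sol: "weak_solution T H G B R u Y \<mu>" and s: "0 \<le> s" "s < T" and \<eta>: "0 < \<eta>"
  shows "\<exists>d0>0. \<forall>d \<psi>. 0 < d \<longrightarrow> d < d0 \<longrightarrow> s + d \<le> T \<longrightarrow> \<psi> \<in> test_functions \<longrightarrow> 1-lipschitz_on UNIV \<psi> \<longrightarrow>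
       K-lipschitz_on UNIV (gradient \<psi>) \<longrightarrow> euler_defect Y \<mu> s d \<psi> \<le> d * \<eta>"
proof -
  have u: "\<And>t. norm (u t) \<le> B" and P: "\<And>t. t \<in> {0..T} \<Longrightarrow> \<mu> t \<in> P1"
    and lim: "((\<lambda>r. lipdist (\<mu> r) (\<mu> s)) \<longlongrightarrow> 0) (at s within {0..T})"
    and Y: "caratheodory T Y u"
    and test: "\<And>\<phi>. \<phi> \<in> test_functions \<Longrightarrow> caratheodory T (\<lambda>t. \<integral>x. \<phi> x \<partial>\<mu> t)
        (\<lambda>t. \<integral>x. gradient \<phi> x \<bullet> velocity H G (u t) (Y t) (\<mu> t) x \<partial>\<mu> t)"
    using sol s unfolding weak_solution_def by auto
  have Ps: "\<mu> s \<in> P1" using P s by auto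
  interpret S: prob_space "\<mu> s" using P1_D(1)[OF Ps] .
  define w where "w = (\<lambda>r. (\<Lambda> + \<bar>K\<bar> * vmax + vlip) * lipdist (\<mu> r) (\<mu> s) + D * (B * \<Lambda> * norm (Y r - Y s)))"
  have "(Y \<longlongrightarrow> Y s) (at s within {0..T})"
    using caratheodory_continuous[OF Y] s by (auto simp: continuous_on_def)
  then have "(w \<longlongrightarrow> (\<Lambda> + \<bar>K\<bar> * vmax + vlip) * 0 + D * (B * \<Lambda> * norm (Y s - Y s))) (at s within {0..T})"
    unfolding w_def using lim by (intro tendsto_intros)
  then have "\<forall>\<^sub>F r in at s within {0..T}. w r < \<eta> / 2"
    using \<eta> by (intro order_tendstoD(2)[of _ 0]) auto
  then obtain d1 where d1: "0 < d1" "\<And>r. r \<in> {0..T} \<Longrightarrow> r \<noteq> s \<Longrightarrow> dist r s < d1 \<Longrightarrow> w r < \<eta> / 2"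
    unfolding eventually_at by auto
  have ws: "w s < \<eta> / 2"
  proof -
    have "lipdist (\<mu> s) (\<mu> s) \<le> 0" by (rule lipdist_least) simp
    then have "lipdist (\<mu> s) (\<mu> s) = 0" using lipdist_nonneg[OF Ps Ps] by simp
    then show ?thesis using \<eta> by (simp add: w_def)
  qed
  define d0 where "d0 = min d1 (\<eta> / (2 * (\<bar>K\<bar> * vmax\<^sup>2 + 1)))"
  have KV: "0 < 2 * (\<bar>K\<bar> * vmax\<^sup>2 + 1)" by (simp add: add_nonneg_pos)
  show ?thesis
  proof (intro exI[of _ d0] conjI allI impI)
    show "0 < d0" using d1 \<eta> KV by (simp add: d0_def)
    fix d and \<psi> :: "real^'d \<Rightarrow> real"
    assume d: "0 < d" "d < d0" "s + d \<le> T" and \<psi>: "\<psi> \<in> test_functions" "1-lipschitz_on UNIV \<psi>"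
      and K: "K-lipschitz_on UNIV (gradient \<psi>)"
    have K0: "0 \<le> K" using lipschitz_on_nonneg[OF K] .
    define ub where "ub = (Y (s + d) - Y s) /\<^sub>R d"
    have ub: "norm ub \<le> B"
      unfolding ub_def using caratheodory_lipschitz[OF Y u, of s "s + d"] s d by (intro norm_average_le) auto
    have uI: "(u has_integral d *\<^sub>R ub) {s..s + d}"
      using abs_continuous_has_integral[OF Y, of s "s + d"] s d by (simp add: ub_def)
    have g1: "norm (gradient \<psi> x) \<le> 1" for x by (rule norm_gradient_le[OF \<psi>])
    define A where "A = (\<lambda>r. \<integral>x. gradient \<psi> x \<bullet> velocity H G (u r) (Y r) (\<mu> r) x \<partial>\<mu> r)"
    define E where "E = (\<lambda>r. \<integral>x. gradient \<psi> x \<bullet> velocity H G (u r) (Y s) (\<mu> s) x \<partial>\<mu> s)"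
    define e where "e = (\<integral>x. gradient \<psi> x \<bullet> velocity H G ub (Y s) (\<mu> s) x \<partial>\<mu> s)"
    have AI: "(A has_integral (\<integral>x. \<psi> x \<partial>\<mu> (s + d)) - (\<integral>x. \<psi> x \<partial>\<mu> s)) {s..s + d}"
      unfolding A_def using abs_continuous_has_integral[OF test[OF \<psi>(1)], of s "s + d"] s d by simp
    have EI: "(E has_integral d * e) {s..s + d}"
      unfolding E_def e_def by (rule averaged_velocity_has_integral[OF Ps K g1 u uI ub d(1)])
    have AE: "norm (A r - E r) \<le> \<eta> / 2" if r: "r \<in> {s..s + d}" for r
    proof -
      have rT: "r \<in> {0..T}" using r s d by auto
      note Pr = P[OF rT]
      interpret R: prob_space "\<mu> r" using P1_D(1)[OF Pr] .
      have l1: "(K * vmax + 1 * vlip)-lipschitz_on UNIV (\<lambda>x. gradient \<psi> x \<bullet> velocity H G (u r) (Y r) (\<mu> r) x)"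
        by (rule inner_lipschitz[OF K g1 velocity_lip[OF Pr u] velocity_bound[OF Pr u]])
      have l2: "(K * vmax + 1 * vlip)-lipschitz_on UNIV (\<lambda>x. gradient \<psi> x \<bullet> velocity H G (u r) (Y s) (\<mu> s) x)"
        by (rule inner_lipschitz[OF K g1 velocity_lip[OF Ps u] velocity_bound[OF Ps u]])
      note i1 = P1_lipschitz_integrable[OF Pr l1] and i2 = P1_lipschitz_integrable[OF Pr l2]
      have "norm (A r - (\<integral>x. gradient \<psi> x \<bullet> velocity H G (u r) (Y s) (\<mu> s) x \<partial>\<mu> r))
        \<le> \<Lambda> * lipdist (\<mu> r) (\<mu> s) + D * (B * \<Lambda> * norm (Y r - Y s))" (is "_ \<le> ?c")
        unfolding A_def
      proof (rule R.norm_integral_diff_le[OF i1 i2], rule AE_I2)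
        fix x
        show "norm (gradient \<psi> x \<bullet> velocity H G (u r) (Y r) (\<mu> r) x - gradient \<psi> x \<bullet> velocity H G (u r) (Y s) (\<mu> s) x) \<le> ?c"
          unfolding inner_diff_right[symmetric] real_norm_def
          using order_trans[OF Cauchy_Schwarz_ineq2 mult_mono[OF g1 velocity_diff[OF Pr Ps u, of r "Y r" x "u r" "Y s"]], of x] by simp
      qed
      then have 1: "\<bar>A r - (\<integral>x. gradient \<psi> x \<bullet> velocity H G (u r) (Y s) (\<mu> s) x \<partial>\<mu> r)\<bar> \<le> ?c" by simp
      have 2: "\<bar>(\<integral>x. gradient \<psi> x \<bullet> velocity H G (u r) (Y s) (\<mu> s) x \<partial>\<mu> r) - E r\<bar>
        \<le> (K * vmax + 1 * vlip) * lipdist (\<mu> r) (\<mu> s)"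
        unfolding E_def by (rule lipdist_upper_abs[OF Pr Ps l2])
      have "\<bar>A r - E r\<bar> \<le> w r"
        using 1 2 K0 unfolding w_def by (simp add: distrib_right)
      also have "w r \<le> \<eta> / 2"
      proof (cases "r = s")
        case False
        then show ?thesis using d1(2)[OF rT] r d by (simp add: dist_real_def d0_def)
      qed (use ws in simp)
      finally show ?thesis by simp
    qed
    have "norm ((\<integral>x. \<psi> x \<partial>\<mu> (s + d)) - (\<integral>x. \<psi> x \<partial>\<mu> s) - d * e) \<le> \<eta> / 2 * measure lborel (cbox s (s + d))"
      using has_integral_bound[OF _ has_integral_diff[OF AI EI, folded box_real] AE] \<eta> by auto
    then have 3: "\<bar>(\<integral>x. \<psi> x \<partial>\<mu> (s + d)) - (\<integral>x. \<psi> x \<partial>\<mu> s) - d * e\<bar> \<le> \<eta> / 2 * d" using d by simp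
    let ?v = "velocity H G ub (Y s) (\<mu> s)"
    have vb: "norm (?v x) \<le> vmax" for x by (rule velocity_bound[OF Ps ub])
    have vl: "vlip-lipschitz_on UNIV ?v" by (rule velocity_lip[OF Ps ub])
    have l3: "(K * vmax + 1 * vlip)-lipschitz_on UNIV (\<lambda>x. gradient \<psi> x \<bullet> ?v x)"
      by (rule inner_lipschitz[OF K g1 vl vb])
    have l4: "(1 * (1 + \<bar>d\<bar> * vlip))-lipschitz_on UNIV (\<lambda>x. \<psi> (x + d *\<^sub>R ?v x))"
      by (rule lipschitz_on_compose2[OF lipschitz_on_add[OF lipschitz_on_id lipschitz_on_cmult[OF vl]]])
        (rule lipschitz_on_subset[OF \<psi>(2) subset_UNIV])
    note i = P1_lipschitz_integrable[OF Ps l3] P1_lipschitz_integrable[OF Ps l4] P1_lipschitz_integrable[OF Ps \<psi>(2)]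
    have tay: "\<bar>\<psi> (x + d *\<^sub>R ?v x) - \<psi> x - d * (gradient \<psi> x \<bullet> ?v x)\<bar> \<le> \<eta> / 2 * d" for x
    proof -
      have "\<bar>\<psi> (x + d *\<^sub>R ?v x) - \<psi> x - gradient \<psi> x \<bullet> (d *\<^sub>R ?v x)\<bar> \<le> K * (norm (d *\<^sub>R ?v x))\<^sup>2"
        by (rule gradient_taylor[OF test_functionsD(5)[OF \<psi>(1)] K])
      also have "\<dots> = (K * (norm (?v x))\<^sup>2 * d) * d" using d by (simp add: power_mult_distrib power2_eq_square)
      also have "\<dots> \<le> \<eta> / 2 * d"
      proof (rule mult_right_mono)
        have "K * (norm (?v x))\<^sup>2 * d \<le> \<bar>K\<bar> * vmax\<^sup>2 * d"
          using K0 vb d by (intro mult_right_mono mult_mono power_mono) auto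
        also have "\<dots> \<le> (\<bar>K\<bar> * vmax\<^sup>2 + 1) * d" using d by (simp add: distrib_right)
        also have "\<dots> \<le> \<eta> / 2"
        proof -
          have "d < \<eta> / (2 * (\<bar>K\<bar> * vmax\<^sup>2 + 1))" using d by (simp add: d0_def)
          then have "d * (2 * (\<bar>K\<bar> * vmax\<^sup>2 + 1)) < \<eta>" using KV by (simp only: pos_less_divide_eq)
          then show ?thesis by (simp add: algebra_simps)
        qed
        finally show "K * (norm (?v x))\<^sup>2 * d \<le> \<eta> / 2" .
      qed (use d in simp)
      finally show ?thesis by simp
    qed
    have "norm ((\<integral>x. \<psi> (x + d *\<^sub>R ?v x) \<partial>\<mu> s) - (\<integral>x. \<psi> x + d * (gradient \<psi> x \<bullet> ?v x) \<partial>\<mu> s)) \<le> \<eta> / 2 * d"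
      using i tay by (intro S.norm_integral_diff_le) (auto simp: algebra_simps)
    then have 4: "\<bar>(\<integral>x. \<psi> (x + d *\<^sub>R ?v x) \<partial>\<mu> s) - (\<integral>x. \<psi> x \<partial>\<mu> s) - d * e\<bar> \<le> \<eta> / 2 * d"
      unfolding e_def using i by (simp add: algebra_simps)
    have "\<bar>(\<integral>x. \<psi> x \<partial>\<mu> (s + d)) - (\<integral>x. \<psi> (x + d *\<^sub>R ?v x) \<partial>\<mu> s)\<bar> \<le> d * \<eta>"
    proof -
      have "d * \<eta> = \<eta> / 2 * d + \<eta> / 2 * d" by simp
      then show ?thesis using 3 4 by linarith
    qed
    then show "euler_defect Y \<mu> s d \<psi> \<le> d * \<eta>"
      unfolding euler_defect_def ub_def .
  qed
qed


text \<open>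
  Four errors add up.  The Euler defects are \<open>o(d)\<close>.  The two fields differ by a multiple of the
  distance of the states and controls, where \<open>lipdist\<close> is at most \<open>moll_dist + 2 \<epsilon>\<close>.  Interchanging
  the mollification and the Euler step costs \<open>d * vlip * \<epsilon>\<close>.  What remains is the
  mollification of \<open>\<phi>\<close> composed with the Euler step, a function with Lipschitz constant
  \<open>1 + d * vlip\<close>, tested against \<open>\<mu> s\<close> and \<open>\<nu> s\<close>.
\<close>

lemma moll_dist_step:
  fixes u u' :: "real \<Rightarrow> (real^'d)^'m"
  assumes moll: "mollifier \<rho> \<epsilon>" and \<epsilon>: "0 \<le> \<epsilon>"
    and sol: "weak_solution T H G B R u Y \<mu>" and sol': "weak_solution T H G B R u' Y' \<nu>" and R: "0 \<le> R"
    and \<kappa>: "\<And>t. norm (u t - u' t) \<le> \<kappa>" and Y0: "Y 0 = Y' 0"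
    and s: "0 \<le> s" "s < T" and \<eta>: "0 < \<eta>"
  shows "\<exists>d0>0. \<forall>d. 0 < d \<and> d < d0 \<and> s + d \<le> T \<longrightarrow>
    moll_dist \<rho> (\<mu> (s + d)) (\<nu> (s + d)) \<le> moll_dist \<rho> (\<mu> s) (\<nu> s) +
      d * ((vlip + \<Lambda>) * moll_dist \<rho> (\<mu> s) (\<nu> s) +
        (2 * (vlip + \<Lambda>) * \<epsilon> + D * (M + B * \<Lambda> * T) * \<kappa> + 2 * \<eta>))"
proof -
  interpret mollifier \<rho> \<epsilon> by fact
  have u: "\<And>t. norm (u t) \<le> B" "\<And>t. norm (u' t) \<le> B"
    and P: "\<And>t. t \<in> {0..T} \<Longrightarrow> \<mu> t \<in> P1" "\<And>t. t \<in> {0..T} \<Longrightarrow> \<nu> t \<in> P1"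
    and supp: "\<And>t. t \<in> {0..T} \<Longrightarrow> AE x in \<mu> t. norm x \<le> R" "\<And>t. t \<in> {0..T} \<Longrightarrow> AE x in \<nu> t. norm x \<le> R"
    and Y: "caratheodory T Y u" "caratheodory T Y' u'"
    using sol sol' unfolding weak_solution_def by auto
  have Ps: "\<mu> s \<in> P1" "\<nu> s \<in> P1" using P s by auto
  interpret MS: prob_space "\<mu> s" using P1_D(1)[OF Ps(1)] .
  interpret NS: prob_space "\<nu> s" using P1_D(1)[OF Ps(2)] .
  have \<kappa>0: "0 \<le> \<kappa>" using \<kappa> norm_ge_zero order_trans by blast
  obtain K where K: "\<And>\<phi>. 1-lipschitz_on UNIV \<phi> \<Longrightarrow> compact (closure {x. \<phi> x \<noteq> 0}) \<Longrightarrow>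
      K-lipschitz_on UNIV (gradient (mollify \<rho> \<phi>))"
    using gradient_mollify_lipschitz[OF rho(1)] by metis
  obtain d1 where d1: "0 < d1" and E1:
    "\<forall>d \<psi>. 0 < d \<longrightarrow> d < d1 \<longrightarrow> s + d \<le> T \<longrightarrow> \<psi> \<in> test_functions \<longrightarrow> 1-lipschitz_on UNIV \<psi> \<longrightarrow>
       K-lipschitz_on UNIV (gradient \<psi>) \<longrightarrow> euler_defect Y \<mu> s d \<psi> \<le> d * \<eta>"
    using euler_step[OF sol s \<eta>, of K] by (elim exE conjE)
  obtain d2 where d2: "0 < d2" and E2:
    "\<forall>d \<psi>. 0 < d \<longrightarrow> d < d2 \<longrightarrow> s + d \<le> T \<longrightarrow> \<psi> \<in> test_functions \<longrightarrow> 1-lipschitz_on UNIV \<psi> \<longrightarrow>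
       K-lipschitz_on UNIV (gradient \<psi>) \<longrightarrow> euler_defect Y' \<nu> s d \<psi> \<le> d * \<eta>"
    using euler_step[OF sol' s \<eta>, of K] by (elim exE conjE)
  show ?thesis
  proof (intro exI[of _ "min d1 d2"] conjI allI impI)
    show "0 < min d1 d2" using d1 d2 by simp
    fix d assume "0 < d \<and> d < min d1 d2 \<and> s + d \<le> T"
    then have d: "0 < d" "d < d1" "d < d2" "s + d \<le> T" by auto
    have sd: "s + d \<in> {0..T}" using s d by auto
    note Pd = P[OF sd]
    define w where "w = velocity H G ((Y (s + d) - Y s) /\<^sub>R d) (Y s) (\<mu> s)"
    define w' where "w' = velocity H G ((Y' (s + d) - Y' s) /\<^sub>R d) (Y' s) (\<nu> s)"
    have ub: "norm ((Y (s + d) - Y s) /\<^sub>R d) \<le> B" "norm ((Y' (s + d) - Y' s) /\<^sub>R d) \<le> B"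
      using caratheodory_lipschitz[OF Y(1) u(1), of s "s + d"] caratheodory_lipschitz[OF Y(2) u(2), of s "s + d"] s d
      by (simp_all add: norm_average_le del: norm_scaleR)
    have wl: "vlip-lipschitz_on UNIV w" "vlip-lipschitz_on UNIV w'"
      unfolding w_def w'_def by (intro velocity_lip Ps ub)+
    have ww: "norm (w x - w' x) \<le> \<Lambda> * lipdist (\<mu> s) (\<nu> s) + D * (M + B * \<Lambda> * T) * \<kappa>" for x
    proof -
      have 1: "norm ((Y (s + d) - Y s) /\<^sub>R d - (Y' (s + d) - Y' s) /\<^sub>R d) \<le> \<kappa>"
        using caratheodory_diff_bound[OF Y \<kappa>, of s "s + d"] s d
        unfolding scaleR_right_diff_distrib[symmetric] by (intro norm_average_le) auto
      have "norm (Y s - Y' s) \<le> \<kappa> * s"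
        using caratheodory_diff_bound[OF Y \<kappa>, of 0 s] s Y0 by simp
      also have "\<dots> \<le> \<kappa> * T" using s \<kappa>0 by (intro mult_left_mono) auto
      finally have 2: "norm (Y s - Y' s) \<le> \<kappa> * T" .
      have "norm (w x - w' x) \<le> \<Lambda> * lipdist (\<mu> s) (\<nu> s) + D * (M * norm ((Y (s + d) - Y s) /\<^sub>R d - (Y' (s + d) - Y' s) /\<^sub>R d) + B * \<Lambda> * norm (Y s - Y' s))"
        unfolding w_def w'_def by (rule velocity_diff[OF Ps ub(1)])
      also have "\<dots> \<le> \<Lambda> * lipdist (\<mu> s) (\<nu> s) + D * (M * \<kappa> + B * \<Lambda> * (\<kappa> * T))"
        using 1 2 consts_nonneg M_nonneg B_nonneg \<Lambda>_nonneg by (intro add_left_mono mult_left_mono add_mono) auto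
      finally show ?thesis by (simp add: algebra_simps)
    qed
    show "moll_dist \<rho> (\<mu> (s + d)) (\<nu> (s + d)) \<le> moll_dist \<rho> (\<mu> s) (\<nu> s) +
      d * ((vlip + \<Lambda>) * moll_dist \<rho> (\<mu> s) (\<nu> s) +
        (2 * (vlip + \<Lambda>) * \<epsilon> + D * (M + B * \<Lambda> * T) * \<kappa> + 2 * \<eta>))"
    proof (rule moll_dist_least)
      fix \<phi> :: "real^'d \<Rightarrow> real" assume \<phi>: "1-lipschitz_on UNIV \<phi>"
      obtain \<phi>c :: "real^'d \<Rightarrow> real" where \<phi>c: "1-lipschitz_on UNIV \<phi>c" "compact (closure {x. \<phi>c x \<noteq> 0})"
        "\<And>x. norm x \<le> R + \<epsilon> \<Longrightarrow> \<phi>c x = \<phi> x - \<phi> 0"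
        using lipschitz_cutoff[OF \<phi>, of "R + \<epsilon>"] R \<epsilon> by auto
      define \<psi> where "\<psi> = mollify \<rho> \<phi>c"
      note cc = lipschitz_on_continuous_on[OF \<phi>c(1)] and c\<phi> = lipschitz_on_continuous_on[OF \<phi>]
      have \<psi>: "\<psi> \<in> test_functions" "1-lipschitz_on UNIV \<psi>" "K-lipschitz_on UNIV (gradient \<psi>)"
        unfolding \<psi>_def using mollify_test[OF rho(1) cc \<phi>c(2)] mollify_lip[OF \<phi>c(1)] K[OF \<phi>c(1,2)] by auto
      \<comment> \<open>The cutoff makes the test function compactly supported and is invisible to both measures.\<close>
      have eqR: "\<psi> x = mollify \<rho> \<phi> x - \<phi> 0" if "norm x \<le> R" for x
      proof -
        have "\<bar>mollify \<rho> \<phi>c x - mollify \<rho> (\<lambda>x. \<phi> x - \<phi> 0) x\<bar> \<le> 0 * (\<integral>z. \<bar>\<rho> z\<bar> \<partial>lborel)"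
        proof (rule mollify_diff_bound[OF rho(1) cc])
          show "continuous_on UNIV (\<lambda>x. \<phi> x - \<phi> 0)" using c\<phi> by (intro continuous_intros)
          fix z assume "\<rho> z \<noteq> 0"
          then have "norm z \<le> \<epsilon>" using rho(3) by (meson not_le)
          then have "norm (x - z) \<le> R + \<epsilon>" using that norm_triangle_ineq4[of x z] by linarith
          then show "\<bar>\<phi>c (x - z) - (\<phi> (x - z) - \<phi> 0)\<bar> \<le> 0" using \<phi>c(3) by simp
        qed
        then show ?thesis using mollify_shift[OF rho(1,4) c\<phi>, of "\<phi> 0" x] by (simp add: \<psi>_def)
      qed
      have int_eq: "(\<integral>x. \<psi> x \<partial>\<xi>) = (\<integral>x. mollify \<rho> \<phi> x \<partial>\<xi>) - \<phi> 0"
        if "\<xi> \<in> P1" "AE x in \<xi>. norm x \<le> R" for \<xi>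
      proof -
        interpret prob_space \<xi> using P1_D(1)[OF that(1)] .
        note i = P1_lipschitz_integrable[OF that(1) mollify_lip[OF \<phi>]] P1_lipschitz_integrable[OF that(1) \<psi>(2)]
        have "(\<integral>x. \<psi> x \<partial>\<xi>) = (\<integral>x. mollify \<rho> \<phi> x - \<phi> 0 \<partial>\<xi>)"
        proof (rule integral_cong_AE)
          show "AE x in \<xi>. \<psi> x = mollify \<rho> \<phi> x - \<phi> 0" using that(2) by eventually_elim (rule eqR)
        qed (use i in \<open>auto intro!: borel_measurable_integrable\<close>)
        then show ?thesis using i by (simp add: prob_space)
      qed
      define m where "m = moll_dist \<rho> (\<mu> s) (\<nu> s)"
      have e1: "\<bar>(\<integral>x. \<psi> x \<partial>\<mu> (s + d)) - (\<integral>x. \<psi> (x + d *\<^sub>R w x) \<partial>\<mu> s)\<bar> \<le> d * \<eta>"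
        unfolding w_def by (rule E1[unfolded euler_defect_def, rule_format, OF d(1,2,4) \<psi>])
      have e2: "\<bar>(\<integral>x. \<psi> x \<partial>\<nu> (s + d)) - (\<integral>x. \<psi> (x + d *\<^sub>R w' x) \<partial>\<nu> s)\<bar> \<le> d * \<eta>"
        unfolding w'_def by (rule E2[unfolded euler_defect_def, rule_format, OF d(1,3,4) \<psi>])
      have shift: "(1 * (1 + \<bar>d\<bar> * vlip))-lipschitz_on UNIV (\<lambda>x. f (x + d *\<^sub>R v x))"
        if "vlip-lipschitz_on UNIV v" "1-lipschitz_on UNIV f" for v :: "real^'d \<Rightarrow> real^'d" and f :: "real^'d \<Rightarrow> real"
        by (rule lipschitz_on_compose2[OF lipschitz_on_add[OF lipschitz_on_id lipschitz_on_cmult[OF that(1)]]])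
          (rule lipschitz_on_subset[OF that(2) subset_UNIV])
      define \<theta> where "\<theta> = (\<lambda>x. \<phi>c (x + d *\<^sub>R w x))"
      have \<theta>: "(1 + d * vlip)-lipschitz_on UNIV \<theta>"
        unfolding \<theta>_def using shift[OF wl(1) \<phi>c(1)] d by simp
      have comm: "\<bar>\<psi> (x + d *\<^sub>R w x) - mollify \<rho> \<theta> x\<bar> \<le> d * vlip * \<epsilon>" for x
      proof -
        have "\<bar>mollify \<rho> \<phi>c (x + d *\<^sub>R w x) - mollify \<rho> \<theta> x\<bar> \<le> d * vlip * \<epsilon> * (\<integral>z. \<bar>\<rho> z\<bar> \<partial>lborel)"
        proof (rule mollify_diff_bound[OF rho(1) cc lipschitz_on_continuous_on[OF \<theta>]])
          fix z assume "\<rho> z \<noteq> 0"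
          then have z: "norm z \<le> \<epsilon>" using rho(3) by (meson not_le)
          have "\<bar>\<phi>c (x + d *\<^sub>R w x - z) - \<theta> (x - z)\<bar> \<le> norm ((x + d *\<^sub>R w x - z) - (x - z + d *\<^sub>R w (x - z)))"
            unfolding \<theta>_def using lipschitz_onD[OF \<phi>c(1), of "x + d *\<^sub>R w x - z" "x - z + d *\<^sub>R w (x - z)"]
            by (simp add: dist_norm)
          also have "\<dots> = d * norm (w x - w (x - z))"
            using d by (simp add: scaleR_right_diff_distrib[symmetric])
          also have "\<dots> \<le> d * (vlip * norm z)"
            using lipschitz_onD[OF wl(1), of x "x - z"] d by (intro mult_left_mono) (auto simp: dist_norm)
          also have "\<dots> \<le> d * (vlip * \<epsilon>)" using d z consts_nonneg by (intro mult_left_mono) auto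
          finally show "\<bar>\<phi>c (x + d *\<^sub>R w x - z) - \<theta> (x - z)\<bar> \<le> d * vlip * \<epsilon>" by simp
        qed
        then show ?thesis by (simp add: \<psi>_def rho_abs)
      qed
      have comm_int: "\<bar>(\<integral>x. \<psi> (x + d *\<^sub>R w x) \<partial>\<xi>) - (\<integral>x. mollify \<rho> \<theta> x \<partial>\<xi>)\<bar> \<le> d * vlip * \<epsilon>" if "\<xi> \<in> P1" for \<xi>
      proof -
        interpret prob_space \<xi> using P1_D(1)[OF that] .
        show ?thesis
          using norm_integral_diff_le[OF P1_lipschitz_integrable[OF that shift[OF wl(1) \<psi>(2)]] P1_lipschitz_integrable[OF that mollify_lip[OF \<theta>]]]
            comm by simp
      qed
      have field: "norm ((\<integral>x. \<psi> (x + d *\<^sub>R w x) \<partial>\<nu> s) - (\<integral>x. \<psi> (x + d *\<^sub>R w' x) \<partial>\<nu> s))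
          \<le> d * (\<Lambda> * lipdist (\<mu> s) (\<nu> s) + D * (M + B * \<Lambda> * T) * \<kappa>)" (is "_ \<le> ?c")
      proof (rule NS.norm_integral_diff_le[OF P1_lipschitz_integrable[OF Ps(2) shift[OF wl(1) \<psi>(2)]] P1_lipschitz_integrable[OF Ps(2) shift[OF wl(2) \<psi>(2)]]], rule AE_I2)
        fix x
        have "norm (\<psi> (x + d *\<^sub>R w x) - \<psi> (x + d *\<^sub>R w' x)) \<le> norm (d *\<^sub>R (w x - w' x))"
          using lipschitz_onD[OF \<psi>(2), of "x + d *\<^sub>R w x" "x + d *\<^sub>R w' x"] by (simp add: dist_norm scaleR_right_diff_distrib)
        also have "\<dots> \<le> ?c" using ww[of x] d by (simp add: mult_left_mono)
        finally show "norm (\<psi> (x + d *\<^sub>R w x) - \<psi> (x + d *\<^sub>R w' x)) \<le> ?c" .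
      qed
      have main: "(\<integral>x. mollify \<rho> \<theta> x \<partial>\<mu> s) - (\<integral>x. mollify \<rho> \<theta> x \<partial>\<nu> s) \<le> (1 + d * vlip) * m"
        unfolding m_def using d consts_nonneg by (intro moll_dist_upper[OF Ps \<theta>]) (simp add: add_pos_nonneg)
      have "d * (\<Lambda> * lipdist (\<mu> s) (\<nu> s)) \<le> d * (\<Lambda> * (m + 2 * \<epsilon>))"
        unfolding m_def using d \<Lambda>_nonneg lipdist_le_moll_dist[OF Ps] by (intro mult_left_mono) auto
      moreover have "(\<integral>x. mollify \<rho> \<phi> x \<partial>\<mu> (s + d)) - (\<integral>x. mollify \<rho> \<phi> x \<partial>\<nu> (s + d))
        = (\<integral>x. \<psi> x \<partial>\<mu> (s + d)) - (\<integral>x. \<psi> x \<partial>\<nu> (s + d))"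
        using int_eq[OF Pd(1) supp(1)[OF sd]] int_eq[OF Pd(2) supp(2)[OF sd]] by simp
      moreover have "(1 + d * vlip) * m + d * (\<Lambda> * (m + 2 * \<epsilon>)) + d * (D * (M + B * \<Lambda> * T) * \<kappa>) + 2 * (d * vlip * \<epsilon>) + 2 * (d * \<eta>)
        = m + d * ((vlip + \<Lambda>) * m + (2 * (vlip + \<Lambda>) * \<epsilon> + D * (M + B * \<Lambda> * T) * \<kappa> + 2 * \<eta>))"
        by (simp add: algebra_simps)
      ultimately show "(\<integral>x. mollify \<rho> \<phi> x \<partial>\<mu> (s + d)) - (\<integral>x. mollify \<rho> \<phi> x \<partial>\<nu> (s + d))
        \<le> moll_dist \<rho> (\<mu> s) (\<nu> s) + d * ((vlip + \<Lambda>) * moll_dist \<rho> (\<mu> s) (\<nu> s) +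
        (2 * (vlip + \<Lambda>) * \<epsilon> + D * (M + B * \<Lambda> * T) * \<kappa> + 2 * \<eta>))"
        using e1 e2 comm_int[OF Ps(1)] comm_int[OF Ps(2)] field[unfolded real_norm_def] main
        unfolding m_def[symmetric] distrib_left[of d "\<Lambda> * lipdist (\<mu> s) (\<nu> s)"] by linarith
    qed
  qed
qed

text \<open>
  The differential inequality of \<open>moll_dist_step\<close> is integrated for a fixed mollifier; the terms
  proportional to its scale vanish in the limit.
\<close>

theorem weak_solution_stability:
  fixes u u' :: "real \<Rightarrow> (real^'d)^'m"
  assumes sol: "weak_solution T H G B R u Y \<mu>" and sol': "weak_solution T H G B R u' Y' \<nu>" and R: "0 \<le> R"
    and \<kappa>: "\<And>t. norm (u t - u' t) \<le> \<kappa>" and Y0: "Y 0 = Y' 0"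
    and t: "t \<in> {0..T}"
  shows "lipdist (\<mu> t) (\<nu> t) \<le> exp ((vlip + \<Lambda>) * T) * (lipdist (\<mu> 0) (\<nu> 0) + D * (M + B * \<Lambda> * T) * T * \<kappa>)"
proof -
  have P: "\<And>t. t \<in> {0..T} \<Longrightarrow> \<mu> t \<in> P1" "\<And>t. t \<in> {0..T} \<Longrightarrow> \<nu> t \<in> P1"
    and lim: "\<And>t. t \<in> {0..T} \<Longrightarrow> ((\<lambda>s. lipdist (\<mu> s) (\<mu> t)) \<longlongrightarrow> 0) (at t within {0..T})"
      "\<And>t. t \<in> {0..T} \<Longrightarrow> ((\<lambda>s. lipdist (\<nu> s) (\<nu> t)) \<longlongrightarrow> 0) (at t within {0..T})"
    using sol sol' unfolding weak_solution_def by auto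
  have T0: "0 \<in> {0..T}" "0 \<le> T" using t by auto
  define c where "c = vlip + \<Lambda>"
  define b where "b = D * (M + B * \<Lambda> * T) * \<kappa>"
  have \<kappa>0: "0 \<le> \<kappa>" using \<kappa> norm_ge_zero order_trans by blast
  have c0: "0 \<le> c" and b0: "0 \<le> b"
    using consts_nonneg \<Lambda>_nonneg M_nonneg B_nonneg \<kappa>0 T0 by (auto simp: c_def b_def)
  have est: "lipdist (\<mu> t) (\<nu> t) \<le> exp (c * T) * (lipdist (\<mu> 0) (\<nu> 0) + b * T) + e * (2 + exp (c * T) * ((2 * c + 2) * T))"
    if e: "0 < e" for e
  proof -
    obtain \<rho> :: "real^'d \<Rightarrow> real" where \<rho>: "mollifier \<rho> e"
      using mollifier_exists[OF e] by (metis mollifier.intro)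
    interpret mollifier \<rho> e by fact
    define f where "f = (\<lambda>t. moll_dist \<rho> (\<mu> t) (\<nu> t))"
    have cont: "continuous_on {0..T} f"
      unfolding continuous_on_def
    proof
      fix t assume t: "t \<in> {0..T}"
      show "(f \<longlongrightarrow> f t) (at t within {0..T})"
      proof (rule LIM_zero_cancel, rule Lim_null_comparison)
        show "\<forall>\<^sub>F s in at t within {0..T}. norm (f s - f t) \<le> lipdist (\<mu> s) (\<mu> t) + lipdist (\<nu> s) (\<nu> t)"
          unfolding eventually_at_filter
        proof (intro always_eventually allI impI)
          fix s assume s: "s \<in> {0..T}"
          show "norm (f s - f t) \<le> lipdist (\<mu> s) (\<mu> t) + lipdist (\<nu> s) (\<nu> t)"
            using moll_dist_triangle[OF P(1)[OF s] P(2)[OF s] P(1)[OF t] P(2)[OF t]]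
              moll_dist_triangle[OF P(1)[OF t] P(2)[OF t] P(1)[OF s] P(2)[OF s]]
              lipdist_sym[OF P(1)[OF s] P(1)[OF t]] lipdist_sym[OF P(2)[OF s] P(2)[OF t]]
            by (simp add: f_def abs_le_iff)
        qed
        show "((\<lambda>s. lipdist (\<mu> s) (\<mu> t) + lipdist (\<nu> s) (\<nu> t)) \<longlongrightarrow> 0) (at t within {0..T})"
          using tendsto_add[OF lim(1)[OF t] lim(2)[OF t]] by simp
      qed
    qed
    have "f t \<le> exp (c * t) * (f 0 + (2 * c * e + b + 2 * e) * t)"
    proof (rule dini_gronwall[OF cont c0])
      show "0 \<le> 2 * c * e + b + 2 * e" using c0 b0 e by simp
      show "0 \<le> f 0" unfolding f_def by (intro moll_dist_nonneg P T0)
      fix s assume "0 \<le> s" "s < T"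
      from moll_dist_step[OF \<rho> less_imp_le[OF e] sol sol' R \<kappa> Y0 this e]
      show "\<exists>d0>0. \<forall>d. 0 < d \<and> d < d0 \<and> s + d \<le> T \<longrightarrow> f (s + d) \<le> f s + d * (c * f s + (2 * c * e + b + 2 * e))"
        unfolding f_def c_def b_def .
    qed (use t in auto)
    also have "\<dots> \<le> exp (c * T) * (lipdist (\<mu> 0) (\<nu> 0) + (2 * c * e + b + 2 * e) * T)"
    proof (intro mult_mono add_mono)
      show "f 0 \<le> lipdist (\<mu> 0) (\<nu> 0)" unfolding f_def by (intro moll_dist_le_lipdist P T0)
      have "0 \<le> f 0" unfolding f_def by (intro moll_dist_nonneg P T0)
      then show "0 \<le> f 0 + (2 * c * e + b + 2 * e) * t" using t c0 b0 e by (intro add_nonneg_nonneg mult_nonneg_nonneg) auto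
    qed (use t c0 b0 e in \<open>auto intro!: mult_left_mono\<close>)
    finally have "lipdist (\<mu> t) (\<nu> t) \<le> exp (c * T) * (lipdist (\<mu> 0) (\<nu> 0) + (2 * c * e + b + 2 * e) * T) + 2 * e"
      using lipdist_le_moll_dist[OF P(1)[OF t] P(2)[OF t]] by (simp add: f_def)
    then show ?thesis by (simp add: algebra_simps)
  qed
  define q where "q = 2 + exp (c * T) * ((2 * c + 2) * T)"
  have q: "0 < q" unfolding q_def using c0 T0 by (intro add_pos_nonneg mult_nonneg_nonneg) auto
  have "lipdist (\<mu> t) (\<nu> t) \<le> exp (c * T) * (lipdist (\<mu> 0) (\<nu> 0) + b * T)"
  proof (rule field_le_epsilon)
    fix e :: real assume "0 < e"
    then show "lipdist (\<mu> t) (\<nu> t) \<le> exp (c * T) * (lipdist (\<mu> 0) (\<nu> 0) + b * T) + e"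
      using est[of "e / q"] q by (simp add: q_def[symmetric])
  qed
  then show ?thesis by (simp add: c_def b_def mult_ac)
qed

end

section \<open>Characteristics of the mean-field equation\<close>

locale flow_setup = lipschitz_field H G \<Lambda> M B
  for H :: "real^'d \<Rightarrow> real^'d" and G :: "'d \<Rightarrow> real^'d \<Rightarrow> real^'d" and \<Lambda> M B :: real +
  fixes T :: real and u :: "real \<Rightarrow> (real^'d)^'m" and Y0 :: "(real^'d)^'m" and \<mu>0 :: "(real^'d) measure"
  assumes T: "0 < T" and u_bound: "\<And>t. norm (u t) \<le> B"
    and u_meas: "u \<in> borel_measurable (lebesgue_on {0..T})" and \<mu>0: "\<mu>0 \<in> P1"
begin

definition Y where "Y t = Y0 + integral {0..t} u"

text \<open>
  For these flows the velocity along each path is measurable in time, and the image of \<open>\<mu>0\<close> has a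
  finite first moment.
\<close>

definition admissible :: "(real \<Rightarrow> real^'d \<Rightarrow> real^'d) \<Rightarrow> bool" where
  "admissible X \<longleftrightarrow> continuous_on UNIV (\<lambda>(s, x). X s x) \<and> (\<exists>b. \<forall>s x. norm (X s x - x) \<le> b)"

definition pushed :: "(real \<Rightarrow> real^'d \<Rightarrow> real^'d) \<Rightarrow> real \<Rightarrow> (real^'d) measure" where
  "pushed X s = distr \<mu>0 borel (X s)"

definition flow_vel :: "(real \<Rightarrow> real^'d \<Rightarrow> real^'d) \<Rightarrow> real \<Rightarrow> real^'d \<Rightarrow> real^'d" where
  "flow_vel X s x = velocity H G (u s) (Y s) (pushed X s) (X s x)"

sublocale M0: prob_space \<mu>0 using P1_D(1)[OF \<mu>0] .

lemma integrable_bounded_measurable: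
  fixes f :: "real \<Rightarrow> 'a::euclidean_space"
  assumes "f \<in> borel_measurable (lebesgue_on {0..T})" "\<And>s. s \<in> {0..T} \<Longrightarrow> norm (f s) \<le> c" "t \<le> T" "0 \<le> r"
  shows "f integrable_on {r..t}"
proof -
  have "f integrable_on {0..T}"
    by (rule measurable_bounded_by_integrable_imp_integrable[OF assms(1) integrable_const_ivl assms(2)]) auto
  then show ?thesis by (rule integrable_on_subinterval) (use assms in auto)
qed

lemma u_integrable: "t \<le> T \<Longrightarrow> 0 \<le> r \<Longrightarrow> u integrable_on {r..t}"
  by (rule integrable_bounded_measurable[OF u_meas u_bound])

lemma Y_diff: "0 \<le> r \<Longrightarrow> r \<le> t \<Longrightarrow> t \<le> T \<Longrightarrow> Y t - Y r = integral {r..t} u"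
  using Henstock_Kurzweil_Integration.integral_combine[of 0 r t u] u_integrable[of t 0]
  by (simp add: Y_def) (metis add_diff_cancel_left')

lemma Y_lip: "s \<in> {0..T} \<Longrightarrow> t \<in> {0..T} \<Longrightarrow> norm (Y t - Y s) \<le> B * \<bar>t - s\<bar>"
proof (induction s t rule: linorder_wlog)
  case (le s t)
  then show ?case
    using norm_integral_le[OF u_integrable[of t s] _ u_bound] Y_diff[of s t] by simp
next
  case (sym s t)
  then show ?case by (simp add: norm_minus_commute abs_minus_commute)
qed

lemma Y_caratheodory: "caratheodory T Y u"
  unfolding caratheodory_def
proof
  show "abs_continuous_on 0 T Y"
    using Y_lip B_nonneg by (intro abs_continuous_on_lipschitz[OF _ _ abs_continuous_on_id, of 0 T Y B]) auto
  show "AE t in lebesgue_on {0..T}. (Y has_vector_derivative u t) (at t within {0..T})"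
    using lebesgue_differentiation[OF u_integrable[OF order_refl order_refl]]
  proof eventually_elim
    case (elim t)
    then have "((\<lambda>t. Y0 + integral {0..t} u) has_vector_derivative 0 + u t) (at t within {0..T})"
      by (intro has_vector_derivative_add) auto
    then show ?case by (simp add: Y_def[abs_def])
  qed
qed

lemma Y_continuous: "continuous_on {0..T} Y"
  using caratheodory_continuous[OF Y_caratheodory] T by simp

lemma admissible_continuous:
  assumes "admissible X" shows "continuous_on UNIV (X s)" "continuous_on UNIV (\<lambda>s. X s x)"
proof -
  have c: "continuous_on UNIV (\<lambda>(s, x). X s x)" using assms by (simp add: admissible_def)
  show "continuous_on UNIV (X s)"
    using continuous_on_compose2[OF c, of UNIV "\<lambda>x. (s, x)"] by (simp add: continuous_intros)
  show "continuous_on UNIV (\<lambda>s. X s x)"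
    using continuous_on_compose2[OF c, of UNIV "\<lambda>s. (s, x)"] by (simp add: continuous_intros)
qed

lemma admissible_measurable: "admissible X \<Longrightarrow> X s \<in> borel_measurable \<mu>0"
  using P1_measurable[OF \<mu>0 borel_measurable_continuous_onI[OF admissible_continuous(1)]] .

lemma admissible_bound:
  assumes "admissible X" obtains b where "0 \<le> b" "\<And>s x. norm (X s x - x) \<le> b" "\<And>s x. norm (X s x) \<le> norm x + b"
proof -
  obtain b where b: "\<And>s x. norm (X s x - x) \<le> b" using assms by (auto simp: admissible_def)
  have "norm (X s x) \<le> norm x + b" for s x using norm_triangle_sub[of "X s x" x] b[of s x] by linarith
  then show thesis using b order_trans[OF norm_ge_zero b] by (intro that)
qed

lemma admissible_integrable: assumes "admissible X" shows "integrable \<mu>0 (\<lambda>x. norm (X s x))"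
proof -
  obtain b where b: "0 \<le> b" "\<And>s x. norm (X s x) \<le> norm x + b" using admissible_bound[OF assms] by metis
  show ?thesis
    by (rule Bochner_Integration.integrable_bound[of _ "\<lambda>x. norm x + b"])
      (use b P1_D(4)[OF \<mu>0] admissible_measurable[OF assms] in auto)
qed

lemma pushed_P1: "admissible X \<Longrightarrow> pushed X s \<in> P1"
  unfolding pushed_def by (intro P1_distr admissible_measurable admissible_integrable M0.prob_space_axioms)

lemma pushed_dist:
  assumes "admissible X" "admissible X'"
  shows "W1 (pushed X s) (pushed X' s') \<le> (\<integral>\<xi>. dist (X s \<xi>) (X' s' \<xi>) \<partial>\<mu>0)"
  unfolding pushed_def by (intro W1_distr_le M0.prob_space_axioms admissible_measurable assms)

lemma pushed_W1_le:
  assumes "admissible X" "admissible X'" "\<And>\<xi>. dist (X s \<xi>) (X' s' \<xi>) \<le> c"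
  shows "W1 (pushed X s) (pushed X' s') \<le> c"
proof -
  have "(\<integral>\<xi>. dist (X s \<xi>) (X' s' \<xi>) \<partial>\<mu>0) \<le> (\<integral>\<xi>. c \<partial>\<mu>0)"
  proof (rule integral_mono)
    show "integrable \<mu>0 (\<lambda>\<xi>. dist (X s \<xi>) (X' s' \<xi>))"
      using admissible_measurable[OF assms(1)] admissible_measurable[OF assms(2)] assms(3)
      by (intro M0.integrable_const_bound[of _ c]) auto
  qed (use assms in auto)
  then show ?thesis using pushed_dist[OF assms(1,2), of s s'] by (simp add: M0.prob_space)
qed

lemma pushed_continuous:
  assumes "admissible X" shows "((\<lambda>s. lipdist (pushed X s) (pushed X t)) \<longlongrightarrow> 0) (at t)"
proof (rule Lim_null_comparison)
  obtain b where b: "0 \<le> b" "\<And>s x. norm (X s x - x) \<le> b" using admissible_bound[OF assms] by metis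
  show "\<forall>\<^sub>F s in at t. norm (lipdist (pushed X s) (pushed X t)) \<le> (\<integral>\<xi>. dist (X s \<xi>) (X t \<xi>) \<partial>\<mu>0)"
  proof (rule always_eventually, rule allI)
    fix s
    show "norm (lipdist (pushed X s) (pushed X t)) \<le> (\<integral>\<xi>. dist (X s \<xi>) (X t \<xi>) \<partial>\<mu>0)"
      using lipdist_le_W1[OF pushed_P1[OF assms] pushed_P1[OF assms], of s t] pushed_dist[OF assms assms, of s t]
        lipdist_nonneg[OF pushed_P1[OF assms] pushed_P1[OF assms], of s t] by simp
  qed
  show "((\<lambda>s. \<integral>\<xi>. dist (X s \<xi>) (X t \<xi>) \<partial>\<mu>0) \<longlongrightarrow> 0) (at t)"
    unfolding tendsto_at_iff_sequentially comp_def
  proof (intro allI impI)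
    fix r :: "nat \<Rightarrow> real" assume r: "r \<longlonglongrightarrow> t"
    have "(\<lambda>n. \<integral>\<xi>. dist (X (r n) \<xi>) (X t \<xi>) \<partial>\<mu>0) \<longlonglongrightarrow> (\<integral>\<xi>. 0 \<partial>\<mu>0)"
    proof (rule integral_dominated_convergence[where w="\<lambda>_. 2 * b"])
      show "AE \<xi> in \<mu>0. (\<lambda>n. dist (X (r n) \<xi>) (X t \<xi>)) \<longlonglongrightarrow> 0"
      proof (rule AE_I2)
        fix \<xi>
        have "(\<lambda>n. X (r n) \<xi>) \<longlonglongrightarrow> X t \<xi>"
          using continuous_on_tendsto_compose[OF admissible_continuous(2)[OF assms] r] by simp
        then show "(\<lambda>n. dist (X (r n) \<xi>) (X t \<xi>)) \<longlonglongrightarrow> 0" by (simp add: tendsto_dist_iff[symmetric])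
      qed
      show "AE \<xi> in \<mu>0. norm (dist (X (r n) \<xi>) (X t \<xi>)) \<le> 2 * b" for n
      proof (rule AE_I2)
        fix \<xi>
        show "norm (dist (X (r n) \<xi>) (X t \<xi>)) \<le> 2 * b"
          using dist_triangle2[of "X (r n) \<xi>" "X t \<xi>" \<xi>] b(2)[of "r n" \<xi>] b(2)[of t \<xi>] by (simp add: dist_norm)
      qed
    qed (use admissible_measurable[OF assms] in auto)
    then show "(\<lambda>n. \<integral>\<xi>. dist (X (r n) \<xi>) (X t \<xi>) \<partial>\<mu>0) \<longlonglongrightarrow> 0" by simp
  qed
qed

lemma convolve_pushed_continuous:
  assumes "admissible X" shows "continuous_on UNIV (\<lambda>s. convolve H (pushed X s) (X s x))"
proof -
  have "isCont (\<lambda>s. convolve H (pushed X s) (X s x)) t" for t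
    unfolding isCont_def
  proof (rule LIM_zero_cancel, rule Lim_null_comparison)
    show "\<forall>\<^sub>F s in at t. norm (convolve H (pushed X s) (X s x) - convolve H (pushed X t) (X t x))
        \<le> \<Lambda> * norm (X s x - X t x) + \<Lambda> * lipdist (pushed X s) (pushed X t)"
    proof (rule always_eventually, rule allI)
      fix s
      have "norm (convolve H (pushed X s) (X s x) - convolve H (pushed X t) (X t x))
        \<le> norm (convolve H (pushed X s) (X s x) - convolve H (pushed X s) (X t x))
          + norm (convolve H (pushed X s) (X t x) - convolve H (pushed X t) (X t x))"
        by (rule order_trans[OF _ norm_triangle_ineq]) simp
      also have "\<dots> \<le> \<Lambda> * norm (X s x - X t x) + \<Lambda> * lipdist (pushed X s) (pushed X t)"
        using convolve_lip[OF pushed_P1[OF assms]]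
          lipdist_upper_norm[OF pushed_P1[OF assms] pushed_P1[OF assms] H_shift_lip]
        unfolding convolve_def by (intro add_mono) blast+
      finally show "norm (convolve H (pushed X s) (X s x) - convolve H (pushed X t) (X t x))
        \<le> \<Lambda> * norm (X s x - X t x) + \<Lambda> * lipdist (pushed X s) (pushed X t)" .
    qed
    have "((\<lambda>s. X s x) \<longlongrightarrow> X t x) (at t)"
      using admissible_continuous(2)[OF assms] by (simp add: continuous_on_def)
    then have "((\<lambda>s. \<Lambda> * norm (X s x - X t x) + \<Lambda> * lipdist (pushed X s) (pushed X t)) \<longlongrightarrow>
        \<Lambda> * norm (X t x - X t x) + \<Lambda> * 0) (at t)"
      by (intro tendsto_intros pushed_continuous assms)
    then show "((\<lambda>s. \<Lambda> * norm (X s x - X t x) + \<Lambda> * lipdist (pushed X s) (pushed X t)) \<longlongrightarrow> 0) (at t)" by simp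
  qed
  then show ?thesis by (simp add: continuous_at_imp_continuous_on)
qed

lemma flow_vel_bound: "admissible X \<Longrightarrow> norm (flow_vel X s x) \<le> vmax"
  unfolding flow_vel_def by (intro velocity_bound pushed_P1 u_bound)

lemma continuous_on_imp_measurable: "continuous_on {0..T} f \<Longrightarrow> f \<in> borel_measurable (lebesgue_on {0..T})"
  for f :: "real \<Rightarrow> 'a::euclidean_space"
  by (intro continuous_imp_measurable_on_sets_lebesgue) auto

lemma ctrl_measurable:
  assumes "continuous_on {0..T} x" "continuous_on {0..T} y"
  shows "(\<lambda>s. ctrl (u s) (y s) (x s)) \<in> borel_measurable (lebesgue_on {0..T})"
  unfolding ctrl_def
proof (intro borel_measurable_sum borel_measurable_scaleR)
  fix l k
  have "(\<lambda>v::(real^'d)^'m. v $ k $ l / real CARD('m)) \<in> borel_measurable borel"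
    by (intro borel_measurable_continuous_onI continuous_intros) auto
  then show "(\<lambda>s. u s $ k $ l / real CARD('m)) \<in> borel_measurable (lebesgue_on {0..T})"
    by (rule measurable_compose[OF u_meas])
  have "continuous_on {0..T} (\<lambda>s. G l (x s - y s $ k))"
    by (rule continuous_on_compose2[OF lipschitz_on_continuous_on[OF G_lip]])
      (auto intro!: continuous_intros assms)
  then show "(\<lambda>s. G l (x s - y s $ k)) \<in> borel_measurable (lebesgue_on {0..T})" by (rule continuous_on_imp_measurable)
qed

lemma flow_vel_measurable:
  assumes "admissible X" shows "(\<lambda>s. flow_vel X s x) \<in> borel_measurable (lebesgue_on {0..T})"
  unfolding flow_vel_def velocity_eq
  by (intro borel_measurable_add continuous_on_imp_measurable ctrl_measurable Y_continuous
      continuous_on_subset[OF convolve_pushed_continuous[OF assms]] continuous_on_subset[OF admissible_continuous(2)[OF assms]]) auto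

lemma flow_vel_integrable: "admissible X \<Longrightarrow> t \<le> T \<Longrightarrow> 0 \<le> r \<Longrightarrow> (\<lambda>s. flow_vel X s x) integrable_on {r..t}"
  by (rule integrable_bounded_measurable[OF flow_vel_measurable flow_vel_bound])

lemma flow_vel_diff:
  assumes "admissible X" "admissible X'" "\<And>\<xi>. dist (X s \<xi>) (X' s \<xi>) \<le> c"
  shows "norm (flow_vel X s x - flow_vel X' s x) \<le> (\<Lambda> + vlip) * c"
proof -
  note P = pushed_P1[OF assms(1), of s] pushed_P1[OF assms(2), of s]
  have "lipdist (pushed X s) (pushed X' s) \<le> c"
    using lipdist_le_W1[OF P] pushed_W1_le[OF assms] by simp
  then have 1: "norm (velocity H G (u s) (Y s) (pushed X s) (X s x) - velocity H G (u s) (Y s) (pushed X' s) (X s x)) \<le> \<Lambda> * c"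
    using velocity_diff[OF P u_bound, of s "Y s" "X s x" "u s" "Y s"] \<Lambda>_nonneg
    by (simp add: order_trans[OF _ mult_left_mono])
  have "norm (velocity H G (u s) (Y s) (pushed X' s) (X s x) - velocity H G (u s) (Y s) (pushed X' s) (X' s x)) \<le> vlip * dist (X s x) (X' s x)"
    using lipschitz_onD[OF velocity_lip[OF P(2) u_bound]] by (simp add: dist_norm)
  also have "\<dots> \<le> vlip * c" using assms(3) consts_nonneg by (intro mult_left_mono) auto
  finally have 2: "norm (velocity H G (u s) (Y s) (pushed X' s) (X s x) - velocity H G (u s) (Y s) (pushed X' s) (X' s x)) \<le> vlip * c" .
  have "norm (flow_vel X s x - flow_vel X' s x) \<le>
    norm (velocity H G (u s) (Y s) (pushed X s) (X s x) - velocity H G (u s) (Y s) (pushed X' s) (X s x)) +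
    norm (velocity H G (u s) (Y s) (pushed X' s) (X s x) - velocity H G (u s) (Y s) (pushed X' s) (X' s x))"
    unfolding flow_vel_def by (rule order_trans[OF _ norm_triangle_ineq]) simp
  also have "\<dots> \<le> \<Lambda> * c + vlip * c" using 1 2 by (rule add_mono)
  finally show ?thesis by (simp add: distrib_right)
qed

text \<open>
  Displacements are bounded continuous functions on all of \<open>\<real>\<close> in time; outside \<open>[0, T]\<close> they are
  continued by their values at the end points.
\<close>

definition clip :: "real \<Rightarrow> real" where "clip t = max 0 (min t T)"

lemma clip: "0 \<le> clip t" "clip t \<le> T" "t \<in> {0..T} \<Longrightarrow> clip t = t"
  using T by (auto simp: clip_def)

definition displacement :: "(real \<Rightarrow> real^'d \<Rightarrow> real^'d) \<Rightarrow> real \<Rightarrow> real^'d \<Rightarrow> real^'d" where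
  "displacement X t x = integral {0..clip t} (\<lambda>s. flow_vel X s x)"

lemma integral_flow_vel_lip:
  assumes "admissible X" "s \<in> {0..T}" "t \<in> {0..T}"
  shows "norm (integral {0..t} (\<lambda>s. flow_vel X s x) - integral {0..s} (\<lambda>s. flow_vel X s x)) \<le> vmax * \<bar>t - s\<bar>"
  using assms(2,3)
proof (induction s t rule: linorder_wlog)
  case (le s t)
  then have "integral {0..t} (\<lambda>s. flow_vel X s x) - integral {0..s} (\<lambda>s. flow_vel X s x) = integral {s..t} (\<lambda>s. flow_vel X s x)"
    using Henstock_Kurzweil_Integration.integral_combine[of 0 s t "\<lambda>s. flow_vel X s x"] flow_vel_integrable[OF assms(1), of t 0 x]
    by (simp add: algebra_simps)
  then show ?case using norm_integral_le[OF flow_vel_integrable[OF assms(1), of t s x] _ flow_vel_bound[OF assms(1)]] le by simp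
next
  case (sym s t)
  then show ?case by (simp add: norm_minus_commute abs_minus_commute)
qed

lemma displacement_bound: "admissible X \<Longrightarrow> norm (displacement X t x) \<le> vmax * T"
proof -
  assume X: "admissible X"
  have "norm (displacement X t x) \<le> vmax * clip t"
    using integral_flow_vel_lip[OF X, of 0 "clip t" x] clip[of t] T by (simp add: displacement_def)
  also have "\<dots> \<le> vmax * T" using clip consts_nonneg by (intro mult_left_mono)
  finally show ?thesis .
qed

text \<open>
  Continuity in \<open>x\<close> comes from dominated convergence, continuity in time from the bound on the
  velocity.
\<close>

lemma displacement_continuous:
  assumes "admissible X" shows "continuous_on UNIV (\<lambda>(t, x). displacement X t x)"
  unfolding continuous_on_sequentially comp_def
proof (intro allI ballI impI, elim conjE)
  fix p :: "nat \<Rightarrow> real \<times> (real^'d)" and q assume p: "p \<longlonglongrightarrow> q"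
  obtain t x where q: "q = (t, x)" by (cases q)
  define tn where "tn = (\<lambda>n. fst (p n))"
  define xn where "xn = (\<lambda>n. snd (p n))"
  have tn: "tn \<longlonglongrightarrow> t" and xn: "xn \<longlonglongrightarrow> x"
    using tendsto_fst[OF p] tendsto_snd[OF p] by (simp_all add: q tn_def xn_def)
  have lim1: "(\<lambda>n. integral {0..clip t} (\<lambda>s. flow_vel X s (xn n))) \<longlonglongrightarrow> integral {0..clip t} (\<lambda>s. flow_vel X s x)"
  proof (rule dominated_convergence(2)[where h="\<lambda>_. vmax"])
    show "(\<lambda>n. flow_vel X s (xn n)) \<longlonglongrightarrow> flow_vel X s x" for s
    proof -
      have "continuous_on UNIV (flow_vel X s)"
        unfolding flow_vel_def[abs_def]
        by (rule continuous_on_compose2[OF lipschitz_on_continuous_on[OF velocity_lip[OF pushed_P1[OF assms] u_bound]]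
          admissible_continuous(1)[OF assms]]) auto
      from continuous_on_tendsto_compose[OF this xn] show ?thesis by simp
    qed
  qed (use flow_vel_bound[OF assms] flow_vel_integrable[OF assms] clip in auto)
  have lim2: "(\<lambda>n. vmax * \<bar>clip (tn n) - clip t\<bar>) \<longlonglongrightarrow> 0"
  proof -
    have "(\<lambda>n. vmax * \<bar>clip (tn n) - clip t\<bar>) \<longlonglongrightarrow> vmax * \<bar>clip t - clip t\<bar>"
      unfolding clip_def using tn by (intro tendsto_intros)
    then show ?thesis by simp
  qed
  have "(\<lambda>n. displacement X (tn n) (xn n) - integral {0..clip t} (\<lambda>s. flow_vel X s (xn n))) \<longlonglongrightarrow> 0"
    using integral_flow_vel_lip[OF assms, of "clip t" "clip (tn n)" "xn n" for n] clip
    by (intro Lim_null_comparison[OF _ lim2]) (auto simp: displacement_def)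
  from tendsto_add[OF this lim1] have "(\<lambda>n. displacement X (tn n) (xn n)) \<longlonglongrightarrow> displacement X t x"
    by (simp add: displacement_def)
  then show "(\<lambda>n. case p n of (t, x) \<Rightarrow> displacement X t x) \<longlonglongrightarrow> (case q of (t, x) \<Rightarrow> displacement X t x)"
    by (simp add: q tn_def xn_def case_prod_unfold)
qed

text \<open>
  At least twice the Lipschitz constant of the velocity as a function of the flow, so that integration
  of \<open>exp (rate * s)\<close> gains a factor 1/2.
\<close>

definition rate :: real where "rate = 2 * (\<Lambda> + vlip) + 1"

lemma rate_pos: "0 < rate" using \<Lambda>_nonneg consts_nonneg by (simp add: rate_def)

text \<open>
  The weight \<open>exp (rate * t)\<close> replaces the supremum norm by an equivalent norm for which the Picard map
  is a contraction on the whole interval \<open>[0, T]\<close>.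
\<close>

definition candidate :: "(real \<times> (real^'d), real^'d) bcontfun \<Rightarrow> real \<Rightarrow> real^'d \<Rightarrow> real^'d" where
  "candidate Z t x = x + exp (rate * clip t) *\<^sub>R apply_bcontfun Z (t, x)"

lemma admissible_candidate: "admissible (candidate Z)"
  unfolding admissible_def
proof (intro conjI exI allI)
  show "continuous_on UNIV (\<lambda>(s, x). candidate Z s x)"
    unfolding candidate_def clip_def case_prod_unfold by (auto intro!: continuous_intros continuous_on_apply_bcontfun)
  fix s x
  have "norm (candidate Z s x - x) = exp (rate * clip s) * norm (apply_bcontfun Z (s, x))" by (simp add: candidate_def)
  also have "\<dots> \<le> exp (rate * T) * norm Z"
    using clip rate_pos by (intro mult_mono norm_bounded) auto
  finally show "norm (candidate Z s x - x) \<le> exp (rate * T) * norm Z" .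
qed

definition picard :: "(real \<times> (real^'d), real^'d) bcontfun \<Rightarrow> (real \<times> (real^'d), real^'d) bcontfun" where
  "picard Z = Bcontfun (\<lambda>(t, x). exp (- (rate * clip t)) *\<^sub>R displacement (candidate Z) t x)"

lemma picard_apply: "apply_bcontfun (picard Z) (t, x) = exp (- (rate * clip t)) *\<^sub>R displacement (candidate Z) t x"
proof -
  have "(\<lambda>(t, x). exp (- (rate * clip t)) *\<^sub>R displacement (candidate Z) t x) \<in> bcontfun"
  proof (rule bcontfun_normI)
    show "continuous_on UNIV (\<lambda>(t, x). exp (- (rate * clip t)) *\<^sub>R displacement (candidate Z) t x)"
      using displacement_continuous[OF admissible_candidate] unfolding clip_def case_prod_unfold by (intro continuous_intros)
    fix p :: "real \<times> (real^'d)" obtain t x where p: "p = (t, x)" by (cases p)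
    have "norm (exp (- (rate * clip t)) *\<^sub>R displacement (candidate Z) t x) \<le> 1 * (vmax * T)"
      unfolding norm_scaleR using clip rate_pos displacement_bound[OF admissible_candidate] by (intro mult_mono) auto
    then show "norm (case p of (t, x) \<Rightarrow> exp (- (rate * clip t)) *\<^sub>R displacement (candidate Z) t x) \<le> vmax * T" by (simp add: p)
  qed
  from Bcontfun_inverse[OF this] show ?thesis by (simp add: picard_def)
qed

lemma picard_contraction: "dist (picard Z) (picard Z') \<le> 1 / 2 * dist Z Z'"
proof (rule dist_bound)
  fix p :: "real \<times> (real^'d)" obtain t x where p: "p = (t, x)" by (cases p)
  let ?c = "(\<Lambda> + vlip) * dist Z Z'"
  have c0: "0 \<le> ?c" using \<Lambda>_nonneg consts_nonneg by simp
  let ?f = "\<lambda>s. flow_vel (candidate Z) s x - flow_vel (candidate Z') s x"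
  have fi: "?f integrable_on {0..clip t}"
    using flow_vel_integrable[OF admissible_candidate] clip by (intro integrable_diff) auto
  have gI: "((\<lambda>s. ?c * exp (rate * s)) has_integral (?c * (exp (rate * clip t) / rate) - ?c * (exp (rate * 0) / rate))) {0..clip t}"
    using clip rate_pos
    by (intro fundamental_theorem_of_calculus)
      (auto intro!: derivative_eq_intros simp: has_real_derivative_iff_has_vector_derivative[symmetric])
  have "norm (displacement (candidate Z) t x - displacement (candidate Z') t x) = norm (integral {0..clip t} ?f)"
    unfolding displacement_def using flow_vel_integrable[OF admissible_candidate] clip by (subst integral_diff) auto
  also have "\<dots> \<le> integral {0..clip t} (\<lambda>s. ?c * exp (rate * s))"
  proof (rule integral_norm_bound_integral[OF fi])
    show "(\<lambda>s. ?c * exp (rate * s)) integrable_on {0..clip t}" using gI by blast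
    fix s assume s: "s \<in> {0..clip t}"
    have cs: "clip s = s" using s clip(2)[of t] by (intro clip(3)) auto
    have "dist (candidate Z s \<xi>) (candidate Z' s \<xi>) \<le> exp (rate * s) * dist Z Z'" for \<xi>
    proof -
      have "dist (candidate Z s \<xi>) (candidate Z' s \<xi>) = exp (rate * s) * dist (apply_bcontfun Z (s, \<xi>)) (apply_bcontfun Z' (s, \<xi>))"
        by (simp add: candidate_def cs dist_norm scaleR_right_diff_distrib[symmetric])
      also have "\<dots> \<le> exp (rate * s) * dist Z Z'" by (intro mult_left_mono dist_bounded) simp
      finally show ?thesis .
    qed
    from flow_vel_diff[OF admissible_candidate admissible_candidate this, of x]
    show "norm (?f s) \<le> ?c * exp (rate * s)" by (simp add: mult_ac)
  qed
  also have "\<dots> = ?c * (exp (rate * clip t) / rate) - ?c * (exp (rate * 0) / rate)" using gI by (rule integral_unique)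
  also have "\<dots> \<le> ?c * (exp (rate * clip t) / rate)" using c0 rate_pos by simp
  finally have d: "norm (displacement (candidate Z) t x - displacement (candidate Z') t x) \<le> ?c * (exp (rate * clip t) / rate)" .
  have "dist (apply_bcontfun (picard Z) p) (apply_bcontfun (picard Z') p)
      = exp (- (rate * clip t)) * norm (displacement (candidate Z) t x - displacement (candidate Z') t x)"
    by (simp add: p picard_apply dist_norm scaleR_right_diff_distrib[symmetric])
  also have "\<dots> \<le> exp (- (rate * clip t)) * (?c * (exp (rate * clip t) / rate))"
    using d by (intro mult_left_mono) auto
  also have "\<dots> = (exp (- (rate * clip t)) * exp (rate * clip t)) * ?c / rate" by (simp only: times_divide_eq_right mult_ac)
  also have "exp (- (rate * clip t)) * exp (rate * clip t) = 1" by (simp add: exp_minus)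
  also have "1 * ?c / rate \<le> 1 / 2 * dist Z Z'"
  proof -
    have "2 * ?c \<le> rate * dist Z Z'" unfolding rate_def by (simp add: algebra_simps)
    then show ?thesis using rate_pos by (simp add: pos_divide_le_eq mult.commute)
  qed
  finally show "dist (apply_bcontfun (picard Z) p) (apply_bcontfun (picard Z') p) \<le> 1 / 2 * dist Z Z'" .
qed

lemma flow_exists:
  obtains X where "admissible X" "\<And>t x. t \<in> {0..T} \<Longrightarrow> X t x = x + integral {0..t} (\<lambda>s. flow_vel X s x)"
proof -
  obtain Z where Z: "picard Z = Z"
    using banach_fix_type[of "1 / 2" picard] picard_contraction by auto
  have "candidate Z t x = x + integral {0..t} (\<lambda>s. flow_vel (candidate Z) s x)" if "t \<in> {0..T}" for t x
  proof -
    have "candidate Z t x = x + exp (rate * clip t) *\<^sub>R apply_bcontfun (picard Z) (t, x)"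
      by (simp add: candidate_def Z)
    also have "\<dots> = x + displacement (candidate Z) t x" by (simp add: picard_apply exp_minus)
    finally show ?thesis using clip(3)[OF that] by (simp add: displacement_def)
  qed
  with admissible_candidate show thesis by (rule that)
qed


text \<open>
  At a time of differentiability of \<open>Y\<close> every characteristic is differentiable: subtracting from the
  velocity the control field frozen at time \<open>t\<close> leaves a remainder that is continuous at \<open>t\<close>,
  and the integral of the frozen field is a linear function of \<open>Y\<close>.  The exceptional
  times thus do not depend on the starting point \<open>x\<close>.
\<close>

lemma flow_derivative:
  assumes X: "admissible X" and eq: "\<And>t x. t \<in> {0..T} \<Longrightarrow> X t x = x + integral {0..t} (\<lambda>s. flow_vel X s x)"
    and t: "t \<in> {0..T}" and Yt: "(Y has_vector_derivative u t) (at t within {0..T})"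
  shows "((\<lambda>r. X r x) has_vector_derivative flow_vel X t x) (at t within {0..T})"
proof -
  define F where "F = (\<lambda>w. ctrl w (Y t) (X t x))"
  define rem where "rem = (\<lambda>s. flow_vel X s x - F (u s))"
  have linF: "bounded_linear F" unfolding F_def using ctrl_linear linear_conv_bounded_linear by blast
  have Fi: "(\<lambda>s. F (u s)) integrable_on {0..r}" if "r \<le> T" for r
    using integrable_linear[OF u_integrable[OF that order_refl] linF] by (simp add: comp_def)
  have remi: "rem integrable_on {0..r}" if "r \<le> T" for r
    unfolding rem_def using that by (intro integrable_diff flow_vel_integrable X Fi) auto
  have rem_t: "rem t = convolve H (pushed X t) (X t x)"
    by (simp add: rem_def flow_vel_def velocity_eq F_def)
  have "continuous (at t within {0..T}) rem"
    unfolding continuous_within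
  proof (rule LIM_zero_cancel, rule Lim_null_comparison)
    show "\<forall>\<^sub>F s in at t within {0..T}. norm (rem s - rem t) \<le>
        norm (convolve H (pushed X s) (X s x) - convolve H (pushed X t) (X t x))
        + D * (B * (\<Lambda> * (norm (X s x - X t x) + norm (Y s - Y t))))"
    proof (rule always_eventually, rule allI)
      fix s
      have "rem s - rem t = (convolve H (pushed X s) (X s x) - convolve H (pushed X t) (X t x))
          + (ctrl (u s) (Y s) (X s x) - ctrl (u s) (Y t) (X t x))"
        unfolding rem_t by (simp add: rem_def flow_vel_def velocity_eq F_def)
      then have "norm (rem s - rem t) \<le> norm (convolve H (pushed X s) (X s x) - convolve H (pushed X t) (X t x))
          + norm (ctrl (u s) (Y s) (X s x) - ctrl (u s) (Y t) (X t x))"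
        by (simp only: norm_triangle_ineq)
      also have "\<dots> \<le> norm (convolve H (pushed X s) (X s x) - convolve H (pushed X t) (X t x))
        + D * (B * (\<Lambda> * (norm (X s x - X t x) + norm (Y s - Y t))))"
        by (intro add_left_mono ctrl_diff u_bound)
      finally show "norm (rem s - rem t) \<le> norm (convolve H (pushed X s) (X s x) - convolve H (pushed X t) (X t x))
        + D * (B * (\<Lambda> * (norm (X s x - X t x) + norm (Y s - Y t))))" .
    qed
    have 1: "((\<lambda>s. convolve H (pushed X s) (X s x)) \<longlongrightarrow> convolve H (pushed X t) (X t x)) (at t within {0..T})"
      using continuous_on_subset[OF convolve_pushed_continuous[OF X] subset_UNIV, of "{0..T}" x] t by (simp add: continuous_on_def)
    have 2: "((\<lambda>s. X s x) \<longlongrightarrow> X t x) (at t within {0..T})"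
      using continuous_on_subset[OF admissible_continuous(2)[OF X] subset_UNIV, of "{0..T}" x] t by (simp add: continuous_on_def)
    have 3: "(Y \<longlongrightarrow> Y t) (at t within {0..T})" using Y_continuous t by (simp add: continuous_on_def)
    have "((\<lambda>s. norm (convolve H (pushed X s) (X s x) - convolve H (pushed X t) (X t x))
        + D * (B * (\<Lambda> * (norm (X s x - X t x) + norm (Y s - Y t))))) \<longlongrightarrow>
        norm (convolve H (pushed X t) (X t x) - convolve H (pushed X t) (X t x))
        + D * (B * (\<Lambda> * (norm (X t x - X t x) + norm (Y t - Y t))))) (at t within {0..T})"
      by (intro tendsto_intros 1 2 3)
    then show "((\<lambda>s. norm (convolve H (pushed X s) (X s x) - convolve H (pushed X t) (X t x))
        + D * (B * (\<Lambda> * (norm (X s x - X t x) + norm (Y s - Y t))))) \<longlongrightarrow> 0) (at t within {0..T})" by simp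
  qed
  then have remd: "((\<lambda>r. integral {0..r} rem) has_vector_derivative rem t) (at t within {0..T})"
    using integral_has_vector_derivative_continuous_at[of rem 0 T t "{}"] remi[OF order_refl] t by simp
  have "((\<lambda>r. F (Y r - Y0)) has_vector_derivative F (u t)) (at t within {0..T})"
    using bounded_linear.has_vector_derivative[OF linF has_vector_derivative_diff[OF Yt has_vector_derivative_const[of Y0]]] by simp
  from has_vector_derivative_add[OF has_vector_derivative_add[OF remd this] has_vector_derivative_const[of x]]
  have d: "((\<lambda>r. (integral {0..r} rem + F (Y r - Y0)) + x) has_vector_derivative flow_vel X t x) (at t within {0..T})"
    by (simp add: rem_def)
  show ?thesis
  proof (rule has_vector_derivative_transform[OF t _ d])
    fix r assume r: "r \<in> {0..T}"
    have "F (Y r - Y0) = integral {0..r} (\<lambda>s. F (u s))"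
      using integral_linear[OF u_integrable[of r 0] linF] r by (simp add: Y_def comp_def)
    then have "integral {0..r} rem + F (Y r - Y0) = integral {0..r} (\<lambda>s. rem s + F (u s))"
      using r by (subst integral_add) (auto intro!: remi Fi)
    then show "X r x = (integral {0..r} rem + F (Y r - Y0)) + x"
      using eq[OF r] by (simp add: rem_def add.commute)
  qed
qed

lemma flow_lipschitz:
  assumes X: "admissible X" and eq: "\<And>t x. t \<in> {0..T} \<Longrightarrow> X t x = x + integral {0..t} (\<lambda>s. flow_vel X s x)"
    and st: "s \<in> {0..T}" "t \<in> {0..T}"
  shows "norm (X t x - X s x) \<le> vmax * norm (t - s)"
  using integral_flow_vel_lip[OF X st, of x] eq[OF st(1)] eq[OF st(2)] by simp

lemma flow_caratheodory:
  assumes X: "admissible X" and eq: "\<And>t x. t \<in> {0..T} \<Longrightarrow> X t x = x + integral {0..t} (\<lambda>s. flow_vel X s x)"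
  shows "caratheodory T (\<lambda>t. X t x) (\<lambda>t. flow_vel X t x)"
  unfolding caratheodory_def
proof
  show "abs_continuous_on 0 T (\<lambda>t. X t x)"
    by (rule abs_continuous_on_lipschitz[OF _ consts_nonneg(2) abs_continuous_on_id]) (rule flow_lipschitz[OF X eq])
  have "AE t in lebesgue_on {0..T}. (Y has_vector_derivative u t) (at t within {0..T})"
    using Y_caratheodory by (simp add: caratheodory_def)
  then show "AE t in lebesgue_on {0..T}. ((\<lambda>t. X t x) has_vector_derivative flow_vel X t x) (at t within {0..T})"
    using AE_space by eventually_elim (auto intro!: flow_derivative[OF X eq])
qed

text \<open>
  Since the exceptional times are common to all characteristics, one may differentiate under the
  integral over the starting points by dominated convergence.
\<close>

lemma flow_weak_form:
  assumes X: "admissible X" and eq: "\<And>t x. t \<in> {0..T} \<Longrightarrow> X t x = x + integral {0..t} (\<lambda>s. flow_vel X s x)"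
    and \<phi>: "\<phi> \<in> test_functions"
  shows "caratheodory T (\<lambda>t. \<integral>x. \<phi> x \<partial>pushed X t)
        (\<lambda>t. \<integral>x. gradient \<phi> x \<bullet> velocity H G (u t) (Y t) (pushed X t) x \<partial>pushed X t)"
proof -
  obtain C where C: "C-lipschitz_on UNIV \<phi>" using test_lipschitz[OF \<phi>] by metis
  note C0 = lipschitz_on_nonneg[OF C]
  obtain K where K: "K-lipschitz_on UNIV (gradient \<phi>)" using test_gradient_lipschitz[OF \<phi>] by metis
  have int_\<phi>: "(\<integral>x. \<phi> x \<partial>pushed X t) = (\<integral>\<xi>. \<phi> (X t \<xi>) \<partial>\<mu>0)" for t
    unfolding pushed_def by (rule integral_distr[OF admissible_measurable[OF X] lipschitz_measurable[OF C]])
  have g1: "norm (gradient \<phi> x) \<le> C" for x by (rule norm_gradient_le[OF \<phi> C])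
  have int_v: "(\<integral>x. gradient \<phi> x \<bullet> velocity H G (u t) (Y t) (pushed X t) x \<partial>pushed X t)
      = (\<integral>\<xi>. gradient \<phi> (X t \<xi>) \<bullet> flow_vel X t \<xi> \<partial>\<mu>0)" for t
  proof -
    note l = inner_lipschitz[OF K g1 velocity_lip[OF pushed_P1[OF X] u_bound] velocity_bound[OF pushed_P1[OF X] u_bound]]
    have "(\<integral>x. gradient \<phi> x \<bullet> velocity H G (u t) (Y t) (pushed X t) x \<partial>distr \<mu>0 borel (X t))
      = (\<integral>\<xi>. gradient \<phi> (X t \<xi>) \<bullet> velocity H G (u t) (Y t) (pushed X t) (X t \<xi>) \<partial>\<mu>0)"
      by (rule integral_distr[OF admissible_measurable[OF X] lipschitz_measurable[OF l]])
    then show ?thesis by (simp add: flow_vel_def pushed_def)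
  qed
  have lip\<phi>: "\<bar>\<phi> (X t \<xi>) - \<phi> (X s \<xi>)\<bar> \<le> C * (vmax * \<bar>t - s\<bar>)" if "s \<in> {0..T}" "t \<in> {0..T}" for s t \<xi>
  proof -
    have "\<bar>\<phi> (X t \<xi>) - \<phi> (X s \<xi>)\<bar> \<le> C * norm (X t \<xi> - X s \<xi>)"
      using lipschitz_onD[OF C, of "X t \<xi>" "X s \<xi>"] by (simp add: dist_norm)
    also have "\<dots> \<le> C * (vmax * \<bar>t - s\<bar>)"
      using flow_lipschitz[OF X eq that] C0 by (intro mult_left_mono) auto
    finally show ?thesis .
  qed
  have i\<phi>: "integrable \<mu>0 (\<lambda>\<xi>. \<phi> (X t \<xi>))" for t
    using P1_lipschitz_integrable[OF pushed_P1[OF X] C, of t]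
    unfolding pushed_def integrable_distr_eq[OF admissible_measurable[OF X] lipschitz_measurable[OF C]] .
  show ?thesis
    unfolding caratheodory_def int_\<phi> int_v
  proof
    show "abs_continuous_on 0 T (\<lambda>t. \<integral>\<xi>. \<phi> (X t \<xi>) \<partial>\<mu>0)"
    proof (rule abs_continuous_on_lipschitz[OF _ _ abs_continuous_on_id])
      show "0 \<le> C * vmax" using C0 consts_nonneg by simp
      fix s t assume st: "s \<in> {0..T}" "t \<in> {0..T}"
      show "norm ((\<integral>\<xi>. \<phi> (X t \<xi>) \<partial>\<mu>0) - (\<integral>\<xi>. \<phi> (X s \<xi>) \<partial>\<mu>0)) \<le> C * vmax * norm (t - s)"
        using M0.norm_integral_diff_le[OF i\<phi> i\<phi>, of t s "C * vmax * norm (t - s)"] lip\<phi>[OF st] by (simp add: mult.assoc)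
    qed
    have der: "((\<lambda>t. \<integral>\<xi>. \<phi> (X t \<xi>) \<partial>\<mu>0) has_vector_derivative (\<integral>\<xi>. gradient \<phi> (X t \<xi>) \<bullet> flow_vel X t \<xi> \<partial>\<mu>0)) (at t within {0..T})"
      if t: "t \<in> {0..T}" and Yt: "(Y has_vector_derivative u t) (at t within {0..T})" for t
    proof -
      have pt: "((\<lambda>r. (\<phi> (X r \<xi>) - \<phi> (X t \<xi>)) / (r - t)) \<longlongrightarrow> gradient \<phi> (X t \<xi>) \<bullet> flow_vel X t \<xi>) (at t within {0..T})" for \<xi>
      proof -
        have "((\<lambda>r. \<phi> (X r \<xi>)) has_derivative (\<lambda>h. gradient \<phi> (X t \<xi>) \<bullet> (h *\<^sub>R flow_vel X t \<xi>))) (at t within {0..T})"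
          by (rule has_derivative_compose[OF flow_derivative[OF X eq t Yt, of \<xi>, unfolded has_vector_derivative_def] test_functionsD(5)[OF \<phi>]])
        then have "((\<lambda>r. \<phi> (X r \<xi>)) has_real_derivative gradient \<phi> (X t \<xi>) \<bullet> flow_vel X t \<xi>) (at t within {0..T})"
          by (simp add: has_field_derivative_def mult_commute_abs)
        then show ?thesis by (simp add: has_field_derivative_iff)
      qed
      have "((\<lambda>r. ((\<integral>\<xi>. \<phi> (X r \<xi>) \<partial>\<mu>0) - (\<integral>\<xi>. \<phi> (X t \<xi>) \<partial>\<mu>0)) / (r - t)) \<longlongrightarrow> (\<integral>\<xi>. gradient \<phi> (X t \<xi>) \<bullet> flow_vel X t \<xi> \<partial>\<mu>0)) (at t within {0..T})"
        unfolding tendsto_at_iff_sequentially comp_def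
      proof (intro allI impI)
        fix r :: "nat \<Rightarrow> real" assume r: "\<forall>n. r n \<in> {0..T} - {t}" "r \<longlonglongrightarrow> t"
        have "(\<lambda>n. \<integral>\<xi>. (\<phi> (X (r n) \<xi>) - \<phi> (X t \<xi>)) / (r n - t) \<partial>\<mu>0) \<longlonglongrightarrow> (\<integral>\<xi>. gradient \<phi> (X t \<xi>) \<bullet> flow_vel X t \<xi> \<partial>\<mu>0)"
        proof (rule integral_dominated_convergence[where w="\<lambda>_. C * vmax"])
          have lim: "(\<lambda>n. (\<phi> (X (r n) \<xi>) - \<phi> (X t \<xi>)) / (r n - t)) \<longlonglongrightarrow> gradient \<phi> (X t \<xi>) \<bullet> flow_vel X t \<xi>" for \<xi>
            using pt[of \<xi>] r unfolding tendsto_at_iff_sequentially comp_def by blast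
          then show "AE \<xi> in \<mu>0. (\<lambda>n. (\<phi> (X (r n) \<xi>) - \<phi> (X t \<xi>)) / (r n - t)) \<longlonglongrightarrow> gradient \<phi> (X t \<xi>) \<bullet> flow_vel X t \<xi>"
            by simp
          show m: "(\<lambda>\<xi>. (\<phi> (X (r n) \<xi>) - \<phi> (X t \<xi>)) / (r n - t)) \<in> borel_measurable \<mu>0" for n
            using i\<phi> by (intro borel_measurable_divide borel_measurable_diff borel_measurable_integrable borel_measurable_const)
          show "(\<lambda>\<xi>. gradient \<phi> (X t \<xi>) \<bullet> flow_vel X t \<xi>) \<in> borel_measurable \<mu>0"
            by (rule borel_measurable_LIMSEQ_real[OF lim m])
          show "AE \<xi> in \<mu>0. norm ((\<phi> (X (r n) \<xi>) - \<phi> (X t \<xi>)) / (r n - t)) \<le> C * vmax" for n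
          proof (rule AE_I2)
            fix \<xi>
            have "\<bar>r n - t\<bar> > 0" using r(1) by auto
            then show "norm ((\<phi> (X (r n) \<xi>) - \<phi> (X t \<xi>)) / (r n - t)) \<le> C * vmax"
              using lip\<phi>[OF t, of "r n" \<xi>] r(1) by (simp add: pos_divide_le_eq mult.assoc)
          qed
        qed simp
        then show "(\<lambda>n. ((\<integral>\<xi>. \<phi> (X (r n) \<xi>) \<partial>\<mu>0) - (\<integral>\<xi>. \<phi> (X t \<xi>) \<partial>\<mu>0)) / (r n - t)) \<longlonglongrightarrow> (\<integral>\<xi>. gradient \<phi> (X t \<xi>) \<bullet> flow_vel X t \<xi> \<partial>\<mu>0)"
          using i\<phi> by simp
      qed
      then show ?thesis
        by (simp add: has_real_derivative_iff_has_vector_derivative[symmetric] has_field_derivative_iff)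
    qed
    have "AE t in lebesgue_on {0..T}. (Y has_vector_derivative u t) (at t within {0..T})"
      using Y_caratheodory by (simp add: caratheodory_def)
    then show "AE t in lebesgue_on {0..T}. ((\<lambda>t. \<integral>\<xi>. \<phi> (X t \<xi>) \<partial>\<mu>0) has_vector_derivative
        (\<integral>\<xi>. gradient \<phi> (X t \<xi>) \<bullet> flow_vel X t \<xi> \<partial>\<mu>0)) (at t within {0..T})"
      using AE_space by eventually_elim (auto intro!: der)
  qed
qed

end

section \<open>Locally Lipschitz velocity fields\<close>

text \<open>
  The field is evaluated at the projection of the point onto a ball, which turns a locally Lipschitz
  field into a globally Lipschitz one with the same bound.
\<close>

definition trunc :: "real \<Rightarrow> ('a::euclidean_space \<Rightarrow> 'b) \<Rightarrow> 'a \<Rightarrow> 'b" where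
  "trunc r F x = F (closest_point (cball 0 r) x)"

lemma trunc_eq: "norm x \<le> r \<Longrightarrow> trunc r F x = F x"
  by (simp add: trunc_def closest_point_self)

lemma trunc_lipschitz:
  fixes F :: "'a::euclidean_space \<Rightarrow> 'b::euclidean_space"
  assumes "local_lipschitz (UNIV::real set) UNIV (\<lambda>_. F)" "0 \<le> r"
  obtains K where "K-lipschitz_on UNIV (trunc r F)"
proof -
  have "local_lipschitz {0::real} (cball 0 r) (\<lambda>_. F)"
    by (rule local_lipschitz_subset[OF assms(1)]) auto
  then obtain K where K: "K-lipschitz_on (cball 0 r) F"
    using local_lipschitz_compact_implies_lipschitz[of "{0::real}" "cball 0 r" "\<lambda>_. F"] by auto
  have "closest_point (cball 0 r) ` (UNIV :: 'a set) \<subseteq> cball 0 r"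
    using assms(2) by (auto intro!: closest_point_in_set simp del: mem_cball)
  then have "(K * 1)-lipschitz_on UNIV (\<lambda>x. F (closest_point (cball 0 r) x))"
    by (intro lipschitz_on_compose2[OF closest_point_cball[OF assms(2)] lipschitz_on_subset[OF K]])
  then show thesis by (intro that[of K]) (simp add: trunc_def[abs_def])
qed

locale bounded_field =
  fixes H :: "real^'d \<Rightarrow> real^'d" and G :: "'d \<Rightarrow> real^'d \<Rightarrow> real^'d" and M B T :: real
  assumes H_loc: "local_lipschitz (UNIV::real set) UNIV (\<lambda>_. H)"
    and G_loc: "\<And>l. local_lipschitz (UNIV::real set) UNIV (\<lambda>_. G l)"
    and H_bd: "\<And>x. norm (H x) \<le> M" and G_bd: "\<And>l x. norm (G l x) \<le> M"
    and B_nonneg: "0 \<le> B" and T_pos: "0 < T"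
begin

lemma trunc_field:
  assumes "0 \<le> r" obtains \<Lambda> where "lipschitz_field (trunc r H) (\<lambda>l. trunc r (G l)) \<Lambda> M B"
proof -
  obtain K where K: "K-lipschitz_on UNIV (trunc r H)" using trunc_lipschitz[OF H_loc assms] by metis
  have "\<exists>K. K-lipschitz_on UNIV (trunc r (G l))" for l using trunc_lipschitz[OF G_loc assms, of l] by metis
  then obtain KG where KG: "\<And>l. (KG l)-lipschitz_on UNIV (trunc r (G l))" by metis
  define \<Lambda> where "\<Lambda> = K + (\<Sum>l\<in>UNIV. KG l)"
  have pos: "0 \<le> K" "\<And>l. 0 \<le> KG l" using lipschitz_on_nonneg K KG by blast+
  have "KG l \<le> \<Lambda>" for l
    using member_le_sum[of l UNIV KG] pos by (simp add: \<Lambda>_def add_increasing)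
  moreover have "K \<le> \<Lambda>" using pos by (simp add: \<Lambda>_def sum_nonneg)
  ultimately have "lipschitz_field (trunc r H) (\<lambda>l. trunc r (G l)) \<Lambda> M B"
    using H_bd G_bd B_nonneg by unfold_locales (auto simp: trunc_def[abs_def] intro: lipschitz_on_le K[unfolded trunc_def[abs_def]] KG[unfolded trunc_def[abs_def]])
  then show thesis by (rule that)
qed

lemma H_measurable: "(\<lambda>\<xi>. H (x - \<xi>)) \<in> borel_measurable borel"
proof -
  have "continuous_on UNIV H" using local_lipschitz_continuous_on[OF H_loc, of 0] by simp
  then have "continuous_on UNIV (\<lambda>\<xi>. H (x - \<xi>))"
    by (rule continuous_on_compose2) (auto intro!: continuous_intros)
  then show ?thesis by (rule borel_measurable_continuous_onI)
qed

text \<open>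
  Inside the ball that contains the states all differences \<open>x - \<xi>\<close> and \<open>x - Y\<^sub>k\<close> have norm at most \<open>r\<close>.
\<close>

lemma velocity_trunc:
  fixes Y :: "(real^'d)^'m"
  assumes \<mu>: "\<mu> \<in> P1" "AE \<xi> in \<mu>. norm \<xi> \<le> R" and x: "norm x \<le> R" and Y: "norm Y \<le> S"
    and r: "2 * R \<le> r" "R + S \<le> r"
  shows "velocity (trunc r H) (\<lambda>l. trunc r (G l)) u Y \<mu> x = velocity H G u Y \<mu> x"
proof -
  have "0 \<le> r" using r x norm_ge_zero[of x] by linarith
  then obtain K where K: "K-lipschitz_on UNIV (trunc r H)" using trunc_lipschitz[OF H_loc] by metis
  have t: "trunc r F (x - y) = F (x - y)" if "norm x + norm y \<le> r" for F :: "real^'d \<Rightarrow> real^'d" and y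
    using that norm_triangle_ineq4[of x y] by (intro trunc_eq) linarith
  have "convolve (trunc r H) \<mu> x = convolve H \<mu> x"
    unfolding convolve_def
  proof (rule integral_cong_AE)
    show "AE \<xi> in \<mu>. trunc r H (x - \<xi>) = H (x - \<xi>)"
      using \<mu>(2) by eventually_elim (use x r in \<open>auto intro!: t\<close>)
    have "(K * 1)-lipschitz_on UNIV (\<lambda>\<xi>. trunc r H (x - \<xi>))"
      by (rule lipschitz_on_compose2[OF _ lipschitz_on_subset[OF K subset_UNIV]])
        (auto intro!: lipschitz_onI simp: dist_norm norm_minus_commute)
    then show "(\<lambda>\<xi>. trunc r H (x - \<xi>)) \<in> borel_measurable \<mu>"
      by (intro P1_measurable[OF \<mu>(1)] lipschitz_measurable)
  qed (rule P1_measurable[OF \<mu>(1) H_measurable])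
  moreover have "trunc r (G l) (x - Y $ k) = G l (x - Y $ k)" for l k
    using x r Y Finite_Cartesian_Product.norm_nth_le[of Y k] by (intro t) linarith
  ultimately show ?thesis by (simp add: velocity_def convolve_atomic_def)
qed

lemma velocity_continuous:
  fixes Y :: "(real^'d)^'m"
  assumes \<mu>: "\<mu> \<in> P1" shows "continuous_on UNIV (velocity H G u Y \<mu>)"
proof -
  interpret prob_space \<mu> using P1_D(1)[OF \<mu>] .
  have cH: "continuous_on UNIV H" using local_lipschitz_continuous_on[OF H_loc, of 0] by simp
  have "continuous_on UNIV (convolve H \<mu>)"
    unfolding continuous_on_sequentially comp_def convolve_def
  proof (intro allI ballI impI, elim conjE)
    fix z :: "nat \<Rightarrow> real^'d" and x assume z: "z \<longlonglongrightarrow> x"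
    show "(\<lambda>n. \<integral>\<xi>. H (z n - \<xi>) \<partial>\<mu>) \<longlonglongrightarrow> (\<integral>\<xi>. H (x - \<xi>) \<partial>\<mu>)"
    proof (rule integral_dominated_convergence[where w="\<lambda>_. M"])
      show "AE \<xi> in \<mu>. (\<lambda>n. H (z n - \<xi>)) \<longlonglongrightarrow> H (x - \<xi>)"
        using continuous_on_tendsto_compose[OF cH tendsto_diff[OF z tendsto_const]] by auto
    qed (use H_bd P1_measurable[OF \<mu> H_measurable] in auto)
  qed
  moreover have "continuous_on UNIV (convolve_atomic (G l) (\<lambda>k. (u $ k $ l) / real CARD('m)) (\<lambda>k. Y $ k))" for l
  proof -
    have cG: "continuous_on UNIV (G l)" using local_lipschitz_continuous_on[OF G_loc, of 0] by simp
    show ?thesis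
      unfolding convolve_atomic_def[abs_def]
      by (intro continuous_on_sum continuous_on_scaleR continuous_on_const continuous_on_compose2[OF cG])
        (auto intro!: continuous_intros)
  qed
  ultimately show ?thesis unfolding velocity_def[abs_def] by (intro continuous_on_add continuous_on_sum)
qed

lemma weak_form_measurable:
  assumes "\<mu> \<in> P1" "\<phi> \<in> test_functions"
  shows "(\<lambda>x. gradient \<phi> x \<bullet> velocity H G u Y \<mu> x) \<in> borel_measurable borel"
proof -
  obtain K where K: "K-lipschitz_on UNIV (gradient \<phi>)" using test_gradient_lipschitz[OF assms(2)] by metis
  show ?thesis
    by (intro borel_measurable_continuous_onI continuous_on_inner velocity_continuous[OF assms(1)] lipschitz_on_continuous_on[OF K])
qed

lemma weak_form_trunc:
  fixes Y :: "(real^'d)^'m"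
  assumes \<mu>: "\<mu> \<in> P1" "AE \<xi> in \<mu>. norm \<xi> \<le> R" and Y: "norm Y \<le> S"
    and r: "2 * R \<le> r" "R + S \<le> r" and \<phi>: "\<phi> \<in> test_functions"
  shows "(\<integral>x. gradient \<phi> x \<bullet> velocity H G u Y \<mu> x \<partial>\<mu>)
    = (\<integral>x. gradient \<phi> x \<bullet> velocity (trunc r H) (\<lambda>l. trunc r (G l)) u Y \<mu> x \<partial>\<mu>)"
proof (rule integral_cong_AE)
  interpret prob_space \<mu> using P1_D(1)[OF \<mu>(1)] .
  have "0 \<le> R"
  proof (rule ccontr)
    assume neg: "\<not> 0 \<le> R"
    have "AE \<xi> in \<mu>. False"
      using \<mu>(2) by eventually_elim (use neg norm_ge_zero order_trans in blast)
    then show False by (simp add: AE_False)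
  qed
  then have "0 \<le> r" using r by simp
  then obtain \<Lambda> where "lipschitz_field (trunc r H) (\<lambda>l. trunc r (G l)) \<Lambda> M (max B (norm u))"
  proof -
    interpret bf: bounded_field H G M "max B (norm u)" T
      using H_loc G_loc H_bd G_bd B_nonneg T_pos by unfold_locales auto
    show thesis using bf.trunc_field[OF \<open>0 \<le> r\<close>] that by blast
  qed
  then interpret F: lipschitz_field "trunc r H" "\<lambda>l. trunc r (G l)" \<Lambda> M "max B (norm u)" .
  obtain K where K: "K-lipschitz_on UNIV (gradient \<phi>)" using test_gradient_lipschitz[OF \<phi>] by metis
  show "(\<lambda>x. gradient \<phi> x \<bullet> velocity H G u Y \<mu> x) \<in> borel_measurable \<mu>"
    by (rule P1_measurable[OF \<mu>(1) weak_form_measurable[OF \<mu>(1) \<phi>]])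
  have "continuous_on UNIV (velocity (trunc r H) (\<lambda>l. trunc r (G l)) u Y \<mu>)"
    by (rule lipschitz_on_continuous_on[OF F.velocity_lip[OF \<mu>(1)]]) simp
  then show "(\<lambda>x. gradient \<phi> x \<bullet> velocity (trunc r H) (\<lambda>l. trunc r (G l)) u Y \<mu> x) \<in> borel_measurable \<mu>"
    by (intro P1_measurable[OF \<mu>(1)] borel_measurable_continuous_onI continuous_on_inner lipschitz_on_continuous_on[OF K])
  show "AE x in \<mu>. gradient \<phi> x \<bullet> velocity H G u Y \<mu> x
      = gradient \<phi> x \<bullet> velocity (trunc r H) (\<lambda>l. trunc r (G l)) u Y \<mu> x"
    using \<mu>(2) by eventually_elim (simp add: velocity_trunc[OF \<mu> _ Y r])
qed

lemma pde_solution_lipdist_continuous: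
  assumes sol: "pde_solution T H G Y0 \<mu>0 u Y \<mu>" and t: "t \<in> {0..T}"
  shows "((\<lambda>s. lipdist (\<mu> s) (\<mu> t)) \<longlongrightarrow> 0) (at t within {0..T})"
proof (rule Lim_null_comparison)
  have P: "\<And>t. t \<in> {0..T} \<Longrightarrow> \<mu> t \<in> P1" using sol unfolding pde_solution_def by auto
  show "((\<lambda>s. chi_dist (Y s, \<mu> s) (Y t, \<mu> t)) \<longlongrightarrow> 0) (at t within {0..T})"
    using sol t unfolding pde_solution_def by auto
  show "\<forall>\<^sub>F s in at t within {0..T}. norm (lipdist (\<mu> s) (\<mu> t)) \<le> chi_dist (Y s, \<mu> s) (Y t, \<mu> t)"
    unfolding eventually_at_filter
  proof (intro always_eventually allI impI)
    fix s assume "s \<in> {0..T}"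
    then show "norm (lipdist (\<mu> s) (\<mu> t)) \<le> chi_dist (Y s, \<mu> s) (Y t, \<mu> t)"
      using lipdist_nonneg[OF P P, of s t] lipdist_le_W1[OF P P, of s t] t W1_le_chi_dist[of "\<mu> s" "\<mu> t" "Y s" "Y t"] by simp
  qed
qed

lemma pde_solution_weak:
  fixes u :: "real \<Rightarrow> (real^'d)^'m"
  assumes sol: "pde_solution T H G Y0 \<mu>0 u Y \<mu>" and u': "AE t in lebesgue_on {0..T}. u t = u' t" "\<And>t. norm (u' t) \<le> B"
    and R: "\<And>t. t \<in> {0..T} \<Longrightarrow> AE x in \<mu> t. norm x \<le> R" and S: "\<And>t. t \<in> {0..T} \<Longrightarrow> norm (Y t) \<le> S"
    and r: "2 * R \<le> r" "R + S \<le> r"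
  shows "weak_solution T (trunc r H) (\<lambda>l. trunc r (G l)) B R u' Y \<mu>"
  unfolding weak_solution_def
proof (intro conjI allI ballI)
  have P: "\<And>t. t \<in> {0..T} \<Longrightarrow> \<mu> t \<in> P1" using sol unfolding pde_solution_def by auto
  show "norm (u' t) \<le> B" for t by fact
  show "\<mu> t \<in> P1" "AE x in \<mu> t. norm x \<le> R" if "t \<in> {0..T}" for t using P R that by auto
  show "((\<lambda>s. lipdist (\<mu> s) (\<mu> t)) \<longlongrightarrow> 0) (at t within {0..T})" if "t \<in> {0..T}" for t
    by (rule pde_solution_lipdist_continuous[OF sol that])
  show "caratheodory T Y u'"
    using sol u'(1) unfolding pde_solution_def by (auto intro: caratheodory_cong)
  fix \<phi> :: "real^'d \<Rightarrow> real" assume \<phi>: "\<phi> \<in> test_functions"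
  have "caratheodory T (\<lambda>t. \<integral>x. \<phi> x \<partial>\<mu> t) (\<lambda>t. \<integral>x. gradient \<phi> x \<bullet> velocity H G (u t) (Y t) (\<mu> t) x \<partial>\<mu> t)"
    using sol \<phi> unfolding pde_solution_def by auto
  then show "caratheodory T (\<lambda>t. \<integral>x. \<phi> x \<partial>\<mu> t)
    (\<lambda>t. \<integral>x. gradient \<phi> x \<bullet> velocity (trunc r H) (\<lambda>l. trunc r (G l)) (u' t) (Y t) (\<mu> t) x \<partial>\<mu> t)"
  proof (rule caratheodory_cong)
    show "AE t in lebesgue_on {0..T}. (\<integral>x. gradient \<phi> x \<bullet> velocity H G (u t) (Y t) (\<mu> t) x \<partial>\<mu> t)
      = (\<integral>x. gradient \<phi> x \<bullet> velocity (trunc r H) (\<lambda>l. trunc r (G l)) (u' t) (Y t) (\<mu> t) x \<partial>\<mu> t)"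
      using u'(1) AE_space
    proof eventually_elim
      case (elim t)
      then have t: "t \<in> {0..T}" by simp
      show ?case unfolding elim(1) by (rule weak_form_trunc[OF P[OF t] R[OF t] S[OF t] r \<phi>])
    qed
  qed
qed


end

section \<open>Empirical measures and particle systems\<close>

lemma prob_space_uniform_count_measure: "1 \<le> N \<Longrightarrow> prob_space (uniform_count_measure {..<N::nat})"
  by (rule prob_space_uniform_count_measure) (auto simp: lessThan_empty_iff)

lemma measurable_uniform_count_measure: "f \<in> borel_measurable (uniform_count_measure A)"
  by (simp add: measurable_def space_uniform_count_measure sets_uniform_count_measure)

lemma empirical_P1:
  fixes X :: "nat \<Rightarrow> 'a::euclidean_space"
  assumes "1 \<le> N" shows "empirical N X \<in> P1"
  unfolding empirical_def
proof (rule P1_distr[OF prob_space_uniform_count_measure[OF assms] measurable_uniform_count_measure])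
  interpret prob_space "uniform_count_measure {..<N}" by (rule prob_space_uniform_count_measure[OF assms])
  show "integrable (uniform_count_measure {..<N}) (\<lambda>x. norm (X x))"
    by (rule integrable_const_bound[of _ "\<Sum>i<N. norm (X i)"])
      (auto intro!: AE_I2 measurable_uniform_count_measure member_le_sum simp: space_uniform_count_measure)
qed

lemma empirical_integral:
  fixes X :: "nat \<Rightarrow> 'a::euclidean_space" and f :: "'a \<Rightarrow> real"
  assumes "f \<in> borel_measurable borel"
  shows "(\<integral>x. f x \<partial>empirical N X) = (\<Sum>i<N. f (X i)) / real N"
  unfolding empirical_def by (simp add: integral_distr[OF measurable_uniform_count_measure assms] integral_uniform_count_measure)

lemma empirical_AE:
  fixes X :: "nat \<Rightarrow> 'a::euclidean_space"
  assumes "\<forall>i<N. norm (X i) \<le> R" shows "AE x in empirical N X. norm x \<le> R"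
  unfolding empirical_def using assms
  by (subst AE_distr_iff[OF measurable_uniform_count_measure]) (auto intro!: AE_I2 simp: space_uniform_count_measure)

lemma empirical_AE_D:
  fixes X :: "nat \<Rightarrow> 'a::euclidean_space"
  assumes ae: "AE x in empirical N X. norm x \<le> R" and i: "i < N" shows "norm (X i) \<le> R"
proof (rule ccontr)
  assume neg: "\<not> norm (X i) \<le> R"
  have "AE i in uniform_count_measure {..<N}. norm (X i) \<le> R"
    using ae unfolding empirical_def by (subst (asm) AE_distr_iff[OF measurable_uniform_count_measure]) auto
  then have "emeasure (uniform_count_measure {..<N}) {j\<in>{..<N}. \<not> norm (X j) \<le> R} = 0"
    by (subst (asm) AE_iff_measurable[OF _ refl]) (auto simp: space_uniform_count_measure sets_uniform_count_measure)
  then have "card {j\<in>{..<N}. \<not> norm (X j) \<le> R} = 0"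
    using i by (subst (asm) emeasure_uniform_count_measure) auto
  then show False using neg i by auto
qed

lemma W1_empirical_le: "1 \<le> N \<Longrightarrow> W1 (empirical N X) (empirical N X') \<le> (\<Sum>i<N. dist (X i) (X' i)) / real N"
  unfolding empirical_def using W1_distr_le[OF prob_space_uniform_count_measure measurable_uniform_count_measure measurable_uniform_count_measure, of N X X']
  by (simp add: integral_uniform_count_measure)

context bounded_field begin

text \<open>
  The integral of a test function against the empirical measure is a finite mean of compositions with
  trajectories, to which the chain rule applies at almost every time.
\<close>

lemma particle_solution_pde:
  fixes u :: "real \<Rightarrow> (real^'d)^'m"
  assumes sol: "particle_solution T H G N Y0 X0 u Y X" and N: "1 \<le> N"
  shows "pde_solution T H G Y0 (empirical N X0) u Y (\<lambda>t. empirical N (\<lambda>i. X i t))"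
proof -
  have Y: "Y 0 = Y0" "caratheodory T Y u" and X0: "\<And>i. i < N \<Longrightarrow> X i 0 = X0 i"
    and X: "\<And>i. i < N \<Longrightarrow> caratheodory T (X i) (\<lambda>t. velocity H G (u t) (Y t) (empirical N (\<lambda>j. X j t)) (X i t))"
    using sol unfolding particle_solution_def by auto
  have Xc: "continuous_on {0..T} (X i)" if "i < N" for i
    using caratheodory_continuous[OF X[OF that]] T_pos by simp
  have Yc: "continuous_on {0..T} Y" using caratheodory_continuous[OF Y(2)] T_pos by simp
  have "\<exists>R>0. \<forall>t\<in>{0..T}. norm (X i t) \<le> R" if "i < N" for i
    using compact_imp_bounded[OF compact_continuous_image[OF Xc[OF that] compact_Icc]] unfolding bounded_pos by auto
  then obtain R where R: "\<And>i. i < N \<Longrightarrow> 0 < R i" "\<And>i t. i < N \<Longrightarrow> t \<in> {0..T} \<Longrightarrow> norm (X i t) \<le> R i" by metis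
  define RR where "RR = (\<Sum>i<N. R i)"
  have RR: "R i \<le> RR" if "i < N" for i
    unfolding RR_def by (rule member_le_sum) (use that R(1) in \<open>auto intro: less_imp_le\<close>)
  then have RR0: "0 < RR" using R(1)[of 0] N by force
  have P: "empirical N (\<lambda>i. X i t) \<in> P1" for t by (rule empirical_P1[OF N])
  show ?thesis
    unfolding pde_solution_def
  proof (intro conjI ballI)
    show "Y 0 = Y0" "caratheodory T Y u" by fact+
    show "empirical N (\<lambda>i. X i 0) = empirical N X0"
      unfolding empirical_def using X0 by (intro distr_cong) (auto simp: space_uniform_count_measure)
    show "empirical N (\<lambda>i. X i t) \<in> P1" for t by (rule P)
    show "\<exists>R>0. \<forall>t\<in>{0..T}. measure_support (empirical N (\<lambda>i. X i t)) \<subseteq> ball 0 R"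
    proof (intro exI[of _ "RR + 1"] conjI ballI)
      fix t assume t: "t \<in> {0..T}"
      have "AE x in empirical N (\<lambda>i. X i t). norm x \<le> RR"
        by (rule empirical_AE) (use R(2)[OF _ t] RR order_trans in blast)
      then have "measure_support (empirical N (\<lambda>i. X i t)) \<subseteq> cball 0 RR"
        by (intro support_subset_ball P1_D(2)[OF P])
      also have "\<dots> \<subseteq> ball 0 (RR + 1)" by auto
      finally show "measure_support (empirical N (\<lambda>i. X i t)) \<subseteq> ball 0 (RR + 1)" .
    qed (use RR0 in simp)
    show "((\<lambda>s. chi_dist (Y s, empirical N (\<lambda>i. X i s)) (Y t, empirical N (\<lambda>i. X i t))) \<longlongrightarrow> 0) (at t within {0..T})"
      if t: "t \<in> {0..T}" for t
    proof (rule Lim_null_comparison)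
      show "\<forall>\<^sub>F s in at t within {0..T}. norm (chi_dist (Y s, empirical N (\<lambda>i. X i s)) (Y t, empirical N (\<lambda>i. X i t)))
          \<le> norm (Y s - Y t) + (\<Sum>i<N. dist (X i s) (X i t)) / real N"
      proof (rule always_eventually, rule allI)
        fix s
        have c: "norm (chi_dist (Y s, empirical N (\<lambda>i. X i s)) (Y t, empirical N (\<lambda>i. X i t)))
          = chi_dist (Y s, empirical N (\<lambda>i. X i s)) (Y t, empirical N (\<lambda>i. X i t))"
          unfolding real_norm_def by (intro abs_of_nonneg chi_dist_nonneg P)
        show "norm (chi_dist (Y s, empirical N (\<lambda>i. X i s)) (Y t, empirical N (\<lambda>i. X i t)))
          \<le> norm (Y s - Y t) + (\<Sum>i<N. dist (X i s) (X i t)) / real N"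
          unfolding c by (rule order_trans[OF chi_dist_le]) (intro add_left_mono W1_empirical_le[OF N])
      qed
      have "((\<lambda>s. norm (Y s - Y t) + (\<Sum>i<N. dist (X i s) (X i t)) / real N) \<longlongrightarrow>
          norm (Y t - Y t) + (\<Sum>i<N. dist (X i t) (X i t)) / real N) (at t within {0..T})"
        using Xc Yc t N by (intro tendsto_intros) (auto simp: continuous_on_def)
      then show "((\<lambda>s. norm (Y s - Y t) + (\<Sum>i<N. dist (X i s) (X i t)) / real N) \<longlongrightarrow> 0) (at t within {0..T})" by simp
    qed
    fix \<phi> :: "real^'d \<Rightarrow> real" assume \<phi>: "\<phi> \<in> test_functions"
    obtain C where C: "C-lipschitz_on UNIV \<phi>" using test_lipschitz[OF \<phi>] by metis
    note i\<phi> = empirical_integral[OF lipschitz_measurable[OF C]]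
    note iv = empirical_integral[OF weak_form_measurable[OF P \<phi>]]
    show "caratheodory T (\<lambda>t. \<integral>x. \<phi> x \<partial>empirical N (\<lambda>i. X i t))
      (\<lambda>t. \<integral>x. gradient \<phi> x \<bullet> velocity H G (u t) (Y t) (empirical N (\<lambda>i. X i t)) x \<partial>empirical N (\<lambda>i. X i t))"
      unfolding i\<phi> iv caratheodory_def sum_divide_distrib
    proof
      have "abs_continuous_on 0 T (\<lambda>t. \<phi> (X i t) / real N)" if "i < N" for i
      proof (rule abs_continuous_on_lipschitz[of 0 T _ "C / real N" "X i"])
        show "norm (\<phi> (X i t) / real N - \<phi> (X i s) / real N) \<le> C / real N * norm (X i t - X i s)" for s t
          using lipschitz_onD[OF C, of "X i t" "X i s"] N
          by (simp add: dist_norm diff_divide_distrib[symmetric] divide_right_mono)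
        show "abs_continuous_on 0 T (X i)" using X[OF that] by (simp add: caratheodory_def)
      qed (use lipschitz_on_nonneg[OF C] in simp)
      then show "abs_continuous_on 0 T (\<lambda>t. \<Sum>i<N. \<phi> (X i t) / real N)"
        by (intro abs_continuous_on_sum) auto
      have "AE t in lebesgue_on {0..T}. \<forall>i\<in>{..<N}. (X i has_vector_derivative
          velocity H G (u t) (Y t) (empirical N (\<lambda>j. X j t)) (X i t)) (at t within {0..T})"
        using X by (intro AE_finite_allI) (auto simp: caratheodory_def)
      then show "AE t in lebesgue_on {0..T}. ((\<lambda>t. \<Sum>i<N. \<phi> (X i t) / real N) has_vector_derivative
          (\<Sum>i<N. gradient \<phi> (X i t) \<bullet> velocity H G (u t) (Y t) (empirical N (\<lambda>i. X i t)) (X i t) / real N)) (at t within {0..T})"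
      proof eventually_elim
        case (elim t)
        show ?case
        proof (intro has_vector_derivative_sum has_vector_derivative_divide)
          fix i assume i: "i \<in> {..<N}"
          let ?v = "velocity H G (u t) (Y t) (empirical N (\<lambda>i. X i t)) (X i t)"
          have "((\<lambda>r. \<phi> (X i r)) has_derivative (\<lambda>h. gradient \<phi> (X i t) \<bullet> (h *\<^sub>R ?v))) (at t within {0..T})"
            using elim i by (intro has_derivative_compose[OF _ test_functionsD(5)[OF \<phi>]]) (auto simp: has_vector_derivative_def)
          then show "((\<lambda>t. \<phi> (X i t)) has_vector_derivative gradient \<phi> (X i t) \<bullet> ?v) (at t within {0..T})"
            by (simp add: has_vector_derivative_def)
        qed
      qed
    qed
  qed
qed

text \<open>
  The bound for the velocity does not depend on the truncation radius; that radius can therefore be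
  chosen after the ball that the solution cannot leave.
\<close>

definition speed :: real where "speed = M + real CARD('d) * B * M"

lemma M_nonneg: "0 \<le> M" using H_bd[of 0] norm_ge_zero order_trans by blast

lemma speed_nonneg: "0 \<le> speed" using M_nonneg B_nonneg by (simp add: speed_def)

text \<open>
  The particle trajectories are the characteristics of the same flow, started at the atoms of the
  initial measure.
\<close>

theorem solutions_exist:
  fixes u :: "real \<Rightarrow> (real^'d)^'m"
  assumes \<mu>0: "\<mu>0 \<in> P1" "AE x in \<mu>0. norm x \<le> R0" "0 \<le> R0"
    and u: "u \<in> borel_measurable (lebesgue_on {0..T})" "\<And>t. norm (u t) \<le> B"
  shows "\<exists>Y \<mu>. pde_solution T H G Y0 \<mu>0 u Y \<mu> \<and> (\<forall>t\<in>{0..T}. AE x in \<mu> t. norm x \<le> R0 + speed * T) \<and>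
    (\<forall>N\<ge>1. \<forall>X0. \<mu>0 = empirical N X0 \<longrightarrow> (\<exists>X. particle_solution T H G N Y0 X0 u Y X))"
proof -
  define R where "R = R0 + speed * T"
  define S where "S = norm Y0 + B * T"
  define r where "r = 2 * R + S"
  have R0: "0 \<le> R" and S0: "0 \<le> S" using \<mu>0(3) speed_nonneg T_pos B_nonneg by (auto simp: R_def S_def)
  have r: "2 * R \<le> r" "R + S \<le> r" "0 \<le> r" using R0 S0 by (auto simp: r_def)
  obtain \<Lambda> where "lipschitz_field (trunc r H) (\<lambda>l. trunc r (G l)) \<Lambda> M B" using trunc_field[OF r(3)] by metis
  then interpret F: lipschitz_field "trunc r H" "\<lambda>l. trunc r (G l)" \<Lambda> M B .
  interpret F: flow_setup "trunc r H" "\<lambda>l. trunc r (G l)" \<Lambda> M B T u Y0 \<mu>0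
    using T_pos u \<mu>0(1) by unfold_locales auto
  have Vs: "F.vmax = speed" by (simp add: F.vmax_def F.D_def speed_def)
  obtain X where X: "F.admissible X" and eq: "\<And>t x. t \<in> {0..T} \<Longrightarrow> X t x = x + integral {0..t} (\<lambda>s. F.flow_vel X s x)"
    using F.flow_exists by metis
  have P: "F.pushed X t \<in> P1" for t by (rule F.pushed_P1[OF X])
  have X0: "X 0 x = x" for x using eq[of 0 x] T_pos by simp
  have Xb: "norm (X t x) \<le> R" if "t \<in> {0..T}" "norm x \<le> R0" for t x
  proof -
    have "norm (X t x - X 0 x) \<le> speed * norm (t - 0)"
      using F.flow_lipschitz[OF X eq, of 0 t x] that T_pos Vs by simp
    also have "\<dots> \<le> speed * T" using that speed_nonneg by (intro mult_left_mono) auto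
    finally show ?thesis using that norm_triangle_sub[of "X t x" x] by (simp add: R_def X0)
  qed
  have supp: "AE x in F.pushed X t. norm x \<le> R" if "t \<in> {0..T}" for t
  proof -
    have "AE \<xi> in \<mu>0. norm (X t \<xi>) \<le> R" using \<mu>0(2) by eventually_elim (rule Xb[OF that])
    then show ?thesis unfolding F.pushed_def by (subst AE_distr_iff[OF F.admissible_measurable[OF X]]) auto
  qed
  have Yb: "norm (F.Y t) \<le> S" if "t \<in> {0..T}" for t
  proof -
    have "norm (F.Y t - F.Y 0) \<le> B * \<bar>t - 0\<bar>" using F.Y_lip[of 0 t] that T_pos by simp
    also have "\<dots> \<le> B * T" using that B_nonneg by (intro mult_left_mono) auto
    finally show ?thesis using norm_triangle_sub[of "F.Y t" "F.Y 0"] by (simp add: S_def F.Y_def)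
  qed
  have "pde_solution T H G Y0 \<mu>0 u F.Y (F.pushed X)"
    unfolding pde_solution_def
  proof (intro conjI ballI)
    show "F.Y 0 = Y0" by (simp add: F.Y_def)
    have "X 0 = (\<lambda>x. x)" using X0 by auto
    then show "F.pushed X 0 = \<mu>0"
      using distr_id2[of borel \<mu>0] P1_D(2)[OF \<mu>0(1)] by (simp add: F.pushed_def)
    show "F.pushed X t \<in> P1" for t by (rule P)
    show "\<exists>R>0. \<forall>t\<in>{0..T}. measure_support (F.pushed X t) \<subseteq> ball 0 R"
    proof (intro exI[of _ "R + 1"] conjI ballI)
      fix t assume t: "t \<in> {0..T}"
      have "measure_support (F.pushed X t) \<subseteq> cball 0 R"
        by (intro support_subset_ball P1_D(2)[OF P] supp[OF t])
      also have "\<dots> \<subseteq> ball 0 (R + 1)" by auto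
      finally show "measure_support (F.pushed X t) \<subseteq> ball 0 (R + 1)" .
    qed (use R0 in simp)
    show "((\<lambda>s. chi_dist (F.Y s, F.pushed X s) (F.Y t, F.pushed X t)) \<longlongrightarrow> 0) (at t within {0..T})" if t: "t \<in> {0..T}" for t
    proof (rule Lim_null_comparison)
      show "\<forall>\<^sub>F s in at t within {0..T}. norm (chi_dist (F.Y s, F.pushed X s) (F.Y t, F.pushed X t)) \<le> (B + speed) * \<bar>s - t\<bar>"
        unfolding eventually_at_filter
      proof (intro always_eventually allI impI)
        fix s assume s: "s \<in> {0..T}"
        have "chi_dist (F.Y s, F.pushed X s) (F.Y t, F.pushed X t) \<le> norm (F.Y s - F.Y t) + W1 (F.pushed X s) (F.pushed X t)"
          by (rule chi_dist_le)
        also have "\<dots> \<le> B * \<bar>s - t\<bar> + speed * \<bar>s - t\<bar>"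
          using F.Y_lip[OF t s] F.flow_lipschitz[OF X eq t s]
          by (intro add_mono F.pushed_W1_le[OF X X]) (auto simp: dist_norm Vs)
        finally show "norm (chi_dist (F.Y s, F.pushed X s) (F.Y t, F.pushed X t)) \<le> (B + speed) * \<bar>s - t\<bar>"
          using chi_dist_nonneg[OF P P, of "F.Y s" s "F.Y t" t] by (simp add: distrib_right)
      qed
      have "((\<lambda>s. (B + speed) * \<bar>s - t\<bar>) \<longlongrightarrow> (B + speed) * \<bar>t - t\<bar>) (at t within {0..T})"
        by (intro tendsto_intros)
      then show "((\<lambda>s. (B + speed) * \<bar>s - t\<bar>) \<longlongrightarrow> 0) (at t within {0..T})" by simp
    qed
    show "caratheodory T F.Y u" by (rule F.Y_caratheodory)
    fix \<phi> :: "real^'d \<Rightarrow> real" assume \<phi>: "\<phi> \<in> test_functions"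
    show "caratheodory T (\<lambda>t. \<integral>x. \<phi> x \<partial>F.pushed X t)
      (\<lambda>t. \<integral>x. gradient \<phi> x \<bullet> velocity H G (u t) (F.Y t) (F.pushed X t) x \<partial>F.pushed X t)"
    proof (rule caratheodory_cong[OF F.flow_weak_form[OF X eq \<phi>]])
      show "AE t in lebesgue_on {0..T}.
        (\<integral>x. gradient \<phi> x \<bullet> velocity (trunc r H) (\<lambda>l. trunc r (G l)) (u t) (F.Y t) (F.pushed X t) x \<partial>F.pushed X t) =
        (\<integral>x. gradient \<phi> x \<bullet> velocity H G (u t) (F.Y t) (F.pushed X t) x \<partial>F.pushed X t)"
        by (rule AE_I2) (simp add: weak_form_trunc[OF P supp Yb r(1,2) \<phi>])
    qed
  qed
  moreover have "\<exists>Z. particle_solution T H G N Y0 X0 u F.Y Z" if N: "1 \<le> N" and emp: "\<mu>0 = empirical N X0" for N X0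
  proof -
    have e: "empirical N (\<lambda>j. X t (X0 j)) = F.pushed X t" for t
      using borel_measurable_continuous_onI[OF F.admissible_continuous(1)[OF X, of t]]
      unfolding F.pushed_def unfolding emp empirical_def by (subst distr_distr) (auto intro: measurable_uniform_count_measure simp: comp_def)
    have "particle_solution T H G N Y0 X0 u F.Y (\<lambda>i t. X t (X0 i))"
      unfolding particle_solution_def
    proof (intro conjI allI impI)
      show "F.Y 0 = Y0" by (simp add: F.Y_def)
      show "X 0 (X0 i) = X0 i" for i by (rule X0)
      show "caratheodory T F.Y u" by (rule F.Y_caratheodory)
      fix i assume i: "i < N"
      have xi: "norm (X0 i) \<le> R0" using empirical_AE_D[OF \<mu>0(2)[unfolded emp] i] .
      show "caratheodory T (\<lambda>t. X t (X0 i))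
        (\<lambda>t. velocity H G (u t) (F.Y t) (empirical N (\<lambda>j. X t (X0 j))) (X t (X0 i)))"
      proof (rule caratheodory_cong[OF F.flow_caratheodory[OF X eq]])
        show "AE t in lebesgue_on {0..T}. F.flow_vel X t (X0 i) = velocity H G (u t) (F.Y t) (empirical N (\<lambda>j. X t (X0 j))) (X t (X0 i))"
          unfolding F.flow_vel_def e
          by (rule AE_I2) (simp add: velocity_trunc[OF P supp Xb[OF _ xi] Yb r(1,2)])
      qed
    qed
    then show ?thesis by blast
  qed
  ultimately show ?thesis using supp unfolding R_def by blast
qed

end

section \<open>Continuous dependence of states and costs\<close>

lemma pde_solution_cong:
  assumes "pde_solution T H G Y0 \<mu>0 u Y \<mu>" and ae: "AE t in lebesgue_on {0..T}. u t = v t"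
  shows "pde_solution T H G Y0 \<mu>0 v Y \<mu>"
proof -
  have c: "caratheodory T f (\<lambda>t. h (v t) t)" if "caratheodory T f (\<lambda>t. h (u t) t)" for f :: "real \<Rightarrow> real" and h
    by (rule caratheodory_cong[OF that]) (use ae in eventually_elim, simp)
  have "caratheodory T Y v" using assms caratheodory_cong unfolding pde_solution_def by blast
  then show ?thesis
    using assms(1) c[of _ "\<lambda>w t. \<integral>x. gradient _ x \<bullet> velocity H G w (Y t) (\<mu> t) x \<partial>\<mu> t"]
    unfolding pde_solution_def by auto
qed

lemma particle_solution_cong:
  assumes sol: "particle_solution T H G N Y0 X0 u Y X" and ae: "AE t in lebesgue_on {0..T}. u t = v t"
  shows "particle_solution T H G N Y0 X0 v Y X"
  unfolding particle_solution_def
proof (intro conjI allI impI)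
  show "caratheodory T Y v" using sol ae caratheodory_cong unfolding particle_solution_def by blast
  fix i assume "i < N"
  then have "caratheodory T (X i) (\<lambda>t. velocity H G (u t) (Y t) (empirical N (\<lambda>j. X j t)) (X i t))"
    using sol unfolding particle_solution_def by blast
  then show "caratheodory T (X i) (\<lambda>t. velocity H G (v t) (Y t) (empirical N (\<lambda>j. X j t)) (X i t))"
    by (rule caratheodory_cong) (use ae in eventually_elim, simp)
qed (use sol in \<open>auto simp: particle_solution_def\<close>)

context bounded_field begin

text \<open>
  The constant is shared by all solutions with states in the ball of radius \<open>R\<close> and \<open>norm Y0 \<le> S\<close>, so
  it does not depend on the number of particles.  The argument \<open>m\<close> only fixes the type of the
  controlled agents.
\<close>

definition stability_constant :: "'m::finite itself \<Rightarrow> real \<Rightarrow> real \<Rightarrow> real \<Rightarrow> bool" where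
  "stability_constant m R S C \<longleftrightarrow> (\<forall>(Y0::(real^'d)^'m) \<mu>0 \<nu>0 u v Y Y' \<mu> \<nu> \<kappa>.
    pde_solution T H G Y0 \<mu>0 u Y \<mu> \<longrightarrow> pde_solution T H G Y0 \<nu>0 v Y' \<nu> \<longrightarrow>
    (AE t in lebesgue_on {0..T}. norm (u t) \<le> B) \<longrightarrow> (AE t in lebesgue_on {0..T}. norm (v t) \<le> B) \<longrightarrow>
    (AE t in lebesgue_on {0..T}. norm (u t - v t) \<le> \<kappa>) \<longrightarrow> 0 \<le> \<kappa> \<longrightarrow> norm Y0 \<le> S \<longrightarrow>
    (\<forall>t\<in>{0..T}. AE x in \<mu> t. norm x \<le> R) \<longrightarrow> (\<forall>t\<in>{0..T}. AE x in \<nu> t. norm x \<le> R) \<longrightarrow>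
    (\<forall>t\<in>{0..T}. norm (Y t - Y' t) \<le> \<kappa> * T \<and> lipdist (\<mu> t) (\<nu> t) \<le> C * (lipdist \<mu>0 \<nu>0 + \<kappa>)))"

text \<open>
  Controls are redefined as 0 on the null set of times where one of their bounds fails.
\<close>

lemma pde_stability:
  assumes R: "0 \<le> R"
  shows "\<exists>C\<ge>0. stability_constant TYPE('m::finite) R S C"
proof (cases "0 \<le> S")
  case False
  then show ?thesis
    using norm_ge_zero order_trans unfolding stability_constant_def by (intro exI[of _ 0]) blast
next
  case S: True
  define Q where "Q = S + B * T"
  define r where "r = 2 * R + Q"
  have Q: "0 \<le> Q" using S B_nonneg T_pos by (simp add: Q_def)
  have r: "2 * R \<le> r" "R + Q \<le> r" "0 \<le> r" using R Q by (auto simp: r_def)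
  obtain \<Lambda> where "lipschitz_field (trunc r H) (\<lambda>l. trunc r (G l)) \<Lambda> M B" using trunc_field[OF r(3)] by metis
  then interpret F: lipschitz_field "trunc r H" "\<lambda>l. trunc r (G l)" \<Lambda> M B .
  define c where "c = F.D * (M + B * \<Lambda> * T) * T"
  have c: "0 \<le> c" using F.consts_nonneg F.\<Lambda>_nonneg M_nonneg B_nonneg T_pos by (simp add: c_def)
  define C where "C = exp ((F.vlip + \<Lambda>) * T) * (1 + c)"
  show ?thesis
    unfolding stability_constant_def
  proof (intro exI[of _ C] conjI allI impI ballI)
    show "0 \<le> C" using c by (simp add: C_def)
    fix Y0 :: "(real^'d)^'m" and \<mu>0 \<nu>0 u v Y Y' \<mu> \<nu> \<kappa> t
    assume sol: "pde_solution T H G Y0 \<mu>0 u Y \<mu>" "pde_solution T H G Y0 \<nu>0 v Y' \<nu>"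
      and B: "AE t in lebesgue_on {0..T}. norm (u t) \<le> B" "AE t in lebesgue_on {0..T}. norm (v t) \<le> B"
      and \<kappa>: "AE t in lebesgue_on {0..T}. norm (u t - v t) \<le> \<kappa>" "0 \<le> \<kappa>" and Y0: "norm Y0 \<le> S"
      and supp: "\<forall>t\<in>{0..T}. AE x in \<mu> t. norm x \<le> R" "\<forall>t\<in>{0..T}. AE x in \<nu> t. norm x \<le> R" and t: "t \<in> {0..T}"
    define ok where "ok = (\<lambda>t. norm (u t) \<le> B \<and> norm (v t) \<le> B \<and> norm (u t - v t) \<le> \<kappa>)"
    define u' where "u' = (\<lambda>t. if ok t then u t else 0)"
    define v' where "v' = (\<lambda>t. if ok t then v t else 0)"
    have u'B: "norm (u' t) \<le> B" "norm (v' t) \<le> B" "norm (u' t - v' t) \<le> \<kappa>" for t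
      using B_nonneg \<kappa>(2) by (auto simp: u'_def v'_def ok_def)
    have ae: "AE t in lebesgue_on {0..T}. u t = u' t" "AE t in lebesgue_on {0..T}. v t = v' t"
      using B \<kappa>(1) by (eventually_elim, simp add: u'_def v'_def ok_def)+
    have Y: "Y 0 = Y0" "caratheodory T Y u'" "Y' 0 = Y0" "caratheodory T Y' v'" "\<mu> 0 = \<mu>0" "\<nu> 0 = \<nu>0"
      using sol caratheodory_cong[OF _ ae(1), of Y] caratheodory_cong[OF _ ae(2), of Y'] unfolding pde_solution_def by auto
    have Yb: "norm (Y t) \<le> Q" "norm (Y' t) \<le> Q" if "t \<in> {0..T}" for t
    proof -
      have "B * t \<le> B * T" using that B_nonneg by (intro mult_left_mono) auto
      then show "norm (Y t) \<le> Q" "norm (Y' t) \<le> Q"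
        using caratheodory_lipschitz[OF Y(2) u'B(1), of 0 t] caratheodory_lipschitz[OF Y(4) u'B(2), of 0 t] that Y Y0
          norm_triangle_sub[of "Y t" Y0] norm_triangle_sub[of "Y' t" Y0] by (auto simp: Q_def)
    qed
    have w: "weak_solution T (trunc r H) (\<lambda>l. trunc r (G l)) B R u' Y \<mu>"
      "weak_solution T (trunc r H) (\<lambda>l. trunc r (G l)) B R v' Y' \<nu>"
      using supp by (auto intro!: pde_solution_weak[OF sol(1) ae(1) u'B(1) _ Yb(1) r(1,2)] pde_solution_weak[OF sol(2) ae(2) u'B(2) _ Yb(2) r(1,2)])
    have P: "\<mu>0 \<in> P1" "\<nu>0 \<in> P1" using sol T_pos unfolding pde_solution_def by force+
    have "norm ((Y t - Y 0) - (Y' t - Y' 0)) \<le> \<kappa> * (t - 0)"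
      using t by (intro caratheodory_diff_bound[OF Y(2,4) u'B(3)]) auto
    also have "\<dots> \<le> \<kappa> * T" using t \<kappa>(2) by (intro mult_left_mono) auto
    finally show "norm (Y t - Y' t) \<le> \<kappa> * T" by (simp add: Y)
    have "lipdist (\<mu> t) (\<nu> t) \<le> exp ((F.vlip + \<Lambda>) * T) * (lipdist (\<mu> 0) (\<nu> 0) + F.D * (M + B * \<Lambda> * T) * T * \<kappa>)"
      by (rule F.weak_solution_stability[OF w R u'B(3) _ t]) (simp add: Y)
    also have "\<dots> \<le> exp ((F.vlip + \<Lambda>) * T) * ((1 + c) * (lipdist \<mu>0 \<nu>0 + \<kappa>))"
    proof (rule mult_left_mono)
      have "F.D * (M + B * \<Lambda> * T) * T * \<kappa> = c * \<kappa>" by (simp add: c_def)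
      then show "lipdist (\<mu> 0) (\<nu> 0) + F.D * (M + B * \<Lambda> * T) * T * \<kappa> \<le> (1 + c) * (lipdist \<mu>0 \<nu>0 + \<kappa>)"
        using mult_nonneg_nonneg[OF c lipdist_nonneg[OF P]] \<kappa>(2) by (simp add: Y algebra_simps)
    qed simp
    finally show "lipdist (\<mu> t) (\<nu> t) \<le> C * (lipdist \<mu>0 \<nu>0 + \<kappa>)" by (simp add: C_def mult.assoc)
  qed
qed

lemma solutions_exist_AE:
  fixes u :: "real \<Rightarrow> (real^'d)^'m"
  assumes \<mu>0: "\<mu>0 \<in> P1" "AE x in \<mu>0. norm x \<le> R0" "0 \<le> R0"
    and u: "u \<in> borel_measurable (lebesgue_on {0..T})" "AE t in lebesgue_on {0..T}. norm (u t) \<le> B"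
  shows "\<exists>Y \<mu>. pde_solution T H G Y0 \<mu>0 u Y \<mu> \<and> (\<forall>t\<in>{0..T}. AE x in \<mu> t. norm x \<le> R0 + speed * T) \<and>
    (\<forall>N\<ge>1. \<forall>X0. \<mu>0 = empirical N X0 \<longrightarrow> (\<exists>X. particle_solution T H G N Y0 X0 u Y X))"
proof -
  define v where "v = (\<lambda>t. if norm (u t) \<le> B then u t else 0)"
  have v: "v \<in> borel_measurable (lebesgue_on {0..T})"
    unfolding v_def using u(1) by measurable
  have vB: "norm (v t) \<le> B" for t using B_nonneg by (simp add: v_def)
  have ae: "AE t in lebesgue_on {0..T}. v t = u t" using u(2) by eventually_elim (simp add: v_def)
  obtain Y \<mu> where *: "pde_solution T H G Y0 \<mu>0 v Y \<mu>" "\<forall>t\<in>{0..T}. AE x in \<mu> t. norm x \<le> R0 + speed * T"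
    "\<forall>N\<ge>1. \<forall>X0. \<mu>0 = empirical N X0 \<longrightarrow> (\<exists>X. particle_solution T H G N Y0 X0 v Y X)"
    using solutions_exist[OF \<mu>0 v vB, of Y0] by (elim exE conjE)
  show ?thesis
  proof (intro exI[of _ Y] exI[of _ \<mu>] conjI allI impI)
    show "pde_solution T H G Y0 \<mu>0 u Y \<mu>" by (rule pde_solution_cong[OF *(1) ae])
    show "\<forall>t\<in>{0..T}. AE x in \<mu> t. norm x \<le> R0 + speed * T" by fact
    fix N X0 assume "1 \<le> N" "\<mu>0 = empirical N X0"
    then obtain X where "particle_solution T H G N Y0 X0 v Y X" using *(3) by blast
    then show "\<exists>X. particle_solution T H G N Y0 X0 u Y X" using particle_solution_cong ae by blast
  qed
qed

end

locale cost_field = bounded_field H G M B T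
  for H :: "real^'d \<Rightarrow> real^'d" and G :: "'d \<Rightarrow> real^'d \<Rightarrow> real^'d" and M B T :: real +
  fixes L :: "(real^'d)^'m \<Rightarrow> (real^'d) measure \<Rightarrow> real"
  assumes L_cont: "continuous_on_chi L"
    and L_narrow: "\<And>\<mu>s \<mu>. (\<And>j. \<mu>s j \<in> P1) \<Longrightarrow> \<mu> \<in> P1 \<Longrightarrow> narrowly_converges \<mu>s \<mu> \<Longrightarrow>
           uniform_limit UNIV (\<lambda>j Y. L Y (\<mu>s j)) (\<lambda>Y. L Y \<mu>) sequentially"
begin

text \<open>
  The narrow continuity of \<open>L\<close> is uniform in \<open>Y\<close>, so it may be used along a moving \<open>Y\<close>; for the fixed
  limit measure the continuity on \<open>\<chi>\<close> applies because the Wasserstein term vanishes.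
\<close>

lemma L_sequential:
  assumes Y: "Yk \<longlonglongrightarrow> Y" and P: "\<And>k. \<mu>k k \<in> P1" "\<mu> \<in> P1" and lim: "(\<lambda>k. lipdist (\<mu>k k) \<mu>) \<longlonglongrightarrow> 0"
    and supp: "\<And>k. AE x in \<mu>k k. norm x \<le> R" "AE x in \<mu>. norm x \<le> R" and R: "0 \<le> R"
  shows "(\<lambda>k. L (Yk k) (\<mu>k k)) \<longlonglongrightarrow> L Y \<mu>"
proof -
  have "narrowly_converges \<mu>k \<mu>" by (rule lipdist_narrow[OF P(2) P(1) lim supp(2) supp(1) R])
  from L_narrow[OF P this] have u: "uniform_limit UNIV (\<lambda>j Y. L Y (\<mu>k j)) (\<lambda>Y. L Y \<mu>) sequentially" .
  have 1: "(\<lambda>k. L (Yk k) (\<mu>k k) - L (Yk k) \<mu>) \<longlonglongrightarrow> 0"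
  proof (rule LIMSEQ_I)
    fix e :: real assume "0 < e"
    then have "\<forall>\<^sub>F k in sequentially. \<forall>Y\<in>UNIV. dist (L Y (\<mu>k k)) (L Y \<mu>) < e"
      using u unfolding uniform_limit_iff by blast
    then show "\<exists>n0. \<forall>k\<ge>n0. norm (L (Yk k) (\<mu>k k) - L (Yk k) \<mu> - 0) < e"
      by (auto simp: eventually_sequentially dist_real_def)
  qed
  have 2: "(\<lambda>k. L (Yk k) \<mu>) \<longlonglongrightarrow> L Y \<mu>"
  proof (rule LIMSEQ_I)
    fix e :: real assume "0 < e"
    then obtain d where d: "0 < d" "\<And>Y'. chi_dist (Y', \<mu>) (Y, \<mu>) < d \<Longrightarrow> \<bar>L Y' \<mu> - L Y \<mu>\<bar> < e"
      using L_cont P(2) unfolding continuous_on_chi_def by blast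
    obtain n0 where "\<And>k. k \<ge> n0 \<Longrightarrow> norm (Yk k - Y) < d" using LIMSEQ_D[OF Y d(1)] by blast
    then have "chi_dist (Yk k, \<mu>) (Y, \<mu>) < d" if "k \<ge> n0" for k
      using chi_dist_le[of "Yk k" \<mu> Y \<mu>] W1_refl[OF P(2)] that by fastforce
    then show "\<exists>n0. \<forall>k\<ge>n0. norm (L (Yk k) \<mu> - L Y \<mu>) < e" using d(2) by (intro exI[of _ n0]) auto
  qed
  show ?thesis using tendsto_add[OF 1 2] by simp
qed

text \<open>
  Otherwise there are times \<open>t\<^sub>k\<close> with a difference above \<open>e\<close>; along a convergent subsequence both
  terms have the same limit by \<open>L_sequential\<close>.
\<close>

lemma L_uniform:
  assumes Yc: "continuous_on {0..T} Y"
    and \<mu>c: "\<And>t. t \<in> {0..T} \<Longrightarrow> ((\<lambda>s. lipdist (\<mu> s) (\<mu> t)) \<longlongrightarrow> 0) (at t within {0..T})"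
    and P: "\<And>n t. t \<in> {0..T} \<Longrightarrow> \<mu>n n t \<in> P1" "\<And>t. t \<in> {0..T} \<Longrightarrow> \<mu> t \<in> P1"
    and supp: "\<And>n t. t \<in> {0..T} \<Longrightarrow> AE x in \<mu>n n t. norm x \<le> R" "\<And>t. t \<in> {0..T} \<Longrightarrow> AE x in \<mu> t. norm x \<le> R"
    and R: "0 \<le> R" and E: "E \<longlonglongrightarrow> 0"
    and close: "\<And>n t. t \<in> {0..T} \<Longrightarrow> norm (Yn n t - Y t) \<le> E n" "\<And>n t. t \<in> {0..T} \<Longrightarrow> lipdist (\<mu>n n t) (\<mu> t) \<le> E n"
    and e: "0 < e"
  shows "\<forall>\<^sub>F n in sequentially. \<forall>t\<in>{0..T}. \<bar>L (Yn n t) (\<mu>n n t) - L (Y t) (\<mu> t)\<bar> \<le> e"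
proof (rule ccontr)
  assume "\<not> ?thesis"
  then have "\<forall>n0. \<exists>n\<ge>n0. \<exists>t\<in>{0..T}. \<bar>L (Yn n t) (\<mu>n n t) - L (Y t) (\<mu> t)\<bar> > e"
    unfolding eventually_sequentially by (auto simp: not_le)
  then obtain nk tk where k: "\<And>k. nk k \<ge> k" "\<And>k. tk k \<in> {0..T}"
      "\<And>k. \<bar>L (Yn (nk k) (tk k)) (\<mu>n (nk k) (tk k)) - L (Y (tk k)) (\<mu> (tk k))\<bar> > e" by metis
  obtain l r where lr: "l \<in> {0..T}" "strict_mono r" "(tk \<circ> r) \<longlonglongrightarrow> l"
    using compact_imp_seq_compact[OF compact_Icc] k(2) unfolding seq_compact_def by metis
  define s where "s = tk \<circ> r"
  define j where "j = nk \<circ> r"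
  have s: "s k \<in> {0..T}" for k using k(2) by (simp add: s_def)
  have sl: "s \<longlonglongrightarrow> l" using lr(3) by (simp add: s_def)
  have "j k \<ge> k" for k using k(1)[of "r k"] seq_suble[OF lr(2), of k] by (simp add: j_def)
  then have "filterlim j sequentially sequentially"
    by (intro filterlim_at_top_mono[OF filterlim_ident]) auto
  then have Ej: "(\<lambda>k. E (j k)) \<longlonglongrightarrow> 0" using filterlim_compose[OF E] by blast
  have Ys: "(\<lambda>k. Y (s k)) \<longlonglongrightarrow> Y l"
    using continuous_on_tendsto_compose[OF Yc sl lr(1)] s by simp
  have ds: "(\<lambda>k. lipdist (\<mu> (s k)) (\<mu> l)) \<longlonglongrightarrow> 0"
  proof -
    have "continuous (at l within {0..T}) (\<lambda>s. lipdist (\<mu> s) (\<mu> l))"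
      using \<mu>c[OF lr(1)] by (simp add: continuous_within lipdist_refl P(2)[OF lr(1)])
    then have "(\<lambda>k. lipdist (\<mu> (s k)) (\<mu> l)) \<longlonglongrightarrow> lipdist (\<mu> l) (\<mu> l)"
      using sl s unfolding continuous_within_sequentially comp_def by blast
    then show ?thesis by (simp add: lipdist_refl P(2)[OF lr(1)])
  qed
  have A: "(\<lambda>k. L (Y (s k)) (\<mu> (s k))) \<longlonglongrightarrow> L (Y l) (\<mu> l)"
    by (rule L_sequential[OF Ys P(2)[OF s] P(2)[OF lr(1)] ds supp(2)[OF s] supp(2)[OF lr(1)] R])
  have Bt: "(\<lambda>k. L (Yn (j k) (s k)) (\<mu>n (j k) (s k))) \<longlonglongrightarrow> L (Y l) (\<mu> l)"
  proof (rule L_sequential[OF _ P(1)[OF s] P(2)[OF lr(1)] _ supp(1)[OF s] supp(2)[OF lr(1)] R])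
    have "(\<lambda>k. Yn (j k) (s k) - Y (s k)) \<longlonglongrightarrow> 0"
      by (rule Lim_null_comparison[OF _ Ej]) (simp add: close(1)[OF s])
    from tendsto_add[OF this Ys] show "(\<lambda>k. Yn (j k) (s k)) \<longlonglongrightarrow> Y l" by simp
    show "(\<lambda>k. lipdist (\<mu>n (j k) (s k)) (\<mu> l)) \<longlonglongrightarrow> 0"
    proof (rule Lim_null_comparison)
      show "\<forall>\<^sub>F k in sequentially. norm (lipdist (\<mu>n (j k) (s k)) (\<mu> l)) \<le> E (j k) + lipdist (\<mu> (s k)) (\<mu> l)"
      proof (rule always_eventually, rule allI)
        fix k
        show "norm (lipdist (\<mu>n (j k) (s k)) (\<mu> l)) \<le> E (j k) + lipdist (\<mu> (s k)) (\<mu> l)"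
          using lipdist_triangle[OF P(1)[OF s] P(2)[OF s] P(2)[OF lr(1)], of "j k" k k] close(2)[OF s, of "j k" k]
            lipdist_nonneg[OF P(1)[OF s] P(2)[OF lr(1)], of "j k" k] by simp
      qed
      show "(\<lambda>k. E (j k) + lipdist (\<mu> (s k)) (\<mu> l)) \<longlonglongrightarrow> 0" using tendsto_add[OF Ej ds] by simp
    qed
  qed
  have "(\<lambda>k. \<bar>L (Yn (j k) (s k)) (\<mu>n (j k) (s k)) - L (Y (s k)) (\<mu> (s k))\<bar>) \<longlonglongrightarrow> 0"
    using tendsto_rabs_zero[OF LIM_zero] tendsto_diff[OF Bt A] by (simp add: tendsto_rabs_zero)
  then have "\<forall>\<^sub>F k in sequentially. \<bar>L (Yn (j k) (s k)) (\<mu>n (j k) (s k)) - L (Y (s k)) (\<mu> (s k))\<bar> < e"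
    using e by (intro order_tendstoD(2)[of _ 0]) auto
  then obtain k where "\<bar>L (Yn (j k) (s k)) (\<mu>n (j k) (s k)) - L (Y (s k)) (\<mu> (s k))\<bar> < e"
    using eventually_happens' sequentially_bot by blast
  then show False using k(3)[of "r k"] by (simp add: s_def j_def)
qed

lemma pde_solution_L_continuous:
  assumes sol: "pde_solution T H G Y0 \<mu>0 u Y \<mu>" shows "continuous_on {0..T} (\<lambda>t. L (Y t) (\<mu> t))"
  unfolding continuous_on_def
proof
  fix t assume t: "t \<in> {0..T}"
  have P: "\<And>t. t \<in> {0..T} \<Longrightarrow> \<mu> t \<in> P1"
    and lim: "((\<lambda>s. chi_dist (Y s, \<mu> s) (Y t, \<mu> t)) \<longlongrightarrow> 0) (at t within {0..T})"
    using sol t unfolding pde_solution_def by auto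
  show "((\<lambda>t. L (Y t) (\<mu> t)) \<longlongrightarrow> L (Y t) (\<mu> t)) (at t within {0..T})"
  proof (rule tendstoI)
    fix e :: real assume "0 < e"
    then obtain d where d: "0 < d" "\<And>Y' \<mu>'. \<mu>' \<in> P1 \<Longrightarrow> chi_dist (Y', \<mu>') (Y t, \<mu> t) < d \<Longrightarrow> \<bar>L Y' \<mu>' - L (Y t) (\<mu> t)\<bar> < e"
      using L_cont P[OF t] unfolding continuous_on_chi_def by blast
    have "\<forall>\<^sub>F s in at t within {0..T}. chi_dist (Y s, \<mu> s) (Y t, \<mu> t) < d"
      using order_tendstoD(2)[OF lim d(1)] .
    moreover have "\<forall>\<^sub>F s in at t within {0..T}. s \<in> {0..T}" by (simp add: eventually_at_filter)
    ultimately show "\<forall>\<^sub>F s in at t within {0..T}. dist (L (Y s) (\<mu> s)) (L (Y t) (\<mu> t)) < e"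
      by eventually_elim (use d(2) P in \<open>auto simp: dist_real_def\<close>)
  qed
qed

text \<open>
  Stability with equal data gives equal agents and measures at \<open>lipdist\<close> 0; a constant sequence
  of such measures converges narrowly, so \<open>L\<close> does not distinguish them.
\<close>

lemma pde_solution_cost_unique:
  assumes sol: "pde_solution T H G Y0 \<mu>0 u Y \<mu>" "pde_solution T H G Y0 \<mu>0 u Y' \<nu>"
    and u: "AE t in lebesgue_on {0..T}. norm (u t) \<le> B"
  shows "cost T L u Y \<mu> = cost T L u Y' \<nu>"
proof -
  have P: "\<And>t. t \<in> {0..T} \<Longrightarrow> \<mu> t \<in> P1" "\<And>t. t \<in> {0..T} \<Longrightarrow> \<nu> t \<in> P1" "\<mu>0 \<in> P1"
    using sol T_pos unfolding pde_solution_def by force+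
  obtain R1 where R1: "0 < R1" "\<And>t. t \<in> {0..T} \<Longrightarrow> measure_support (\<mu> t) \<subseteq> ball 0 R1"
    using sol(1) unfolding pde_solution_def by auto
  obtain R2 where R2: "0 < R2" "\<And>t. t \<in> {0..T} \<Longrightarrow> measure_support (\<nu> t) \<subseteq> ball 0 R2"
    using sol(2) unfolding pde_solution_def by auto
  define R where "R = max R1 R2"
  have supp: "AE x in \<mu> t. norm x \<le> R" "AE x in \<nu> t. norm x \<le> R" if t: "t \<in> {0..T}" for t
    using AE_support_imp[OF P1_D(2)[OF P(1)[OF t]] R1(2)[OF t]] AE_support_imp[OF P1_D(2)[OF P(2)[OF t]] R2(2)[OF t]]
    by (auto simp: R_def elim!: eventually_mono)
  have R: "0 \<le> R" using R1 by (simp add: R_def)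
  define S where "S = norm Y0"
  obtain C where C: "stability_constant TYPE('m) R S C"
    using pde_stability[OF R, of S] by (elim exE conjE)
  have "norm (Y t - Y' t) \<le> 0 * T \<and> lipdist (\<mu> t) (\<nu> t) \<le> C * (lipdist \<mu>0 \<mu>0 + 0)" if t: "t \<in> {0..T}" for t
    using C[unfolded stability_constant_def, rule_format, OF sol u u, of 0 t] supp t by (auto simp: S_def)
  then have eq: "Y t = Y' t" "lipdist (\<nu> t) (\<mu> t) = 0" if t: "t \<in> {0..T}" for t
    using t lipdist_nonneg[OF P(1)[OF t] P(2)[OF t]] lipdist_sym[OF P(1)[OF t] P(2)[OF t]] by (force simp: lipdist_refl[OF P(3)])+
  have "L (Y t) (\<mu> t) = L (Y' t) (\<nu> t)" if t: "t \<in> {0..T}" for t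
  proof -
    have "(\<lambda>k. L (Y' t) (\<nu> t)) \<longlonglongrightarrow> L (Y t) (\<mu> t)"
      using L_sequential[of "\<lambda>_. Y' t" "Y t" "\<lambda>_. \<nu> t" "\<mu> t" R] eq[OF t] P t supp[OF t] R by simp
    then show ?thesis using LIMSEQ_unique tendsto_const by blast
  qed
  then show ?thesis unfolding cost_def by (intro Bochner_Integration.integral_cong) auto
qed

lemma J_pde_eq:
  assumes "pde_solution T H G Y0 \<mu>0 u Y \<mu>" "AE t in lebesgue_on {0..T}. norm (u t) \<le> B"
  shows "J_pde T H G L Y0 \<mu>0 u = cost T L u Y \<mu>"
  unfolding J_pde_def by (rule the_equality) (use assms pde_solution_cost_unique in blast)+

text \<open>
  Every solution of the particle system is a solution of the mean-field equation, where the cost is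
  unique.
\<close>

lemma J_particle_eq:
  assumes N: "1 \<le> N" and R0: "AE x in empirical N X0. norm x \<le> R0" "0 \<le> R0"
    and u: "u \<in> borel_measurable (lebesgue_on {0..T})" "AE t in lebesgue_on {0..T}. norm (u t) \<le> B"
  shows "J_particle T H G L Y0 N X0 u = J_pde T H G L Y0 (empirical N X0) u"
proof -
  obtain Y X where X: "particle_solution T H G N Y0 X0 u Y X"
    using solutions_exist_AE[OF empirical_P1[OF N] R0 u, of Y0] N by blast
  note p = particle_solution_pde[OF X N]
  show ?thesis
    unfolding J_particle_def J_pde_eq[OF p u(2)]
  proof (rule the_equality)
    show "\<exists>Y' X'. particle_solution T H G N Y0 X0 u Y' X' \<and> cost T L u Y (\<lambda>t. empirical N (\<lambda>i. X i t)) = cost T L u Y' (\<lambda>t. empirical N (\<lambda>i. X' i t))"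
      using X by blast
    fix c assume "\<exists>Y X. particle_solution T H G N Y0 X0 u Y X \<and> c = cost T L u Y (\<lambda>t. empirical N (\<lambda>i. X i t))"
    then show "c = cost T L u Y (\<lambda>t. empirical N (\<lambda>i. X i t))"
      using pde_solution_cost_unique[OF _ p u(2)] particle_solution_pde[OF _ N] by blast
  qed
qed


lemma lebesgue_on_finite: "finite_measure (lebesgue_on {0..T})"
  by (rule finite_measureI) (use T_pos in \<open>simp add: emeasure_restrict_space\<close>)

lemma control_cost_integrable:
  fixes u :: "real \<Rightarrow> (real^'d)^'m"
  assumes u: "u \<in> borel_measurable (lebesgue_on {0..T})" "AE t in lebesgue_on {0..T}. norm (u t) \<le> B"
  shows "integrable (lebesgue_on {0..T}) (\<lambda>t. \<Sum>k\<in>UNIV. (norm (u t $ k))\<^sup>2)"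
proof -
  interpret finite_measure "lebesgue_on {0..T}" by (rule lebesgue_on_finite)
  have "(\<lambda>v::(real^'d)^'m. \<Sum>k\<in>UNIV. (norm (v $ k))\<^sup>2) \<in> borel_measurable borel"
    by (intro borel_measurable_continuous_onI continuous_intros)
  then have m: "(\<lambda>t. \<Sum>k\<in>UNIV. (norm (u t $ k))\<^sup>2) \<in> borel_measurable (lebesgue_on {0..T})"
    by (rule measurable_compose[OF u(1)])
  show ?thesis
  proof (rule integrable_const_bound[OF _ m])
    show "AE t in lebesgue_on {0..T}. norm (\<Sum>k\<in>UNIV. (norm (u t $ k))\<^sup>2) \<le> (\<Sum>k\<in>(UNIV::'m set). B\<^sup>2)"
      using u(2)
    proof eventually_elim
      case (elim t)
      have "(norm (u t $ k))\<^sup>2 \<le> B\<^sup>2" for k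
        using elim Finite_Cartesian_Product.norm_nth_le[of "u t" k] by (intro power_mono) auto
      then have "(\<Sum>k\<in>UNIV. (norm (u t $ k))\<^sup>2) \<le> (\<Sum>k\<in>(UNIV::'m set). B\<^sup>2)" by (intro sum_mono)
      moreover have "0 \<le> (\<Sum>k\<in>UNIV. (norm (u t $ k))\<^sup>2)" by (intro sum_nonneg) simp
      ultimately show ?case by simp
    qed
  qed
qed

lemma control_cost_diff:
  fixes a b :: "(real^'d)^'m"
  assumes "norm a \<le> B" "norm b \<le> B" "norm (a - b) \<le> \<kappa>"
  shows "\<bar>(\<Sum>k\<in>UNIV. (norm (a $ k))\<^sup>2) - (\<Sum>k\<in>UNIV. (norm (b $ k))\<^sup>2)\<bar> \<le> real CARD('m) * (2 * B * \<kappa>)"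
proof -
  have "\<bar>(norm (a $ k))\<^sup>2 - (norm (b $ k))\<^sup>2\<bar> \<le> 2 * B * \<kappa>" for k
  proof -
    have n: "norm (a $ k) \<le> B" "norm (b $ k) \<le> B" "norm ((a - b) $ k) \<le> \<kappa>"
      using assms Finite_Cartesian_Product.norm_nth_le order_trans by blast+
    have "\<bar>(norm (a $ k))\<^sup>2 - (norm (b $ k))\<^sup>2\<bar> = \<bar>norm (a $ k) + norm (b $ k)\<bar> * \<bar>norm (a $ k) - norm (b $ k)\<bar>"
      unfolding abs_mult[symmetric] by (intro arg_cong[where f=abs]) (simp add: power2_eq_square algebra_simps)
    also have "\<dots> \<le> (2 * B) * \<kappa>"
      using n norm_triangle_ineq3[of "a $ k" "b $ k"] B_nonneg by (intro mult_mono) auto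
    finally show ?thesis .
  qed
  then have "(\<Sum>k\<in>UNIV. \<bar>(norm (a $ k))\<^sup>2 - (norm (b $ k))\<^sup>2\<bar>) \<le> (\<Sum>k\<in>(UNIV::'m set). 2 * B * \<kappa>)" by (intro sum_mono)
  then show ?thesis
    unfolding sum_subtractf[symmetric] by (intro order_trans[OF sum_abs]) simp
qed

theorem J_pde_convergence:
  fixes Y0 :: "(real^'d)^'m"
  assumes \<mu>0: "\<mu>0 \<in> P1" "AE x in \<mu>0. norm x \<le> R0" "0 \<le> R0"
    and \<nu>: "\<And>n. \<nu> n \<in> P1" "\<And>n. AE x in \<nu> n. norm x \<le> R0" "(\<lambda>n. lipdist (\<nu> n) \<mu>0) \<longlonglongrightarrow> 0"
    and u: "u \<in> borel_measurable (lebesgue_on {0..T})" "AE t in lebesgue_on {0..T}. norm (u t) \<le> B"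
    and v: "\<And>n. v n \<in> borel_measurable (lebesgue_on {0..T})" "\<And>n. AE t in lebesgue_on {0..T}. norm (v n t) \<le> B"
    and \<kappa>: "\<And>n. AE t in lebesgue_on {0..T}. norm (v n t - u t) \<le> \<kappa> n" "\<And>n. 0 \<le> \<kappa> n" "\<kappa> \<longlonglongrightarrow> 0"
  shows "(\<lambda>n. J_pde T H G L Y0 (\<nu> n) (v n)) \<longlonglongrightarrow> J_pde T H G L Y0 \<mu>0 u"
proof -
  interpret finite_measure "lebesgue_on {0..T}" by (rule lebesgue_on_finite)
  define R where "R = R0 + speed * T"
  define S where "S = norm Y0"
  have R: "0 \<le> R" using \<mu>0(3) speed_nonneg T_pos by (simp add: R_def)
  obtain Y \<mu> where sol: "pde_solution T H G Y0 \<mu>0 u Y \<mu>" and supp: "\<forall>t\<in>{0..T}. AE x in \<mu> t. norm x \<le> R"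
    using solutions_exist_AE[OF \<mu>0 u, of Y0] unfolding R_def by (elim exE conjE)
  have "\<exists>Z. pde_solution T H G Y0 (\<nu> n) (v n) (fst Z) (snd Z) \<and> (\<forall>t\<in>{0..T}. AE x in snd Z t. norm x \<le> R)" for n
  proof -
    obtain Y \<mu> where "pde_solution T H G Y0 (\<nu> n) (v n) Y \<mu>" "\<forall>t\<in>{0..T}. AE x in \<mu> t. norm x \<le> R"
      using solutions_exist_AE[OF \<nu>(1)[of n] \<nu>(2)[of n] \<mu>0(3) v(1)[of n] v(2)[of n], of Y0] unfolding R_def by (elim exE conjE)
    then show ?thesis by (intro exI[of _ "(Y, \<mu>)"]) (unfold fst_conv snd_conv, blast)
  qed
  then have "\<exists>Z. \<forall>n. pde_solution T H G Y0 (\<nu> n) (v n) (fst (Z n)) (snd (Z n)) \<and> (\<forall>t\<in>{0..T}. AE x in snd (Z n) t. norm x \<le> R)"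
    by (intro choice allI)
  then obtain Z where Z: "\<forall>n. pde_solution T H G Y0 (\<nu> n) (v n) (fst (Z n)) (snd (Z n)) \<and> (\<forall>t\<in>{0..T}. AE x in snd (Z n) t. norm x \<le> R)" ..
  define Yn where "Yn = (\<lambda>n. fst (Z n))"
  define \<mu>n where "\<mu>n = (\<lambda>n. snd (Z n))"
  have soln: "pde_solution T H G Y0 (\<nu> n) (v n) (Yn n) (\<mu>n n)" and suppn: "\<forall>t\<in>{0..T}. AE x in \<mu>n n t. norm x \<le> R" for n
    using spec[OF Z, of n] unfolding Yn_def \<mu>n_def by blast+
  have P: "\<mu> t \<in> P1" "\<mu>n n t \<in> P1" if "t \<in> {0..T}" for t n
    using sol soln[of n] that unfolding pde_solution_def by auto
  obtain C where C0: "0 \<le> C" and C: "stability_constant TYPE('m) R S C"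
    using pde_stability[OF R, of S] by (elim exE conjE)
  define E where "E = (\<lambda>n. \<kappa> n * T + C * (lipdist (\<nu> n) \<mu>0 + \<kappa> n))"
  have close: "norm (Yn n t - Y t) \<le> E n" "lipdist (\<mu>n n t) (\<mu> t) \<le> E n" if t: "t \<in> {0..T}" for n t
  proof -
    have "norm (Yn n t - Y t) \<le> \<kappa> n * T \<and> lipdist (\<mu>n n t) (\<mu> t) \<le> C * (lipdist (\<nu> n) \<mu>0 + \<kappa> n)"
      using C[unfolded stability_constant_def, rule_format, OF soln sol v(2) u(2) \<kappa>(1,2)] supp suppn t by (simp add: S_def)
    moreover have "0 \<le> \<kappa> n * T" "0 \<le> C * (lipdist (\<nu> n) \<mu>0 + \<kappa> n)"
      using \<kappa>(2) T_pos C0 lipdist_nonneg[OF \<nu>(1) \<mu>0(1)] by (auto intro!: mult_nonneg_nonneg add_nonneg_nonneg)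
    ultimately show "norm (Yn n t - Y t) \<le> E n" "lipdist (\<mu>n n t) (\<mu> t) \<le> E n" by (auto simp: E_def)
  qed
  have "E \<longlonglongrightarrow> 0 * T + C * (0 + 0)" unfolding E_def by (intro tendsto_intros \<kappa>(3) \<nu>(3))
  then have E: "E \<longlonglongrightarrow> 0" by simp
  have Yc: "continuous_on {0..T} Y"
    using sol T_pos caratheodory_continuous[of T Y u] unfolding pde_solution_def by auto
  note \<mu>c = pde_solution_lipdist_continuous[OF sol]
  have Li: "integrable (lebesgue_on {0..T}) (\<lambda>t. L (Y t) (\<mu> t))" "integrable (lebesgue_on {0..T}) (\<lambda>t. L (Yn n t) (\<mu>n n t))" for n
    by (rule continuous_imp_integrable_real[OF pde_solution_L_continuous[OF sol]],
        rule continuous_imp_integrable_real[OF pde_solution_L_continuous[OF soln]])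
  have J: "J_pde T H G L Y0 \<mu>0 u = cost T L u Y \<mu>" "J_pde T H G L Y0 (\<nu> n) (v n) = cost T L (v n) (Yn n) (\<mu>n n)" for n
    by (rule J_pde_eq[OF sol u(2)], rule J_pde_eq[OF soln v(2)])
  have meas: "measure (lebesgue_on {0..T}) (space (lebesgue_on {0..T})) = T"
    using T_pos by (simp add: measure_restrict_space)
  have bound: "\<bar>cost T L (v n) (Yn n) (\<mu>n n) - cost T L u Y \<mu>\<bar> \<le> (e + real CARD('m) * (2 * B * \<kappa> n)) * T"
    if ev: "\<forall>t\<in>{0..T}. \<bar>L (Yn n t) (\<mu>n n t) - L (Y t) (\<mu> t)\<bar> \<le> e" for n e
  proof -
    define f where "f = (\<lambda>t. L (Yn n t) (\<mu>n n t) + (\<Sum>k\<in>UNIV. (norm (v n t $ k))\<^sup>2))"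
    define g where "g = (\<lambda>t. L (Y t) (\<mu> t) + (\<Sum>k\<in>UNIV. (norm (u t $ k))\<^sup>2))"
    have i: "integrable (lebesgue_on {0..T}) f" "integrable (lebesgue_on {0..T}) g"
      unfolding f_def g_def by (intro Bochner_Integration.integrable_add Li control_cost_integrable u v)+
    have "\<bar>\<integral>t. f t - g t \<partial>lebesgue_on {0..T}\<bar> \<le> (\<integral>t. \<bar>f t - g t\<bar> \<partial>lebesgue_on {0..T})" by (rule integral_abs_bound)
    also have "\<dots> \<le> (\<integral>t. e + real CARD('m) * (2 * B * \<kappa> n) \<partial>lebesgue_on {0..T})"
    proof (rule integral_mono_AE)
      show "AE t in lebesgue_on {0..T}. \<bar>f t - g t\<bar> \<le> e + real CARD('m) * (2 * B * \<kappa> n)"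
        using u(2) v(2)[of n] \<kappa>(1)[of n] AE_space
      proof eventually_elim
        case (elim t)
        then have "\<bar>L (Yn n t) (\<mu>n n t) - L (Y t) (\<mu> t)\<bar> \<le> e" using ev by simp
        then show ?case
          using control_cost_diff[OF elim(2,1,3)] unfolding f_def g_def by linarith
      qed
    qed (use i in auto)
    also have "\<dots> = (e + real CARD('m) * (2 * B * \<kappa> n)) * T" using meas by simp
    finally show ?thesis using i by (simp add: cost_def f_def[symmetric] g_def[symmetric])
  qed
  show ?thesis
    unfolding J
  proof (rule LIMSEQ_I)
    fix e :: real assume e: "0 < e"
    define e' where "e' = e / (3 * T)"
    have e': "0 < e'" using e T_pos by (simp add: e'_def)
    have "(\<lambda>n. real CARD('m) * (2 * B * \<kappa> n)) \<longlonglongrightarrow> real CARD('m) * (2 * B * 0)" by (intro tendsto_intros \<kappa>(3))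
    then have "\<forall>\<^sub>F n in sequentially. real CARD('m) * (2 * B * \<kappa> n) < e'"
      using e' by (intro order_tendstoD(2)[of _ 0]) auto
    moreover have "\<forall>\<^sub>F n in sequentially. \<forall>t\<in>{0..T}. \<bar>L (Yn n t) (\<mu>n n t) - L (Y t) (\<mu> t)\<bar> \<le> e'"
      using supp suppn by (intro L_uniform[OF Yc \<mu>c P(2) P(1) _ _ R E close e']) auto
    ultimately have "\<forall>\<^sub>F n in sequentially. norm (cost T L (v n) (Yn n) (\<mu>n n) - cost T L u Y \<mu>) < e"
    proof eventually_elim
      case (elim n)
      have "\<bar>cost T L (v n) (Yn n) (\<mu>n n) - cost T L u Y \<mu>\<bar> \<le> (e' + real CARD('m) * (2 * B * \<kappa> n)) * T"
        by (rule bound[OF elim(2)])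
      also have "\<dots> \<le> (e' + e') * T" using elim(1) T_pos by (intro mult_right_mono) auto
      also have "\<dots> < e" using e T_pos by (simp add: e'_def field_simps)
      finally show ?case by simp
    qed
    then show "\<exists>n0. \<forall>n\<ge>n0. norm (cost T L (v n) (Yn n) (\<mu>n n) - cost T L u Y \<mu>) < e"
      by (simp add: eventually_sequentially)
  qed
qed

end

text \<open>
  Where the essential supremum is infinite, the bound on the controls takes its place; this concerns
  only finitely many indices.
\<close>

lemma Linf_convergesD:
  fixes u :: "real \<Rightarrow> 'a::euclidean_space"
  assumes conv: "Linf_converges T us u"
    and B: "\<And>n. AE t in lebesgue_on {0..T}. norm (us n t) \<le> B" "AE t in lebesgue_on {0..T}. norm (u t) \<le> B" and B0: "0 \<le> B"
  shows "\<exists>\<kappa>. (\<forall>n. AE t in lebesgue_on {0..T}. norm (us n t - u t) \<le> \<kappa> n) \<and> (\<forall>n. 0 \<le> \<kappa> n) \<and> \<kappa> \<longlonglongrightarrow> 0"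
proof -
  define E where "E = (\<lambda>n. esssup (lebesgue_on {0..T}) (\<lambda>t. ereal (norm (us n t - u t))))"
  have E: "E \<longlonglongrightarrow> 0" using conv by (simp add: Linf_converges_def E_def)
  define \<kappa> where "\<kappa> = (\<lambda>n. if \<bar>E n\<bar> = \<infinity> then 2 * B else max 0 (real_of_ereal (E n)))"
  show ?thesis
  proof (intro exI[of _ \<kappa>] conjI allI)
    show "0 \<le> \<kappa> n" for n using B0 by (simp add: \<kappa>_def)
    show "AE t in lebesgue_on {0..T}. norm (us n t - u t) \<le> \<kappa> n" for n
    proof (cases "\<bar>E n\<bar> = \<infinity>")
      case True
      show ?thesis
        using B(1)[of n] B(2)
        by eventually_elim (use True norm_triangle_ineq4 in \<open>auto simp: \<kappa>_def intro: order_trans[OF norm_triangle_ineq4]\<close>)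
    next
      case False
      have "AE t in lebesgue_on {0..T}. ereal (norm (us n t - u t)) \<le> E n" unfolding E_def by (rule esssup_AE)
      then show ?thesis
      proof eventually_elim
        case (elim t)
        then have "norm (us n t - u t) \<le> real_of_ereal (E n)" using False by (cases "E n") auto
        then show ?case using False by (simp add: \<kappa>_def)
      qed
    qed
    have "(\<lambda>n. max 0 (real_of_ereal (E n))) \<longlonglongrightarrow> max 0 0"
      using E by (intro tendsto_max tendsto_const lim_real_of_ereal) (simp add: zero_ereal_def)
    moreover have "\<forall>\<^sub>F n in sequentially. max 0 (real_of_ereal (E n)) = \<kappa> n"
    proof -
      have "\<forall>\<^sub>F n in sequentially. E n < 1" "\<forall>\<^sub>F n in sequentially. - 1 < E n"
        using order_tendstoD[OF E] by (auto simp: one_ereal_def)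
      then show ?thesis by eventually_elim (auto simp: \<kappa>_def)
    qed
    ultimately show "\<kappa> \<longlonglongrightarrow> 0" by (simp add: Lim_transform_eventually)
  qed
qed

theorem theorem3p6:
  fixes H :: "real^'d \<Rightarrow> real^'d"
    and G :: "'d \<Rightarrow> real^'d \<Rightarrow> real^'d"
    and CH :: real and CG :: "'d \<Rightarrow> real"
    and L :: "(real^'d)^'m \<Rightarrow> (real^'d) measure \<Rightarrow> real"
    and U :: "((real^'d)^'m) set"
    and Y0 :: "(real^'d)^'m" and \<mu>0 :: "(real^'d) measure"
    and X0 :: "nat \<Rightarrow> nat \<Rightarrow> real^'d"
    and T :: real
  assumes "T > 0"
    and "bounded (range H)" and "local_lipschitz (UNIV::real set) UNIV (\<lambda>_. H)"
    and "\<And>\<xi>. norm (H \<xi>) \<le> CH * (1 + norm \<xi>)"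
    and "\<And>l. bounded (range (G l))" and "\<And>l. local_lipschitz (UNIV::real set) UNIV (\<lambda>_. G l)"
    and "\<And>l \<xi>. norm (G l \<xi>) \<le> CG l * (1 + norm \<xi>)"
    and "\<And>Y \<mu>. \<mu> \<in> P1 \<Longrightarrow> L Y \<mu> \<ge> 0"
    and "continuous_on_chi L"
    and "\<And>\<mu>s \<mu>. (\<And>j. \<mu>s j \<in> P1) \<Longrightarrow> \<mu> \<in> P1 \<Longrightarrow> narrowly_converges \<mu>s \<mu> \<Longrightarrow>
           uniform_limit UNIV (\<lambda>j Y. L Y (\<mu>s j)) (\<lambda>Y. L Y \<mu>) sequentially"
    and "U \<noteq> {}" and "compact U"
    and "\<mu>0 \<in> P1"
    and "(\<lambda>N. W1 (empirical N (X0 N)) \<mu>0) \<longlonglongrightarrow> 0"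
    and "\<exists>K. compact K \<and> measure_support \<mu>0 \<subseteq> K \<and>
           (\<forall>N\<ge>1. measure_support (empirical N (X0 N)) \<subseteq> K)"
  shows "Gamma_converges (Linf T U) (Linf_converges T)
           (\<lambda>N u. ereal (J_particle T H G L Y0 N (X0 N) u))
           (\<lambda>u. ereal (J_pde T H G L Y0 \<mu>0 u))"
proof -
  obtain MH where MH: "\<And>x. norm (H x) \<le> MH" using assms(2) unfolding bounded_iff by auto
  have "\<exists>c. \<forall>x. norm (G l x) \<le> c" for l using assms(5)[of l] unfolding bounded_iff by auto
  then obtain MG where MG: "\<And>l x. norm (G l x) \<le> MG l" by metis
  define M where "M = MH + (\<Sum>l\<in>UNIV. MG l)"
  have pos: "0 \<le> MH" "\<And>l. 0 \<le> MG l" using MH MG norm_ge_zero order_trans by blast+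
  have M: "norm (H x) \<le> M" "norm (G l x) \<le> M" for l x
  proof -
    have "MH \<le> M" using pos by (simp add: M_def sum_nonneg)
    then show "norm (H x) \<le> M" using MH order_trans by blast
    have "MG l \<le> M" using member_le_sum[of l UNIV MG] pos by (simp add: M_def add_increasing)
    then show "norm (G l x) \<le> M" using MG order_trans by blast
  qed
  obtain B where B: "0 < B" "\<forall>w\<in>U. norm w \<le> B"
    using compact_imp_bounded[OF \<open>compact U\<close>] unfolding bounded_pos by auto
  interpret cost_field H G M B T L
    using assms M B by unfold_locales auto
  obtain K where K: "compact K" "measure_support \<mu>0 \<subseteq> K" "\<And>N. 1 \<le> N \<Longrightarrow> measure_support (empirical N (X0 N)) \<subseteq> K"
    using assms(15) by auto
  obtain R0 where R0: "0 < R0" "\<forall>x\<in>K. norm x \<le> R0"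
    using compact_imp_bounded[OF K(1)] unfolding bounded_pos by auto
  have supp: "AE x in \<nu>. norm x \<le> R0" if "\<nu> \<in> P1" "measure_support \<nu> \<subseteq> K" for \<nu>
    using AE_measure_support[OF P1_D(2)[OF that(1)]] by eventually_elim (use that(2) R0(2) in auto)
  \<comment> \<open>For \<open>N = 0\<close> the empirical measure is not a probability measure, so the sequences start at \<open>N = 1\<close>.\<close>
  define \<nu> where "\<nu> = (\<lambda>n. empirical (Suc n) (X0 (Suc n)))"
  have \<nu>: "\<nu> n \<in> P1" "AE x in \<nu> n. norm x \<le> R0" for n
    unfolding \<nu>_def by (intro supp empirical_P1 K(3); simp)+
  have \<nu>lim: "(\<lambda>n. lipdist (\<nu> n) \<mu>0) \<longlonglongrightarrow> 0"
  proof (rule Lim_null_comparison)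
    show "(\<lambda>n. W1 (\<nu> n) \<mu>0) \<longlonglongrightarrow> 0" using LIMSEQ_Suc[OF assms(14)] by (simp add: \<nu>_def)
    show "\<forall>\<^sub>F n in sequentially. norm (lipdist (\<nu> n) \<mu>0) \<le> W1 (\<nu> n) \<mu>0"
      using lipdist_le_W1[OF \<nu>(1) assms(13)] lipdist_nonneg[OF \<nu>(1) assms(13)] by simp
  qed
  note \<mu>0 = assms(13) supp[OF assms(13) K(2)] less_imp_le[OF R0(1)]
  have lin: "w \<in> borel_measurable (lebesgue_on {0..T})" "AE t in lebesgue_on {0..T}. norm (w t) \<le> B" if "w \<in> Linf T U" for w
    using that B(2) by (auto simp: Linf_def elim!: eventually_mono)
  have lim: "(\<lambda>N. J_particle T H G L Y0 N (X0 N) (us N)) \<longlonglongrightarrow> J_pde T H G L Y0 \<mu>0 u"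
    if u: "u \<in> Linf T U" and us: "range us \<subseteq> Linf T U" and conv: "Linf_converges T us u" for u us
  proof -
    have us': "us n \<in> Linf T U" for n using us by auto
    obtain \<kappa> where \<kappa>: "\<forall>n. AE t in lebesgue_on {0..T}. norm (us n t - u t) \<le> \<kappa> n" "\<forall>n. 0 \<le> \<kappa> n" "\<kappa> \<longlonglongrightarrow> 0"
      using Linf_convergesD[OF conv lin(2)[OF us'] lin(2)[OF u] less_imp_le[OF B(1)]] by (elim exE conjE)
    have "(\<lambda>n. J_pde T H G L Y0 (\<nu> n) (us (Suc n))) \<longlonglongrightarrow> J_pde T H G L Y0 \<mu>0 u"
      by (rule J_pde_convergence[OF \<mu>0 \<nu> \<nu>lim lin[OF u] lin[OF us'] spec[OF \<kappa>(1)] spec[OF \<kappa>(2)] LIMSEQ_Suc[OF \<kappa>(3)]])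
    moreover have "J_particle T H G L Y0 (Suc n) (X0 (Suc n)) (us (Suc n)) = J_pde T H G L Y0 (\<nu> n) (us (Suc n))" for n
      unfolding \<nu>_def by (rule J_particle_eq[OF _ \<nu>(2)[unfolded \<nu>_def] \<mu>0(3) lin[OF us']]) simp
    ultimately have "(\<lambda>n. J_particle T H G L Y0 (Suc n) (X0 (Suc n)) (us (Suc n))) \<longlonglongrightarrow> J_pde T H G L Y0 \<mu>0 u"
      by simp
    then show ?thesis by (rule LIMSEQ_imp_Suc)
  qed
  show ?thesis
    unfolding Gamma_converges_def
  proof (intro conjI ballI allI impI)
    fix u us assume "u \<in> Linf T U" "range us \<subseteq> Linf T U" "Linf_converges T us u"
    then have "(\<lambda>N. ereal (J_particle T H G L Y0 N (X0 N) (us N))) \<longlonglongrightarrow> ereal (J_pde T H G L Y0 \<mu>0 u)"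
      using lim by (intro tendsto_ereal) blast
    from lim_imp_Liminf[OF sequentially_bot this]
    show "ereal (J_pde T H G L Y0 \<mu>0 u) \<le> liminf (\<lambda>N. ereal (J_particle T H G L Y0 N (X0 N) (us N)))"
      by simp
  next
    fix u assume u: "u \<in> Linf T U"
    have "Linf_converges T (\<lambda>_. u) u"
    proof -
      have "esssup (lebesgue_on {0..T}) (\<lambda>t. 0::ereal) = 0"
        using \<open>T > 0\<close> by (intro esssup_const) (simp add: emeasure_restrict_space)
      then show ?thesis by (simp add: Linf_converges_def zero_ereal_def[symmetric])
    qed
    moreover have "range (\<lambda>_. u) \<subseteq> Linf T U" using u by auto
    moreover from lim[OF u this calculation(1)]
    have "(\<lambda>N. ereal (J_particle T H G L Y0 N (X0 N) u)) \<longlonglongrightarrow> ereal (J_pde T H G L Y0 \<mu>0 u)"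
      by (intro tendsto_ereal) simp
    from lim_imp_Limsup[OF sequentially_bot this]
    have "limsup (\<lambda>N. ereal (J_particle T H G L Y0 N (X0 N) u)) \<le> ereal (J_pde T H G L Y0 \<mu>0 u)"
      by simp
    ultimately show "\<exists>us. range us \<subseteq> Linf T U \<and> Linf_converges T us u \<and>
        limsup (\<lambda>N. ereal (J_particle T H G L Y0 N (X0 N) (us N))) \<le> ereal (J_pde T H G L Y0 \<mu>0 u)"
      by blast
  qed
qed

end
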